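(* Let $\mathbb{E} = \langle B,t;\,t^{-1}Ht = K,\,\varphi\rangle$ be an HNN-extension such that $H$ and $K$ are normal in $B$ and $L\varphi = L$, where $L = H\cap K$. Let $\mathcal{C}$ be a root class of groups closed under taking quotient groups. If $B\in\mathcal{C}$, then the following statements are equivalent, and any of them implies that $\mathbb{E}$ is residually a $\mathcal{C}$-group. 1. There exists a homomorphism of $\mathbb{E}$ onto a group from $\mathcal{C}$ acting injectively on the subgroup $B$. 2. $\mathfrak{U}\in\mathcal{C}$ and $\mathfrak{V}\in\mathcal{C}$.
   Context: Classes of groups are closed under isomorphism. Maps are written on the right and composed from left to right. $\mathbb{E} = \langle B,t;\,t^{-1}Ht = K,\,\varphi\rangle$ denotes the HNN-extension of a group $B$ with stable letter $t$ and subgroups $H,K\leqslant B$ associated according to an isomorphism $\varphi\colon H\to K$ (so $t^{-1}ht = h\varphi$ for $h\in H$); $B$ is identified with its image in $\mathbb{E}$. For a group $X$ with normal subgroup $Y$, $\operatorname{Aut}_X(Y)\leqslant\operatorname{Aut}Y$ is the group of restrictions to $Y$ of all inner automorphisms of $X$; $\operatorname{sgp}\{\cdot\}$ denotes the generated subgroup. With $H,K$ normal in $B$, $L=H\cap K$ and $L\varphi=L$, put $\mathfrak{H}=\operatorname{Aut}_B(H)$, $\mathfrak{K}=\varphi\operatorname{Aut}_B(K)\varphi^{-1}$, $\mathfrak{U}=\operatorname{sgp}\{\mathfrak{H},\mathfrak{K}\}$ (subgroups of $\operatorname{Aut}H$); and $\mathfrak{L}=\operatorname{Aut}_B(L)$,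 $\mathfrak{F}=\operatorname{sgp}\{\varphi|_L\}$, $\mathfrak{V}=\operatorname{sgp}\{\mathfrak{L},\mathfrak{F}\}$ (subgroups of $\operatorname{Aut}L$). A group $X$ is residually a $\mathcal{C}$-group if every non-trivial element of $X$ has non-trivial image under some homomorphism of $X$ onto a group from $\mathcal{C}$. A class $\mathcal{C}$ is a root class if it contains non-trivial groups, is closed under taking subgroups, and satisfies any of the following (equivalent) conditions: (1) for every group $X$ and every subnormal series $1\leqslant Z\leqslant Y\leqslant X$ with $X/Y,Y/Z\in\mathcal{C}$ there is a normal subgroup $T$ of $X$ with $X/T\in\mathcal{C}$ and $T\leqslant Z$; (2) $\mathcal{C}$ is closed under unrestricted wreath products; (3) $\mathcal{C}$ is closed under extensions and, for any $X,Y\in\mathcal{C}$, contains the unrestricted direct product $\prod_{y\in Y}X_y$ with each $X_y\cong X$. *)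

theory Defs
  imports "HOL-Algebra.Bij" "HOL-Algebra.Elementary_Groups" "HOL-Algebra.Product_Groups"
begin

section \<open>Classes of groups\<close>

text \<open>
  A class of groups is represented by a set \<^term>\<open>C :: 'u monoid set\<close>, where the type \<open>'u\<close> plays the
  role of the universe and is left arbitrary.  A group over any other type is regarded as a member
  of the class if it is isomorphic to one of the representatives in \<open>C\<close>.
\<close>

definition group_class :: "'u monoid set \<Rightarrow> bool" where
  "group_class C \<longleftrightarrow>
     (\<forall>X \<in> C. group X) \<and>
     (\<forall>X \<in> C. \<forall>Y. group Y \<and> X \<cong> Y \<longrightarrow> Y \<in> C)"

definition in_class :: "('a, 'm) monoid_scheme \<Rightarrow> 'u monoid set \<Rightarrow> bool"  (infix "in'_class" 50) where
  "G in_class C \<longleftrightarrow> group G \<and> (\<exists>X \<in> C. G \<cong> X)"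

text \<open>
  Root classes, in the form: nontrivial, closed under subgroups, under extensions, and under
  unrestricted direct powers indexed by the elements of a group in the class.  The last condition
  also makes \<open>'u\<close> large enough: all these powers must be isomorphic to groups over \<open>'u\<close>, which in
  particular makes \<open>'u\<close> infinite, so that every extension of a \<open>C\<close>-group by a \<open>C\<close>-group has an
  isomorphic copy over \<open>'u\<close> and it suffices to quantify over such copies.
\<close>

definition extension_closed :: "'u monoid set \<Rightarrow> bool" where
  "extension_closed C \<longleftrightarrow>
     (\<forall>(X :: 'u monoid) N.
        N \<lhd> X \<and> X\<lparr>carrier := N\<rparr> in_class C \<and> (X Mod N) in_class C \<longrightarrow> X in_class C)"

definition root_class :: "'u monoid set \<Rightarrow> bool" where
  "root_class C \<longleftrightarrow>
     group_class C \<and>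
     (\<exists>X \<in> C. carrier X \<noteq> {\<one>\<^bsub>X\<^esub>}) \<and>
     (\<forall>X \<in> C. \<forall>Y. subgroup Y X \<longrightarrow> X\<lparr>carrier := Y\<rparr> in_class C) \<and>
     extension_closed C \<and>
     (\<forall>X \<in> C. \<forall>Y \<in> C. product_group (carrier Y) (\<lambda>_. X) in_class C)"

definition quotient_closed :: "'u monoid set \<Rightarrow> bool" where
  "quotient_closed C \<longleftrightarrow> (\<forall>X \<in> C. \<forall>N. N \<lhd> X \<longrightarrow> (X Mod N) in_class C)"

definition residually :: "('a, 'm) monoid_scheme \<Rightarrow> 'u monoid set \<Rightarrow> bool" where
  "residually G C \<longleftrightarrow>
     (\<forall>x \<in> carrier G. x \<noteq> \<one>\<^bsub>G\<^esub> \<longrightarrow> (\<exists>X \<in> C. \<exists>f \<in> epi G X. f x \<noteq> \<one>\<^bsub>X\<^esub>))"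


section \<open>HNN-extensions\<close>

text \<open>
  The group presented by the generators \<open>B\<close>, \<open>t\<close>, the multiplication table of \<open>B\<close> and the relations
  \<open>t\<^sup>-\<^sup>1 h t = h\<phi>\<close> for \<open>h \<in> H\<close>, as words modulo the least congruence.  Here \<open>\<phi>\<close> is a function
  on the ambient type of which only the values on \<open>H\<close> matter, and \<open>K\<close> is \<open>\<phi> ` H\<close>.
\<close>

datatype 'b hnn_letter = Base 'b | Stable | StableInv

definition hnn_words :: "('b, 'm) monoid_scheme \<Rightarrow> 'b hnn_letter list set" where
  "hnn_words B = lists (Base ` carrier B \<union> {Stable, StableInv})"

inductive hnn_eq ::
    "('b, 'm) monoid_scheme \<Rightarrow> 'b set \<Rightarrow> ('b \<Rightarrow> 'b) \<Rightarrow> 'b hnn_letter list \<Rightarrow> 'b hnn_letter list \<Rightarrow> bool"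
  for B H \<phi> where
  refl: "w \<in> hnn_words B \<Longrightarrow> hnn_eq B H \<phi> w w"
| sym: "hnn_eq B H \<phi> u v \<Longrightarrow> hnn_eq B H \<phi> v u"
| trans: "hnn_eq B H \<phi> u v \<Longrightarrow> hnn_eq B H \<phi> v w \<Longrightarrow> hnn_eq B H \<phi> u w"
| append: "hnn_eq B H \<phi> u u' \<Longrightarrow> hnn_eq B H \<phi> v v' \<Longrightarrow> hnn_eq B H \<phi> (u @ v) (u' @ v')"
| base_mult: "a \<in> carrier B \<Longrightarrow> b \<in> carrier B \<Longrightarrow>
    hnn_eq B H \<phi> [Base a, Base b] [Base (a \<otimes>\<^bsub>B\<^esub> b)]"
| base_one: "hnn_eq B H \<phi> [Base \<one>\<^bsub>B\<^esub>] []"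
| stable_right_inv: "hnn_eq B H \<phi> [Stable, StableInv] []"
| stable_left_inv: "hnn_eq B H \<phi> [StableInv, Stable] []"
| conj: "h \<in> H \<Longrightarrow> hnn_eq B H \<phi> [StableInv, Base h, Stable] [Base (\<phi> h)]"

definition hnn_class ::
    "('b, 'm) monoid_scheme \<Rightarrow> 'b set \<Rightarrow> ('b \<Rightarrow> 'b) \<Rightarrow> 'b hnn_letter list \<Rightarrow> 'b hnn_letter list set" where
  "hnn_class B H \<phi> w = {v. hnn_eq B H \<phi> w v}"

definition hnn_extension ::
    "('b, 'm) monoid_scheme \<Rightarrow> 'b set \<Rightarrow> ('b \<Rightarrow> 'b) \<Rightarrow> 'b hnn_letter list set monoid" where
  "hnn_extension B H \<phi> =
     \<lparr>carrier = hnn_class B H \<phi> ` hnn_words B,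
      mult = \<lambda>P Q. \<Union>u \<in> P. \<Union>v \<in> Q. hnn_class B H \<phi> (u @ v),
      one = hnn_class B H \<phi> []\<rparr>"

text \<open>The image of \<open>B\<close> in the HNN-extension, with which \<open>B\<close> is usually identified.\<close>

definition hnn_base ::
    "('b, 'm) monoid_scheme \<Rightarrow> 'b set \<Rightarrow> ('b \<Rightarrow> 'b) \<Rightarrow> 'b hnn_letter list set set" where
  "hnn_base B H \<phi> = (\<lambda>b. hnn_class B H \<phi> [Base b]) ` carrier B"


section \<open>The automorphism groups attached to an HNN-extension\<close>

text \<open>
  The product in \<^const>\<open>AutoGroup\<close> is \<open>f g = f \<circ> g\<close>, whereas with maps written on the right it is the
  opposite one.  A set of automorphisms generates the same set of automorphisms for either product,
  and the two resulting groups are isomorphic via inversion.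
\<close>

definition Aut_restr :: "('b, 'm) monoid_scheme \<Rightarrow> 'b set \<Rightarrow> ('b \<Rightarrow> 'b) set" where
  "Aut_restr X Y = (\<lambda>x. \<lambda>y \<in> Y. inv\<^bsub>X\<^esub> x \<otimes>\<^bsub>X\<^esub> y \<otimes>\<^bsub>X\<^esub> x) ` carrier X"

text \<open>
  \<open>\<phi> Aut\<^sub>B(K) \<phi>\<^sup>-\<^sup>1\<close> is read from left to right, so that its elements map \<open>h \<in> H\<close> first to \<open>h\<phi> \<in> K\<close>.
\<close>

definition Aut_restr_conj ::
    "('b, 'm) monoid_scheme \<Rightarrow> 'b set \<Rightarrow> 'b set \<Rightarrow> ('b \<Rightarrow> 'b) \<Rightarrow> ('b \<Rightarrow> 'b) set" where
  "Aut_restr_conj B H K \<phi> = (\<lambda>\<alpha>. \<lambda>h \<in> H. inv_into H \<phi> (\<alpha> (\<phi> h))) ` Aut_restr B K"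

definition hnn_U ::
    "('b, 'm) monoid_scheme \<Rightarrow> 'b set \<Rightarrow> 'b set \<Rightarrow> ('b \<Rightarrow> 'b) \<Rightarrow> ('b \<Rightarrow> 'b) monoid" where
  "hnn_U B H K \<phi> =
     subgroup_generated (AutoGroup (B\<lparr>carrier := H\<rparr>)) (Aut_restr B H \<union> Aut_restr_conj B H K \<phi>)"

definition hnn_V :: "('b, 'm) monoid_scheme \<Rightarrow> 'b set \<Rightarrow> ('b \<Rightarrow> 'b) \<Rightarrow> ('b \<Rightarrow> 'b) monoid" where
  "hnn_V B L \<phi> =
     subgroup_generated (AutoGroup (B\<lparr>carrier := L\<rparr>))
       (Aut_restr B L \<union> generate (AutoGroup (B\<lparr>carrier := L\<rparr>)) {restrict \<phi> L})"

end

theory Submission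
  imports Defs "HOL-Algebra.SndIsomorphismGrp" "HOL-Library.Sublist"
begin

text \<open>
  A homomorphism from the HNN-extension to a group \<open>Q\<close> amounts to a homomorphism \<open>\<beta>\<close> from \<open>B\<close> to \<open>Q\<close> and
  an element \<open>\<tau>\<close> with \<open>\<tau>\<inverse> (\<beta> h) \<tau> = \<beta> (h\<phi>)\<close> for \<open>h \<in> H\<close> (\<open>hnn_rep\<close>).

  Suppose that \<open>Q\<close> is in the class and \<open>\<beta>\<close> is injective.  Conjugation by elements \<open>\<beta> b\<close> and
  \<open>\<tau> (\<beta> b) \<tau>\<inverse>\<close> realizes the generators of \<open>U\<close>, the group \<open>hnn_U B H K \<phi>\<close>, on the copy of \<open>H\<close> in \<open>Q\<close>,
  and conjugation by \<open>\<beta> b\<close> and \<open>\<tau>\<inverse>\<close> realizes the generators of \<open>V\<close>, the group \<open>hnn_V B L \<phi>\<close>, on the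
  copy of \<open>L\<close>.  So both are quotients of subgroups of \<open>Q\<close> (\<open>realizable_in_class\<close>).

  Conversely, a target group is built from \<open>B\<close>, \<open>U\<close>, \<open>V\<close> and one nontrivial group \<open>Y\<close> of the class by
  semidirect and unrestricted wreath products, subgroups and quotients, under which the class is
  closed.  The group \<open>U\<close> acts on \<open>H / L\<close>.  Each of \<open>B / K\<close> and \<open>B / H\<close> has a normal subgroup isomorphic to
  \<open>H / L\<close>, on which \<open>B\<close> acts through \<open>U\<close>, with quotient \<open>B / H K\<close>.  A twisted Kaloujnine-Krasner embedding
  (\<open>induced_hom\<close>) maps both of them into the wreath product of the semidirect product of \<open>H / L\<close> and
  \<open>U\<close> with \<open>B / H K\<close>, in such a way that, for \<open>h \<in> H\<close>, the first map at \<open>h\<close> and the second at \<open>h\<phi>\<close> are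
  the same constant function \<open>L h\<close>.  Placed in two coordinates of a wreath product with \<open>Y\<close>, where a
  translation takes one coordinate to the other, these homomorphisms give a representation whose
  kernel on \<open>B\<close> is \<open>H \<inter> K = L\<close> (\<open>hnn_rep_two_coordinates\<close>).  A second twisted embedding, now with the
  semidirect product of \<open>L\<close> and \<open>V\<close>, makes the base homomorphism
  injective.  The stable letter can be lifted as well because two homomorphisms into a wreath product
  that lie over the same homomorphism and agree on its kernel are conjugate (\<open>wreath_homs_conjugate\<close>,
  \<open>hnn_rep_extend_over_kernel\<close>).

  The representation just constructed factors through the HNN-extension, whence \<open>B\<close> embeds into it, and
  injectivity on the image of \<open>B\<close> is injectivity on \<open>B\<close>.

  For residuality, start with a representation injective on the base.  A reduced word describes a path
  without backtracking in the quotient of the Bass-Serre tree by the kernel.  Its vertices are made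
  distinct one by one, each time by a wreath product in which the stable letter gets a nontrivial
  value on the edge just reached and the trivial value on all other edges (\<open>separate_further\<close>).  Thus
  the word is not mapped into the base group.
\<close>

section \<open>Members of a root class\<close>

lemma in_class_iso:
  assumes "group_class C" "G in_class C" "group G'" "G \<cong> G'"
  shows "G' in_class C"
  using assms unfolding in_class_def by (meson group.iso_sym iso_trans)

lemma in_class_group: "G in_class C \<Longrightarrow> group G"
  by (simp add: in_class_def)

lemma inj_hom_iso_image:
  assumes "group G" "group G'" "f \<in> hom G G'" "inj_on f (carrier G)"
  shows "f \<in> iso G (G'\<lparr>carrier := f ` carrier G\<rparr>)"
  using assms by (auto simp: iso_def hom_def bij_betw_def)

lemma hom_image_subgroup:
  assumes "group G" "group G'" "f \<in> hom G G'"
  shows "subgroup (f ` carrier G) G'"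
  using assms group_hom.img_is_subgroup[of G G' f] by (simp add: group_hom_def group_hom_axioms_def)

lemma root_class_group_class: "root_class C \<Longrightarrow> group_class C"
  by (simp add: root_class_def)

lemma root_class_member_group: "root_class C \<Longrightarrow> X \<in> C \<Longrightarrow> group X"
  by (simp add: root_class_def group_class_def)

lemma root_class_member_in_class: "root_class C \<Longrightarrow> X \<in> C \<Longrightarrow> X in_class C"
  unfolding in_class_def using root_class_member_group iso_refl by blast

lemma in_classE:
  assumes "G in_class C"
  obtains X g where "X \<in> C" "g \<in> iso G X"
  using assms by (auto simp: in_class_def is_iso_def)

text \<open>
  A group that embeds into a member of \<open>C\<close> is isomorphic to a subgroup of it.  This is the form in
  which closure under subgroups is used between groups over different types.
\<close>

lemma in_class_embedded:
  assumes C: "root_class C" and "G' in_class C" "group G" and f: "f \<in> hom G G'" "inj_on f (carrier G)"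
  shows "G in_class C"
proof -
  obtain X g where X: "X \<in> C" "g \<in> iso G' X"
    using in_classE[OF assms(2)] .
  have grps: "group G'" "group X"
    using in_class_group[OF assms(2)] root_class_member_group[OF C X(1)] by auto
  let ?h = "g \<circ> f"
  have h: "?h \<in> hom G X" using f(1) X(2) by (auto simp: iso_def intro: hom_compose)
  have inj: "inj_on ?h (carrier G)"
  proof (rule comp_inj_on[OF f(2)])
    show "inj_on g (f ` carrier G)"
      using X(2) f(1) by (auto simp: iso_def bij_betw_def hom_def intro: inj_on_subset)
  qed
  have "X\<lparr>carrier := ?h ` carrier G\<rparr> in_class C"
    using C X(1) hom_image_subgroup[OF assms(3) grps(2) h] unfolding root_class_def by blast
  moreover have "G \<cong> X\<lparr>carrier := ?h ` carrier G\<rparr>"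
    using inj_hom_iso_image[OF assms(3) grps(2) h inj] by (rule is_isoI)
  ultimately show ?thesis
    using in_class_iso[OF root_class_group_class[OF C]] assms(3) group.iso_sym[OF assms(3)]
    by blast
qed

lemma in_class_subgroup:
  assumes "root_class C" "G in_class C" "subgroup S G"
  shows "G\<lparr>carrier := S\<rparr> in_class C"
proof (rule in_class_embedded[OF assms(1,2)])
  show "group (G\<lparr>carrier := S\<rparr>)"
    using assms in_class_group subgroup.subgroup_is_group by blast
  show "(\<lambda>x. x) \<in> hom (G\<lparr>carrier := S\<rparr>) G"
    using subgroup.subset[OF assms(3)] by (auto simp: hom_def)
qed auto

lemma in_class_hom_image:
  assumes C: "root_class C" "quotient_closed C" and "G in_class C" "group G'"
    and f: "f \<in> hom G G'" "f ` carrier G = carrier G'"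
  shows "G' in_class C"
proof -
  obtain X g where X: "X \<in> C" "g \<in> iso G X"
    using in_classE[OF assms(3)] .
  have grps: "group G" "group X"
    using in_class_group[OF assms(3)] root_class_member_group[OF C(1) X(1)] by auto
  obtain k where k: "k \<in> iso X G"
    using group.iso_set_sym[OF grps(1) X(2)] by blast
  let ?h = "f \<circ> k"
  have h: "?h \<in> hom X G'" using f(1) k by (auto simp: iso_def intro: hom_compose)
  have "k ` carrier X = carrier G" using k by (auto simp: iso_def bij_betw_def)
  then have surj: "?h ` carrier X = carrier G'" using f(2) by (metis image_comp)
  interpret group_hom X G' ?h
    using h grps assms(4) by (simp add: group_hom_def group_hom_axioms_def)
  have "X Mod kernel X G' ?h in_class C"
    using C(2) X(1) normal_kernel by (simp add: quotient_closed_def)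
  moreover have "X Mod kernel X G' ?h \<cong> G'"
    using FactGroup_iso_set[OF surj] by (rule is_isoI)
  ultimately show ?thesis
    using in_class_iso[OF root_class_group_class[OF C(1)]] assms(4) by blast
qed

lemma in_class_product_group:
  assumes C: "root_class C" and G: "G in_class C" and Q: "Q in_class C"
  shows "product_group (carrier Q) (\<lambda>_. G) in_class C"
proof -
  obtain X g where X: "X \<in> C" "g \<in> iso G X"
    using in_classE[OF G] .
  obtain Y k where Y: "Y \<in> C" "k \<in> iso Q Y"
    using in_classE[OF Q] .
  have grps: "group G" "group X"
    using in_class_group[OF G] root_class_member_group[OF C X(1)] by auto
  have gX: "g x \<in> carrier X" if "x \<in> carrier G" for x
    using X(2) that by (auto simp: iso_def hom_def)
  have gm: "g (x \<otimes>\<^bsub>G\<^esub> y) = g x \<otimes>\<^bsub>X\<^esub> g y" if "x \<in> carrier G" "y \<in> carrier G" for x y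
    using X(2) that by (auto simp: iso_def hom_def)
  have ginj: "inj_on g (carrier G)" using X(2) by (auto simp: iso_def bij_betw_def)
  have kb: "bij_betw k (carrier Q) (carrier Y)" using Y(2) by (auto simp: iso_def)
  let ?l = "inv_into (carrier Q) k"
  have l: "?l y \<in> carrier Q" if "y \<in> carrier Y" for y
    using bij_betwE[OF bij_betw_inv_into[OF kb]] that by auto
  have lk: "?l (k q) = q" if "q \<in> carrier Q" for q
    using kb that by (simp add: bij_betw_inv_into_left)
  have kY: "k q \<in> carrier Y" if "q \<in> carrier Q" for q
    using kb that by (auto simp: bij_betw_def)
  let ?f = "\<lambda>F. \<lambda>y\<in>carrier Y. g (F (?l y))"
  show ?thesis
  proof (rule in_class_embedded[OF C])
    show "product_group (carrier Y) (\<lambda>_. X) in_class C"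
      using C X(1) Y(1) unfolding root_class_def by blast
    show "group (product_group (carrier Q) (\<lambda>_. G))" using grps by simp
    show "?f \<in> hom (product_group (carrier Q) (\<lambda>_. G)) (product_group (carrier Y) (\<lambda>_. X))"
      using l gX gm by (auto simp: hom_def PiE_iff intro!: restrict_ext)
    show "inj_on ?f (carrier (product_group (carrier Q) (\<lambda>_. G)))"
    proof (rule inj_onI)
      fix F F' assume FF': "F \<in> carrier (product_group (carrier Q) (\<lambda>_. G))"
        "F' \<in> carrier (product_group (carrier Q) (\<lambda>_. G))" "?f F = ?f F'"
      have "F q = F' q" if q: "q \<in> carrier Q" for q
      proof -
        have "g (F q) = g (F' q)"
          using fun_cong[OF FF'(3), of "k q"] q kY lk by simp
        then show ?thesis using ginj FF'(1,2) q by (auto simp: inj_on_def PiE_iff)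
      qed
      then show "F = F'" using FF'(1,2) by (intro PiE_ext[of F "carrier Q" "\<lambda>_. carrier G"]) auto
    qed
  qed
qed

lemma root_class_nontrivial:
  assumes "root_class C"
  obtains Y y where "Y \<in> C" "group Y" "Y in_class C" "y \<in> carrier Y" "y \<noteq> \<one>\<^bsub>Y\<^esub>"
proof -
  obtain Y where Y: "Y \<in> C" "carrier Y \<noteq> {\<one>\<^bsub>Y\<^esub>}" "group Y"
    using assms unfolding root_class_def group_class_def by blast
  moreover have "Y in_class C" using Y unfolding in_class_def by (blast intro: iso_refl)
  moreover have "\<one>\<^bsub>Y\<^esub> \<in> carrier Y" using Y(3) by (simp add: group.is_monoid)
  ultimately show ?thesis using that by blast
qed

text \<open>
  If the universe were finite, some member would have the largest order \<open>n > 1\<close>; but its power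
  indexed by its own elements has order \<open>n ^ n > n\<close>.
\<close>

lemma root_class_infinite_universe:
  fixes C :: "'u monoid set"
  assumes C: "root_class C"
  shows "infinite (UNIV :: 'u set)"
proof
  assume fin: "finite (UNIV :: 'u set)"
  have grow: "\<exists>X' \<in> C. card (carrier X) < card (carrier X')" if X: "X \<in> C" "1 < card (carrier X)" for X
  proof -
    have P: "product_group (carrier X) (\<lambda>_. X) in_class C"
      using C X(1) unfolding root_class_def by blast
    obtain X' k where X': "X' \<in> C" "k \<in> iso (product_group (carrier X) (\<lambda>_. X)) X'"
      using in_classE[OF P] .
    have f: "finite (carrier X)" by (rule finite_subset[OF subset_UNIV fin])
    have "card (carrier X) < 2 ^ card (carrier X)" by simp
    also have "\<dots> \<le> card (carrier X) ^ card (carrier X)" using X(2) by (intro power_mono) auto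
    also have "\<dots> = card (carrier (product_group (carrier X) (\<lambda>_. X)))"
      using f by (simp add: card_PiE)
    also have "\<dots> = card (carrier X')" using iso_same_card[OF is_isoI[OF X'(2)]] .
    finally show ?thesis using X'(1) by blast
  qed
  have "\<exists>X \<in> C. n < card (carrier X) \<and> 1 < card (carrier X)" for n
  proof (induction n)
    case 0
    obtain Y y where Y: "Y \<in> C" "group Y" "y \<in> carrier Y" "y \<noteq> \<one>\<^bsub>Y\<^esub>"
      using root_class_nontrivial[OF C] by metis
    have "{y, \<one>\<^bsub>Y\<^esub>} \<subseteq> carrier Y" using Y by (simp add: group.is_monoid)
    then have "card {y, \<one>\<^bsub>Y\<^esub>} \<le> card (carrier Y)" by (intro card_mono finite_subset[OF subset_UNIV fin])
    then show ?case using Y by force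
  next
    case (Suc n)
    then obtain X where X: "X \<in> C" "n < card (carrier X)" "1 < card (carrier X)" by blast
    from grow[OF X(1,3)] obtain X' where "X' \<in> C" "card (carrier X) < card (carrier X')" by blast
    with X(2,3) show ?case by (intro bexI[of _ X']) auto
  qed
  then obtain X :: "'u monoid" where "card (UNIV :: 'u set) < card (carrier X)" by blast
  then show False using card_mono[OF fin, of "carrier X"] by simp
qed

lemma group_transfer:
  fixes g :: "'a \<Rightarrow> 'u"
  assumes "group G" "inj_on g (carrier G)"
  obtains X :: "'u monoid" where "group X" "g \<in> iso G X"
proof -
  let ?i = "inv_into (carrier G) g"
  let ?X = "\<lparr>carrier = g ` carrier G, mult = (\<lambda>x y. g (?i x \<otimes>\<^bsub>G\<^esub> ?i y)), one = g \<one>\<^bsub>G\<^esub>\<rparr>"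
  interpret G: group G by fact
  have i: "?i (g x) = x" if "x \<in> carrier G" for x
    using assms(2) that by simp
  have h: "g \<in> iso G ?X"
    using assms(2) i by (auto simp: iso_def hom_def bij_betw_def)
  have "group ?X"
  proof (rule groupI)
    fix x assume "x \<in> carrier ?X"
    then obtain a where "a \<in> carrier G" "x = g a" by auto
    then show "\<exists>y\<in>carrier ?X. y \<otimes>\<^bsub>?X\<^esub> x = \<one>\<^bsub>?X\<^esub>"
      using i by (intro bexI[of _ "g (inv\<^bsub>G\<^esub> a)"]) auto
  qed (auto simp: i G.m_assoc)
  from that[OF this h] show ?thesis .
qed

text \<open>
  Closure under extensions is postulated only for groups over the universe.  An extension over any
  other type injects as a set into the product of the quotient and the kernel, hence, the universe
  being infinite, into the universe itself, along which its group structure can be transferred.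
\<close>

lemma in_class_extension:
  fixes C :: "'u monoid set"
  assumes C: "root_class C" and G: "group G" and Q: "Q in_class C" and f: "f \<in> hom G Q"
    and N: "G\<lparr>carrier := kernel G Q f\<rparr> in_class C"
  shows "G in_class C"
proof -
  have gQ: "group Q" using Q by (rule in_class_group)
  interpret f: group_hom G Q f
    using f G gQ by (simp add: group_hom_def group_hom_axioms_def)
  let ?N = "kernel G Q f"
  define r where "r z = (SOME y. y \<in> carrier G \<and> f y = z)" for z
  have r: "r (f x) \<in> carrier G" "f (r (f x)) = f x" if "x \<in> carrier G" for x
    using someI_ex[of "\<lambda>y. y \<in> carrier G \<and> f y = f x"] that by (auto simp: r_def)
  \<comment> \<open>\<open>G\<close> is no larger than \<open>Q \<times> N\<close>, hence has a copy over the universe.\<close>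
  let ?e = "\<lambda>x. (f x, x \<otimes>\<^bsub>G\<^esub> inv\<^bsub>G\<^esub> r (f x))"
  have inj1: "inj_on ?e (carrier G)"
  proof (rule inj_onI)
    fix x x' assume x: "x \<in> carrier G" "x' \<in> carrier G" and eq: "?e x = ?e x'"
    have "x \<otimes>\<^bsub>G\<^esub> inv\<^bsub>G\<^esub> r (f x) = x' \<otimes>\<^bsub>G\<^esub> inv\<^bsub>G\<^esub> r (f x)" using eq by auto
    then show "x = x'" using r(1)[OF x(1)] x by simp
  qed
  have sub1: "?e ` carrier G \<subseteq> carrier Q \<times> ?N"
    using r by (auto simp: kernel_def)
  have emb: "\<exists>g :: _ \<Rightarrow> 'u. inj_on g (carrier K)" if "K in_class C" for K :: "('z, 'm) monoid_scheme"
    using in_classE[OF that] by (metis (no_types, lifting) iso_iff_mon_epi mon_def mem_Collect_eq)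
  obtain g1 :: "_ \<Rightarrow> 'u" where g1: "inj_on g1 (carrier Q)" using emb[OF Q] by blast
  obtain g2 :: "_ \<Rightarrow> 'u" where g2: "inj_on g2 ?N" using emb[OF N] by auto
  obtain p :: "'u \<times> 'u \<Rightarrow> 'u" where "bij_betw p (UNIV \<times> UNIV) UNIV"
    using card_of_Times_same_infinite[OF root_class_infinite_universe[OF C]]
    unfolding card_of_ordIso[symmetric] by blast
  then have p: "inj p" by (simp add: bij_betw_def)
  have p12: "inj_on (map_prod g1 g2) (carrier Q \<times> ?N)" using g1 g2 by (rule map_prod_inj_on)
  have "inj_on (p \<circ> map_prod g1 g2 \<circ> ?e) (carrier G)"
    by (intro comp_inj_on[OF inj1] comp_inj_on[OF inj_on_subset[OF p12 sub1]] inj_on_subset[OF p subset_UNIV])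
  then obtain X :: "'u monoid" and k where X: "group X" "k \<in> iso X G"
    using group_transfer[OF G] group.iso_set_sym[OF G] by metis
  let ?h = "f \<circ> k"
  have h: "?h \<in> hom X Q" using f X(2) by (auto simp: iso_def intro: hom_compose)
  interpret h: group_hom X Q ?h
    using h X gQ by (simp add: group_hom_def group_hom_axioms_def)
  have k: "bij_betw k (carrier X) (carrier G)" "k \<in> hom X G" using X(2) by (auto simp: iso_def)
  have "X\<lparr>carrier := kernel X Q ?h\<rparr> in_class C"
  proof (rule in_class_embedded[OF C N])
    show "group (X\<lparr>carrier := kernel X Q ?h\<rparr>)"
      using X(1) h.subgroup_kernel subgroup.subgroup_is_group by blast
    show "k \<in> hom (X\<lparr>carrier := kernel X Q ?h\<rparr>) (G\<lparr>carrier := ?N\<rparr>)"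
      using k(2) by (auto simp: hom_def kernel_def)
    show "inj_on k (carrier (X\<lparr>carrier := kernel X Q ?h\<rparr>))"
      using k(1) by (auto simp: bij_betw_def kernel_def intro: inj_on_subset)
  qed
  moreover have "X Mod kernel X Q ?h in_class C"
  proof (rule in_class_embedded[OF C Q])
    show "group (X Mod kernel X Q ?h)" using h.normal_kernel normal.factorgroup_is_group by blast
    show "(\<lambda>X. the_elem (?h ` X)) \<in> hom (X Mod kernel X Q ?h) Q" by (rule h.FactGroup_hom)
    show "inj_on (\<lambda>X. the_elem (?h ` X)) (carrier (X Mod kernel X Q ?h))" by (rule h.FactGroup_inj_on)
  qed
  ultimately have "X in_class C"
    using C h.normal_kernel unfolding root_class_def extension_closed_def by blast
  then show ?thesis
    using in_class_iso[OF root_class_group_class[OF C]] G X(2) is_isoI by blast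
qed

section \<open>Semidirect and wreath products\<close>

lemma (in group) mult_inv_cancel [simp]:
  assumes "x \<in> carrier G" "y \<in> carrier G"
  shows "inv x \<otimes> (x \<otimes> y) = y" "x \<otimes> (inv x \<otimes> y) = y"
  using assms by (simp_all flip: m_assoc)

definition acts_on :: "('a, 'm) monoid_scheme \<Rightarrow> ('n, 'k) monoid_scheme \<Rightarrow> ('a \<Rightarrow> 'n \<Rightarrow> 'n) \<Rightarrow> bool" where
  "acts_on A N act \<longleftrightarrow>
     (\<forall>a \<in> carrier A. act a \<in> hom N N) \<and>
     (\<forall>n \<in> carrier N. act \<one>\<^bsub>A\<^esub> n = n) \<and>
     (\<forall>a \<in> carrier A. \<forall>b \<in> carrier A. \<forall>n \<in> carrier N. act (a \<otimes>\<^bsub>A\<^esub> b) n = act a (act b n))"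

definition semidirect ::
    "('n, 'k) monoid_scheme \<Rightarrow> ('a, 'm) monoid_scheme \<Rightarrow> ('a \<Rightarrow> 'n \<Rightarrow> 'n) \<Rightarrow> ('n \<times> 'a) monoid" where
  "semidirect N A act =
     \<lparr>carrier = carrier N \<times> carrier A,
      mult = \<lambda>(n, a) (n', a'). (n \<otimes>\<^bsub>N\<^esub> act a n', a \<otimes>\<^bsub>A\<^esub> a'),
      one = (\<one>\<^bsub>N\<^esub>, \<one>\<^bsub>A\<^esub>)\<rparr>"

lemma semidirect_simps [simp]:
  "carrier (semidirect N A act) = carrier N \<times> carrier A"
  "\<one>\<^bsub>semidirect N A act\<^esub> = (\<one>\<^bsub>N\<^esub>, \<one>\<^bsub>A\<^esub>)"
  "(n, a) \<otimes>\<^bsub>semidirect N A act\<^esub> (n', a') = (n \<otimes>\<^bsub>N\<^esub> act a n', a \<otimes>\<^bsub>A\<^esub> a')"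
  by (simp_all add: semidirect_def)

lemma semidirect_group:
  assumes "group N" "group A" "acts_on A N act"
  shows "group (semidirect N A act)"
proof -
  interpret N: group N by fact
  interpret A: group A by fact
  have act: "act a n \<in> carrier N" if "a \<in> carrier A" "n \<in> carrier N" for a n
    using assms(3) that by (auto simp: acts_on_def hom_def)
  have act_mult: "act a (n \<otimes>\<^bsub>N\<^esub> n') = act a n \<otimes>\<^bsub>N\<^esub> act a n'"
    if "a \<in> carrier A" "n \<in> carrier N" "n' \<in> carrier N" for a n n'
    using assms(3) that by (auto simp: acts_on_def hom_def)
  have act_one: "act \<one>\<^bsub>A\<^esub> n = n" if "n \<in> carrier N" for n
    using assms(3) that by (auto simp: acts_on_def)
  have act_act: "act (a \<otimes>\<^bsub>A\<^esub> b) n = act a (act b n)"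
    if "a \<in> carrier A" "b \<in> carrier A" "n \<in> carrier N" for a b n
    using assms(3) that by (auto simp: acts_on_def)
  show ?thesis
  proof (rule groupI)
    fix x assume "x \<in> carrier (semidirect N A act)"
    then obtain n a where x: "x = (n, a)" "n \<in> carrier N" "a \<in> carrier A" by auto
    have "act (inv\<^bsub>A\<^esub> a) (inv\<^bsub>N\<^esub> n) \<otimes>\<^bsub>N\<^esub> act (inv\<^bsub>A\<^esub> a) n = \<one>\<^bsub>N\<^esub>"
      using x hom_one[OF _ assms(1,1), of "act (inv\<^bsub>A\<^esub> a)"] assms(3)
      by (simp add: acts_on_def flip: act_mult)
    then show "\<exists>y\<in>carrier (semidirect N A act). y \<otimes>\<^bsub>semidirect N A act\<^esub> x = \<one>\<^bsub>semidirect N A act\<^esub>"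
      using x act by (intro bexI[of _ "(act (inv\<^bsub>A\<^esub> a) (inv\<^bsub>N\<^esub> n), inv\<^bsub>A\<^esub> a)"]) auto
  qed (auto simp: act act_one act_mult act_act N.m_assoc A.m_assoc)
qed

text \<open>
  The projection to \<open>A\<close> has a kernel isomorphic to \<open>N\<close>.
\<close>

lemma semidirect_in_class:
  assumes C: "root_class C" and "N in_class C" "A in_class C" "acts_on A N act"
  shows "semidirect N A act in_class C"
proof (rule in_class_extension[OF C _ assms(3), of _ snd])
  have grps: "group N" "group A" using assms(2,3) in_class_group by auto
  interpret N: group N by fact
  interpret A: group A by fact
  show grp: "group (semidirect N A act)" using semidirect_group grps assms(4) by blast
  show snd: "snd \<in> hom (semidirect N A act) A" by (auto simp: hom_def)
  show "semidirect N A act\<lparr>carrier := kernel (semidirect N A act) A snd\<rparr> in_class C"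
  proof (rule in_class_embedded[OF C assms(2), of _ fst])
    show "group (semidirect N A act\<lparr>carrier := kernel (semidirect N A act) A snd\<rparr>)"
      using group_hom.subgroup_kernel[of "semidirect N A act" A snd] grp grps snd
        subgroup.subgroup_is_group by (auto simp: group_hom_def group_hom_axioms_def)
    show "fst \<in> hom (semidirect N A act\<lparr>carrier := kernel (semidirect N A act) A snd\<rparr>) N"
      using assms(4) by (auto simp: hom_def kernel_def acts_on_def)
    show "inj_on fst (carrier (semidirect N A act\<lparr>carrier := kernel (semidirect N A act) A snd\<rparr>))"
      by (auto simp: inj_on_def kernel_def)
  qed
qed

text \<open>
  The unrestricted wreath product with \<open>Q\<close> acting on the coordinates, which are its own elements, by
  right translation: \<open>(F, q) (F', q') = (\<lambda>x. F x F' (x q), q q')\<close>.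
\<close>

definition wreath :: "('g, 'k) monoid_scheme \<Rightarrow> ('q, 'm) monoid_scheme \<Rightarrow> (('q \<Rightarrow> 'g) \<times> 'q) monoid" where
  "wreath G Q =
     semidirect (product_group (carrier Q) (\<lambda>_. G)) Q (\<lambda>q F. \<lambda>x \<in> carrier Q. F (x \<otimes>\<^bsub>Q\<^esub> q))"

lemma wreath_acts_on:
  assumes "group G" "group Q"
  shows "acts_on Q (product_group (carrier Q) (\<lambda>_. G)) (\<lambda>q F. \<lambda>x \<in> carrier Q. F (x \<otimes>\<^bsub>Q\<^esub> q))"
proof -
  interpret Q: group Q by fact
  show ?thesis
    by (auto simp: acts_on_def hom_def PiE_iff Q.m_assoc extensional_def intro!: ext)
qed

lemma wreath_carrier [simp]: "carrier (wreath G Q) = (carrier Q \<rightarrow>\<^sub>E carrier G) \<times> carrier Q"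
  by (simp add: wreath_def)

lemma wreath_one [simp]: "\<one>\<^bsub>wreath G Q\<^esub> = (\<lambda>x \<in> carrier Q. \<one>\<^bsub>G\<^esub>, \<one>\<^bsub>Q\<^esub>)"
  by (simp add: wreath_def)

lemma wreath_mult:
  assumes "group Q" "q \<in> carrier Q"
  shows "(F, q) \<otimes>\<^bsub>wreath G Q\<^esub> (F', q') = (\<lambda>x \<in> carrier Q. F x \<otimes>\<^bsub>G\<^esub> F' (x \<otimes>\<^bsub>Q\<^esub> q), q \<otimes>\<^bsub>Q\<^esub> q')"
  by (auto simp: wreath_def intro!: restrict_ext)

lemma wreath_group: "group G \<Longrightarrow> group Q \<Longrightarrow> group (wreath G Q)"
  unfolding wreath_def by (intro semidirect_group wreath_acts_on product_group) auto

lemma wreath_in_class: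
  "root_class C \<Longrightarrow> G in_class C \<Longrightarrow> Q in_class C \<Longrightarrow> wreath G Q in_class C"
  unfolding wreath_def
  by (intro semidirect_in_class wreath_acts_on in_class_product_group) (auto dest: in_class_group)

lemma wreath_snd_hom:
  assumes "group Q"
  shows "snd \<in> hom (wreath G Q) Q"
  by (auto simp: hom_def wreath_mult[OF assms])

text \<open>
  A homomorphism into a wreath product over a given \<open>\<theta>\<close> is a cocycle: a function \<open>f a x\<close> that is
  multiplicative in \<open>a\<close> along the path from \<open>x\<close> to \<open>x (\<theta> a)\<close>.
\<close>

lemma wreath_homI:
  assumes "group Q" and \<theta>: "\<theta> \<in> hom A Q"
    and "\<And>a x. a \<in> carrier A \<Longrightarrow> x \<in> carrier Q \<Longrightarrow> f a x \<in> carrier G"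
    and "\<And>a b x. a \<in> carrier A \<Longrightarrow> b \<in> carrier A \<Longrightarrow> x \<in> carrier Q \<Longrightarrow>
          f (a \<otimes>\<^bsub>A\<^esub> b) x = f a x \<otimes>\<^bsub>G\<^esub> f b (x \<otimes>\<^bsub>Q\<^esub> \<theta> a)"
  shows "(\<lambda>a. (\<lambda>x \<in> carrier Q. f a x, \<theta> a)) \<in> hom A (wreath G Q)"
proof (rule homI)
  interpret Q: group Q by fact
  have q: "\<theta> a \<in> carrier Q" if "a \<in> carrier A" for a
    using \<theta> that by (auto simp: hom_def)
  fix a b assume ab: "a \<in> carrier A" "b \<in> carrier A"
  have "\<theta> (a \<otimes>\<^bsub>A\<^esub> b) = \<theta> a \<otimes>\<^bsub>Q\<^esub> \<theta> b" using \<theta> ab by (simp add: hom_mult)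
  then show "(\<lambda>x \<in> carrier Q. f (a \<otimes>\<^bsub>A\<^esub> b) x, \<theta> (a \<otimes>\<^bsub>A\<^esub> b)) =
      (\<lambda>x \<in> carrier Q. f a x, \<theta> a) \<otimes>\<^bsub>wreath G Q\<^esub> (\<lambda>x \<in> carrier Q. f b x, \<theta> b)"
    using assms(4)[OF ab] q ab by (auto simp: wreath_mult[OF assms(1)] intro!: restrict_ext)
qed (use assms in \<open>auto simp: hom_def\<close>)

section \<open>Homomorphisms into wreath products\<close>

text \<open>
  \<open>A\<close> acts on \<open>Q\<close> by right translation through \<open>\<theta>\<close>.  With a representative \<open>r q\<close> chosen in the orbit of
  \<open>q\<close>, and \<open>s q\<close> leading from \<open>r q\<close> to \<open>q\<close>, the function \<open>s\<close> is equivariant modulo the kernel of \<open>\<theta>\<close>.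
\<close>

lemma orbit_section:
  assumes "group A" "group Q" and \<theta>: "\<theta> \<in> hom A Q"
  shows "\<exists>r s.
    (\<forall>q \<in> carrier Q. r q \<in> carrier Q \<and> s q \<in> carrier A \<and> r q \<otimes>\<^bsub>Q\<^esub> \<theta> (s q) = q) \<and>
    (\<forall>q \<in> carrier Q. \<forall>a \<in> carrier A.
       r (q \<otimes>\<^bsub>Q\<^esub> \<theta> a) = r q \<and> \<theta> (s (q \<otimes>\<^bsub>Q\<^esub> \<theta> a)) = \<theta> (s q) \<otimes>\<^bsub>Q\<^esub> \<theta> a)"
proof -
  interpret A: group A by fact
  interpret Q: group Q by fact
  interpret \<theta>: group_hom A Q \<theta> using assms by (simp add: group_hom_def group_hom_axioms_def)
  define P where "P q y \<longleftrightarrow> y \<in> carrier Q \<and> (\<exists>a \<in> carrier A. y \<otimes>\<^bsub>Q\<^esub> \<theta> a = q)" for q y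
  define r where "r q = (SOME y. P q y)" for q
  define s where "s q = (SOME a. a \<in> carrier A \<and> r q \<otimes>\<^bsub>Q\<^esub> \<theta> a = q)" for q
  have r: "P q (r q)" if "q \<in> carrier Q" for q
    unfolding r_def by (rule someI[of "P q" q]) (auto simp: P_def that intro!: bexI[of _ "\<one>\<^bsub>A\<^esub>"])
  have s: "s q \<in> carrier A \<and> r q \<otimes>\<^bsub>Q\<^esub> \<theta> (s q) = q" if "q \<in> carrier Q" for q
    unfolding s_def by (rule someI_ex) (use r[OF that] in \<open>auto simp: P_def\<close>)
  have rr: "r (q \<otimes>\<^bsub>Q\<^esub> \<theta> a) = r q" if q: "q \<in> carrier Q" and a: "a \<in> carrier A" for q a
  proof -
    have "P (q \<otimes>\<^bsub>Q\<^esub> \<theta> a) y \<longleftrightarrow> P q y" for y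
    proof
      assume "P (q \<otimes>\<^bsub>Q\<^esub> \<theta> a) y"
      then obtain b where b: "y \<in> carrier Q" "b \<in> carrier A" "y \<otimes>\<^bsub>Q\<^esub> \<theta> b = q \<otimes>\<^bsub>Q\<^esub> \<theta> a"
        by (auto simp: P_def)
      have "y \<otimes>\<^bsub>Q\<^esub> \<theta> (b \<otimes>\<^bsub>A\<^esub> inv\<^bsub>A\<^esub> a) = (y \<otimes>\<^bsub>Q\<^esub> \<theta> b) \<otimes>\<^bsub>Q\<^esub> inv\<^bsub>Q\<^esub> \<theta> a"
        using a b(1,2) by (simp add: Q.m_assoc)
      also have "\<dots> = q" unfolding b(3) using a q by (simp add: Q.m_assoc)
      finally show "P q y"
        using a b(1,2) unfolding P_def by (intro conjI bexI[of _ "b \<otimes>\<^bsub>A\<^esub> inv\<^bsub>A\<^esub> a"]) auto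
    next
      assume "P q y"
      then obtain b where b: "y \<in> carrier Q" "b \<in> carrier A" "y \<otimes>\<^bsub>Q\<^esub> \<theta> b = q"
        by (auto simp: P_def)
      then show "P (q \<otimes>\<^bsub>Q\<^esub> \<theta> a) y"
        using a unfolding P_def by (intro conjI bexI[of _ "b \<otimes>\<^bsub>A\<^esub> a"]) (auto simp flip: Q.m_assoc)
    qed
    then show ?thesis unfolding r_def by presburger
  qed
  have "\<theta> (s (q \<otimes>\<^bsub>Q\<^esub> \<theta> a)) = \<theta> (s q) \<otimes>\<^bsub>Q\<^esub> \<theta> a" if q: "q \<in> carrier Q" and a: "a \<in> carrier A" for q a
  proof -
    have "r q \<otimes>\<^bsub>Q\<^esub> \<theta> (s (q \<otimes>\<^bsub>Q\<^esub> \<theta> a)) = r q \<otimes>\<^bsub>Q\<^esub> (\<theta> (s q) \<otimes>\<^bsub>Q\<^esub> \<theta> a)"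
      using s[of q] s[of "q \<otimes>\<^bsub>Q\<^esub> \<theta> a"] r[of q] rr[OF q a] q a
      by (simp add: P_def flip: Q.m_assoc)
    then show ?thesis
      using s[of q] s[of "q \<otimes>\<^bsub>Q\<^esub> \<theta> a"] r[of q] q a by (simp add: P_def)
  qed
  with r s rr show ?thesis by (intro exI[of _ r] exI[of _ s]) (simp add: P_def)
qed

text \<open>
  A twisted form of the Kaloujnine-Krasner embedding.  The kernel \<open>N\<close> of \<open>\<theta>\<close> is mapped to \<open>G\<close> by
  \<open>\<iota>\<close>, and \<open>\<alpha>\<close> lets \<open>A\<close> act in \<open>G\<close> on the image of \<open>N\<close> as it acts on \<open>N\<close> by conjugation.  The usual
  embedding takes \<open>n\<close> to the function \<open>q \<mapsto> \<iota> (s n s\<inverse>)\<close>, where \<open>s = s q\<close> leads from the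
  representative of the orbit of \<open>q\<close> to \<open>q\<close>; multiplying by the coboundary of \<open>q \<mapsto> \<alpha> (s q)\<close> makes this function constant.  Explicitly, the
  cocycle is \<open>\<iota> (a w\<inverse>) \<alpha> w\<close> with \<open>w = (s q)\<inverse> s (q (\<theta> a))\<close>.  Since \<open>N\<close> is embedded as constants, two
  such homomorphisms can be compared on it even if their transversals have nothing in common.
\<close>

lemma induced_hom:
  assumes "group A" "group G" "group Q" and \<theta>: "\<theta> \<in> hom A Q"
    and \<iota>: "\<iota> \<in> hom (A\<lparr>carrier := kernel A Q \<theta>\<rparr>) G" and \<alpha>: "\<alpha> \<in> hom A G"
    and compat: "\<And>a n. a \<in> carrier A \<Longrightarrow> n \<in> kernel A Q \<theta> \<Longrightarrow>
      \<alpha> a \<otimes>\<^bsub>G\<^esub> \<iota> n = \<iota> (a \<otimes>\<^bsub>A\<^esub> n \<otimes>\<^bsub>A\<^esub> inv\<^bsub>A\<^esub> a) \<otimes>\<^bsub>G\<^esub> \<alpha> a"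
  shows "\<exists>\<beta> \<in> hom A (wreath G Q). (\<forall>a \<in> carrier A. snd (\<beta> a) = \<theta> a) \<and>
    (\<forall>n \<in> kernel A Q \<theta>. \<beta> n = (\<lambda>x \<in> carrier Q. \<iota> n, \<one>\<^bsub>Q\<^esub>))"
proof -
  interpret A: group A by fact
  interpret G: group G by fact
  interpret Q: group Q by fact
  interpret \<theta>: group_hom A Q \<theta> using assms by (simp add: group_hom_def group_hom_axioms_def)
  interpret \<alpha>: group_hom A G \<alpha> using assms by (simp add: group_hom_def group_hom_axioms_def)
  let ?N = "kernel A Q \<theta>"
  have N: "n \<in> ?N \<longleftrightarrow> n \<in> carrier A \<and> \<theta> n = \<one>\<^bsub>Q\<^esub>" for n by (auto simp: kernel_def)
  have \<iota>c: "\<iota> n \<in> carrier G" if "n \<in> ?N" for n using \<iota> that by (auto simp: hom_def)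
  have \<iota>m: "\<iota> (n \<otimes>\<^bsub>A\<^esub> n') = \<iota> n \<otimes>\<^bsub>G\<^esub> \<iota> n'" if "n \<in> ?N" "n' \<in> ?N" for n n'
    using \<iota> that by (auto simp: hom_def)
  obtain r s where
    "\<forall>q \<in> carrier Q. r q \<in> carrier Q \<and> s q \<in> carrier A \<and> r q \<otimes>\<^bsub>Q\<^esub> \<theta> (s q) = q"
    "\<forall>q \<in> carrier Q. \<forall>a \<in> carrier A.
       r (q \<otimes>\<^bsub>Q\<^esub> \<theta> a) = r q \<and> \<theta> (s (q \<otimes>\<^bsub>Q\<^esub> \<theta> a)) = \<theta> (s q) \<otimes>\<^bsub>Q\<^esub> \<theta> a"
    using orbit_section[OF assms(1,3) \<theta>] by auto
  then have rs: "s q \<in> carrier A"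
    "a \<in> carrier A \<Longrightarrow> \<theta> (s (q \<otimes>\<^bsub>Q\<^esub> \<theta> a)) = \<theta> (s q) \<otimes>\<^bsub>Q\<^esub> \<theta> a" if "q \<in> carrier Q" for q a
    using that by auto
  define w where "w a q = inv\<^bsub>A\<^esub> s q \<otimes>\<^bsub>A\<^esub> s (q \<otimes>\<^bsub>Q\<^esub> \<theta> a)" for a q
  have wc: "w a q \<in> carrier A" if "a \<in> carrier A" "q \<in> carrier Q" for a q
    using that rs by (simp add: w_def)
  have ww: "w (a \<otimes>\<^bsub>A\<^esub> b) q = w a q \<otimes>\<^bsub>A\<^esub> w b (q \<otimes>\<^bsub>Q\<^esub> \<theta> a)"
    if "a \<in> carrier A" "b \<in> carrier A" "q \<in> carrier Q" for a b q
    using that rs by (simp add: w_def A.m_assoc Q.m_assoc)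
  have w\<theta>: "\<theta> (w a q) = \<theta> a" if "a \<in> carrier A" "q \<in> carrier Q" for a q
    using that rs by (simp add: w_def)
  have aw: "a \<otimes>\<^bsub>A\<^esub> inv\<^bsub>A\<^esub> w a q \<in> ?N" if "a \<in> carrier A" "q \<in> carrier Q" for a q
    using that wc w\<theta> by (simp add: N)
  define f where "f a q = \<iota> (a \<otimes>\<^bsub>A\<^esub> inv\<^bsub>A\<^esub> w a q) \<otimes>\<^bsub>G\<^esub> \<alpha> (w a q)" for a q
  have "(\<lambda>a. (\<lambda>q \<in> carrier Q. f a q, \<theta> a)) \<in> hom A (wreath G Q)"
  proof (rule wreath_homI[OF assms(3) \<theta>])
    show "f a q \<in> carrier G" if "a \<in> carrier A" "q \<in> carrier Q" for a q
      using that \<iota>c[OF aw[OF that]] wc[OF that] by (simp add: f_def)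
    fix a b q assume ab: "a \<in> carrier A" "b \<in> carrier A" and q: "q \<in> carrier Q"
    let ?q = "q \<otimes>\<^bsub>Q\<^esub> \<theta> a"
    have q': "?q \<in> carrier Q" using ab q by simp
    define u v where "u = w a q" and "v = w b ?q"
    have uv: "u \<in> carrier A" "v \<in> carrier A" using wc ab q q' by (auto simp: u_def v_def)
    define n m where "n = a \<otimes>\<^bsub>A\<^esub> inv\<^bsub>A\<^esub> u" and "m = b \<otimes>\<^bsub>A\<^esub> inv\<^bsub>A\<^esub> v"
    have nm: "n \<in> ?N" "m \<in> ?N" using aw ab q q' by (auto simp: n_def m_def u_def v_def)
    have nmA: "n \<in> carrier A" "m \<in> carrier A" using nm by (auto simp: N)
    have um: "u \<otimes>\<^bsub>A\<^esub> m \<otimes>\<^bsub>A\<^esub> inv\<^bsub>A\<^esub> u \<in> ?N" using nm uv by (simp add: N)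
    have "f a q \<otimes>\<^bsub>G\<^esub> f b ?q = \<iota> n \<otimes>\<^bsub>G\<^esub> (\<alpha> u \<otimes>\<^bsub>G\<^esub> \<iota> m) \<otimes>\<^bsub>G\<^esub> \<alpha> v"
      using \<iota>c nm uv by (simp add: f_def n_def m_def u_def v_def G.m_assoc)
    also have "\<dots> = \<iota> (n \<otimes>\<^bsub>A\<^esub> (u \<otimes>\<^bsub>A\<^esub> m \<otimes>\<^bsub>A\<^esub> inv\<^bsub>A\<^esub> u)) \<otimes>\<^bsub>G\<^esub> \<alpha> (u \<otimes>\<^bsub>A\<^esub> v)"
      using \<iota>c nm uv um by (simp add: compat \<iota>m G.m_assoc)
    also have "n \<otimes>\<^bsub>A\<^esub> (u \<otimes>\<^bsub>A\<^esub> m \<otimes>\<^bsub>A\<^esub> inv\<^bsub>A\<^esub> u) = (a \<otimes>\<^bsub>A\<^esub> b) \<otimes>\<^bsub>A\<^esub> inv\<^bsub>A\<^esub> (u \<otimes>\<^bsub>A\<^esub> v)"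
      using ab uv by (simp add: n_def m_def A.m_assoc A.inv_mult_group)
    also have "u \<otimes>\<^bsub>A\<^esub> v = w (a \<otimes>\<^bsub>A\<^esub> b) q" using ww ab q by (simp add: u_def v_def)
    finally show "f (a \<otimes>\<^bsub>A\<^esub> b) q = f a q \<otimes>\<^bsub>G\<^esub> f b ?q" by (simp add: f_def)
  qed
  moreover have "(\<lambda>q \<in> carrier Q. f n q, \<theta> n) = (\<lambda>q \<in> carrier Q. \<iota> n, \<one>\<^bsub>Q\<^esub>)" if n: "n \<in> ?N" for n
  proof -
    have "w n q = \<one>\<^bsub>A\<^esub>" if "q \<in> carrier Q" for q
      using n that rs by (simp add: w_def N)
    then show ?thesis using n \<iota>c[OF n] by (auto simp: f_def N intro!: restrict_ext)
  qed
  ultimately show ?thesis by (intro bexI[of _ "\<lambda>a. (\<lambda>q \<in> carrier Q. f a q, \<theta> a)"]) simp_all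
qed

text \<open>
  Over a fixed \<open>\<theta>\<close>, a homomorphism into a wreath product is determined up to conjugation by functions
  once its values on the stabilizers of orbit representatives are known, and all these stabilizers
  are the kernel of \<open>\<theta>\<close>.  In the orbit of \<open>r\<close> the conjugating function is \<open>c (r k) = (f k r)\<inverse> (g k r)\<close>,
  where \<open>f\<close> and \<open>g\<close> are the two cocycles; it is well defined because they agree on the kernel.
\<close>

lemma wreath_homs_conjugate:
  assumes "group A" "group G" "group Q"
    and \<beta>: "\<beta>\<^sub>1 \<in> hom A (wreath G Q)" "\<beta>\<^sub>2 \<in> hom A (wreath G Q)"
    and same: "\<And>a. a \<in> carrier A \<Longrightarrow> snd (\<beta>\<^sub>1 a) = snd (\<beta>\<^sub>2 a)"
    and agree: "\<And>a. a \<in> carrier A \<Longrightarrow> snd (\<beta>\<^sub>1 a) = \<one>\<^bsub>Q\<^esub> \<Longrightarrow> \<beta>\<^sub>1 a = \<beta>\<^sub>2 a"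
  shows "\<exists>c \<in> carrier (wreath G Q). snd c = \<one>\<^bsub>Q\<^esub> \<and>
    (\<forall>a \<in> carrier A. \<beta>\<^sub>1 a \<otimes>\<^bsub>wreath G Q\<^esub> c = c \<otimes>\<^bsub>wreath G Q\<^esub> \<beta>\<^sub>2 a)"
proof -
  interpret A: group A by fact
  interpret G: group G by fact
  interpret Q: group Q by fact
  define \<theta> where "\<theta> = snd \<circ> \<beta>\<^sub>1"
  have "\<theta> \<in> hom A Q" unfolding \<theta>_def
    by (rule hom_compose[OF \<beta>(1) wreath_snd_hom[OF assms(3)]])
  then interpret \<theta>: group_hom A Q \<theta> using assms by (simp add: group_hom_def group_hom_axioms_def)
  obtain r s where
    "\<forall>q \<in> carrier Q. r q \<in> carrier Q \<and> s q \<in> carrier A \<and> r q \<otimes>\<^bsub>Q\<^esub> \<theta> (s q) = q"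
    "\<forall>q \<in> carrier Q. \<forall>a \<in> carrier A.
       r (q \<otimes>\<^bsub>Q\<^esub> \<theta> a) = r q \<and> \<theta> (s (q \<otimes>\<^bsub>Q\<^esub> \<theta> a)) = \<theta> (s q) \<otimes>\<^bsub>Q\<^esub> \<theta> a"
    using orbit_section[OF assms(1,3) \<open>\<theta> \<in> hom A Q\<close>] by auto
  then have rs: "r q \<in> carrier Q" "s q \<in> carrier A" "r q \<otimes>\<^bsub>Q\<^esub> \<theta> (s q) = q"
    "a \<in> carrier A \<Longrightarrow> r (q \<otimes>\<^bsub>Q\<^esub> \<theta> a) = r q"
    "a \<in> carrier A \<Longrightarrow> \<theta> (s (q \<otimes>\<^bsub>Q\<^esub> \<theta> a)) = \<theta> (s q) \<otimes>\<^bsub>Q\<^esub> \<theta> a" if "q \<in> carrier Q" for q a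
    using that by auto
  define f g where "f a = fst (\<beta>\<^sub>1 a)" and "g a = fst (\<beta>\<^sub>2 a)" for a
  have b1: "\<beta>\<^sub>1 a = (f a, \<theta> a)" and b2: "\<beta>\<^sub>2 a = (g a, \<theta> a)" if "a \<in> carrier A" for a
    using same[OF that] by (auto simp: f_def g_def \<theta>_def prod_eq_iff)
  have fc: "f a \<in> carrier Q \<rightarrow>\<^sub>E carrier G" "g a \<in> carrier Q \<rightarrow>\<^sub>E carrier G" if "a \<in> carrier A" for a
    using hom_in_carrier[OF \<beta>(1) that] hom_in_carrier[OF \<beta>(2) that] by (auto simp: f_def g_def)
  have fc': "f a q \<in> carrier G" "g a q \<in> carrier G" if "a \<in> carrier A" "q \<in> carrier Q" for a q
    using fc[OF that(1)] that(2) by auto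
  have fm: "f (a \<otimes>\<^bsub>A\<^esub> b) q = f a q \<otimes>\<^bsub>G\<^esub> f b (q \<otimes>\<^bsub>Q\<^esub> \<theta> a)"
    and gm: "g (a \<otimes>\<^bsub>A\<^esub> b) q = g a q \<otimes>\<^bsub>G\<^esub> g b (q \<otimes>\<^bsub>Q\<^esub> \<theta> a)"
    if "a \<in> carrier A" "b \<in> carrier A" "q \<in> carrier Q" for a b q
    using hom_mult[OF \<beta>(1) that(1,2)] hom_mult[OF \<beta>(2) that(1,2)] that
    by (auto simp: b1 b2 wreath_mult[OF assms(3)])
  define d where "d a q = inv\<^bsub>G\<^esub> f a q \<otimes>\<^bsub>G\<^esub> g a q" for a q
  have dc: "d a q \<in> carrier G" if "a \<in> carrier A" "q \<in> carrier Q" for a q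
    using fc'[OF that] by (simp add: d_def)
  \<comment> \<open>\<open>d a q\<close> depends only on the image of \<open>a\<close>\<close>
  have d_ker: "d a q = d b q" if ab: "a \<in> carrier A" "b \<in> carrier A" "\<theta> a = \<theta> b" and q: "q \<in> carrier Q" for a b q
  proof -
    define l where "l = a \<otimes>\<^bsub>A\<^esub> inv\<^bsub>A\<^esub> b"
    have l: "l \<in> carrier A" "\<theta> l = \<one>\<^bsub>Q\<^esub>" using ab by (auto simp: l_def)
    have a: "a = l \<otimes>\<^bsub>A\<^esub> b" using ab by (simp add: l_def A.m_assoc)
    have "f l = g l" using agree[OF l(1)] l by (simp add: b1 b2)
    have "f a q = f l q \<otimes>\<^bsub>G\<^esub> f b q" "g a q = f l q \<otimes>\<^bsub>G\<^esub> g b q"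
      unfolding a using fm[OF l(1) ab(2) q] gm[OF l(1) ab(2) q] l(2) q \<open>f l = g l\<close> by auto
    then show ?thesis
      using fc'(1)[OF l(1) q] fc'[OF ab(2) q] by (simp add: d_def G.inv_mult_group G.m_assoc)
  qed
  have d_mult: "f a (q \<otimes>\<^bsub>Q\<^esub> \<theta> k) \<otimes>\<^bsub>G\<^esub> d (k \<otimes>\<^bsub>A\<^esub> a) q = d k q \<otimes>\<^bsub>G\<^esub> g a (q \<otimes>\<^bsub>Q\<^esub> \<theta> k)"
    if "k \<in> carrier A" "a \<in> carrier A" "q \<in> carrier Q" for k a q
    using that fc' by (simp add: d_def fm gm G.inv_mult_group G.m_assoc)
  define c where "c = (\<lambda>q \<in> carrier Q. d (s q) (r q))"
  have cc: "c \<in> carrier Q \<rightarrow>\<^sub>E carrier G" using dc rs by (auto simp: c_def)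
  show ?thesis
  proof (intro bexI[of _ "(c, \<one>\<^bsub>Q\<^esub>)"] conjI ballI)
    fix a assume a: "a \<in> carrier A"
    have "f a q \<otimes>\<^bsub>G\<^esub> c (q \<otimes>\<^bsub>Q\<^esub> \<theta> a) = c q \<otimes>\<^bsub>G\<^esub> g a q" if q: "q \<in> carrier Q" for q
    proof -
      have "d (s (q \<otimes>\<^bsub>Q\<^esub> \<theta> a)) (r q) = d (s q \<otimes>\<^bsub>A\<^esub> a) (r q)"
        using rs a q by (intro d_ker) auto
      then show ?thesis using d_mult[OF rs(2)[OF q] a rs(1)[OF q]] rs a q by (simp add: c_def)
    qed
    then show "\<beta>\<^sub>1 a \<otimes>\<^bsub>wreath G Q\<^esub> (c, \<one>\<^bsub>Q\<^esub>) = (c, \<one>\<^bsub>Q\<^esub>) \<otimes>\<^bsub>wreath G Q\<^esub> \<beta>\<^sub>2 a"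
      using a by (auto simp: b1 b2 wreath_mult[OF assms(3)] intro!: restrict_ext)
  qed (use cc in auto)
qed

section \<open>Conjugation as a group of automorphisms\<close>

lemma AutoGroup_carrier: "\<sigma> \<in> carrier (AutoGroup G) \<longleftrightarrow> \<sigma> \<in> hom G G \<and> bij_betw \<sigma> (carrier G) (carrier G) \<and> \<sigma> \<in> extensional (carrier G)"
  by (auto simp: AutoGroup_def auto_def Bij_def)

lemma AutoGroup_mult:
  "\<sigma> \<in> carrier (AutoGroup G) \<Longrightarrow> \<rho> \<in> carrier (AutoGroup G) \<Longrightarrow>
   \<sigma> \<otimes>\<^bsub>AutoGroup G\<^esub> \<rho> = compose (carrier G) \<sigma> \<rho>"
  by (auto simp: AutoGroup_def auto_def BijGroup_def)

lemma AutoGroup_one: "\<one>\<^bsub>AutoGroup G\<^esub> = (\<lambda>x \<in> carrier G. x)"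
  by (simp add: AutoGroup_def BijGroup_def)

lemma (in group) AutoGroup_inv:
  assumes "\<sigma> \<in> carrier (AutoGroup G)"
  shows "inv\<^bsub>AutoGroup G\<^esub> \<sigma> = (\<lambda>x \<in> carrier G. inv_into (carrier G) \<sigma> x)"
proof -
  have "\<sigma> \<in> auto G" using assms by (simp add: AutoGroup_def)
  then show ?thesis
    using group.m_inv_consistent[OF group_BijGroup subgroup_auto] inv_BijGroup[of \<sigma> "carrier G"]
    by (simp add: AutoGroup_def auto_def)
qed

lemma (in group) AutoGroup_stabilizer_subgroup:
  assumes "L \<subseteq> carrier G"
  shows "subgroup {\<sigma> \<in> carrier (AutoGroup G). \<sigma> ` L = L} (AutoGroup G)"
proof -
  interpret A: group "AutoGroup G" by (rule AutoGroup)
  show ?thesis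
  proof (rule A.subgroupI)
    have "(\<lambda>x \<in> carrier G. x) ` L = L" using assms by auto
    then show "{\<sigma> \<in> carrier (AutoGroup G). \<sigma> ` L = L} \<noteq> {}"
      using A.one_closed unfolding AutoGroup_one by blast
    fix \<sigma> assume \<sigma>: "\<sigma> \<in> {\<sigma> \<in> carrier (AutoGroup G). \<sigma> ` L = L}"
    then have inj: "inj_on \<sigma> (carrier G)" and L: "\<sigma> ` L = L" and c: "\<sigma> \<in> carrier (AutoGroup G)"
      by (auto simp: AutoGroup_carrier bij_betw_def)
    have "inv_into (carrier G) \<sigma> ` L = inv_into (carrier G) \<sigma> ` (\<sigma> ` L)" by (simp add: L)
    also have "\<dots> = L" by (rule inv_into_image_cancel[OF inj assms])
    finally have "(\<lambda>x \<in> carrier G. inv_into (carrier G) \<sigma> x) ` L = L"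
      using assms by (auto simp: image_def subset_iff)
    then show "inv\<^bsub>AutoGroup G\<^esub> \<sigma> \<in> {\<sigma> \<in> carrier (AutoGroup G). \<sigma> ` L = L}"
      using A.inv_closed[OF c] unfolding AutoGroup_inv[OF c] by blast
    fix \<rho> assume \<rho>: "\<rho> \<in> {\<sigma> \<in> carrier (AutoGroup G). \<sigma> ` L = L}"
    have "compose (carrier G) \<sigma> \<rho> ` L = \<sigma> ` \<rho> ` L"
      using assms by (auto simp: compose_def image_def subset_iff)
    then show "\<sigma> \<otimes>\<^bsub>AutoGroup G\<^esub> \<rho> \<in> {\<sigma> \<in> carrier (AutoGroup G). \<sigma> ` L = L}"
      using \<sigma> \<rho> A.m_closed[of \<sigma> \<rho>] by (simp add: AutoGroup_mult)
  qed auto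
qed

lemma (in group) AutoGroup_acts_on:
  assumes "A \<subseteq> carrier (AutoGroup G)"
  shows "acts_on (AutoGroup G\<lparr>carrier := A\<rparr>) G (\<lambda>\<sigma>. \<sigma>)"
  using assms by (auto simp: acts_on_def AutoGroup_one AutoGroup_mult AutoGroup_carrier subset_iff compose_def)

lemma (in group) AutoGroup_acts_on_quotient:
  assumes A: "A \<subseteq> carrier (AutoGroup G)" and L: "L \<lhd> G" and inv: "\<And>\<sigma>. \<sigma> \<in> A \<Longrightarrow> \<sigma> ` L = L"
  shows "acts_on (AutoGroup G\<lparr>carrier := A\<rparr>) (G Mod L) (`)"
    and "\<And>\<sigma> x. \<sigma> \<in> A \<Longrightarrow> x \<in> carrier G \<Longrightarrow> \<sigma> ` (L #> x) = L #> \<sigma> x"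
proof -
  interpret L: normal L G by fact
  have hom: "\<sigma> (x \<otimes> y) = \<sigma> x \<otimes> \<sigma> y" "\<sigma> x \<in> carrier G"
    if "\<sigma> \<in> A" "x \<in> carrier G" "y \<in> carrier G" for \<sigma> x y
    using that A by (auto simp: AutoGroup_carrier subset_iff hom_def)
  show img: "\<sigma> ` (L #> x) = L #> \<sigma> x" if "\<sigma> \<in> A" "x \<in> carrier G" for \<sigma> x
  proof -
    have "\<sigma> ` (L #> x) = (\<lambda>l. \<sigma> l \<otimes> \<sigma> x) ` L"
      using that hom L.subset by (auto simp: r_coset_def image_def subset_iff)
    also have "\<dots> = (\<lambda>l. l \<otimes> \<sigma> x) ` \<sigma> ` L" by (simp add: image_image)
    also have "\<dots> = L #> \<sigma> x" using inv[OF that(1)] by (auto simp: r_coset_def)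
    finally show ?thesis .
  qed
  have sub: "S \<subseteq> carrier G" if "S \<in> carrier (G Mod L)" for S
    using that r_coset_subset_G[OF L.subset] by (auto simp: carrier_FactGroup)
  show "acts_on (AutoGroup G\<lparr>carrier := A\<rparr>) (G Mod L) (`)"
    unfolding acts_on_def
  proof (intro conjI ballI)
    fix \<sigma> assume \<sigma>: "\<sigma> \<in> carrier (AutoGroup G\<lparr>carrier := A\<rparr>)"
    show "(`) \<sigma> \<in> hom (G Mod L) (G Mod L)"
      using \<sigma> hom by (auto simp: hom_def carrier_FactGroup img L.rcos_sum)
  next
    fix S assume "S \<in> carrier (G Mod L)"
    then show "\<one>\<^bsub>AutoGroup G\<lparr>carrier := A\<rparr>\<^esub> ` S = S"
      using sub[of S] by (auto simp: AutoGroup_one image_def subset_iff)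
  next
    fix \<sigma> \<rho> S assume "\<sigma> \<in> carrier (AutoGroup G\<lparr>carrier := A\<rparr>)" "\<rho> \<in> carrier (AutoGroup G\<lparr>carrier := A\<rparr>)"
      and S: "S \<in> carrier (G Mod L)"
    then have "\<sigma> \<otimes>\<^bsub>AutoGroup G\<^esub> \<rho> = compose (carrier G) \<sigma> \<rho>" using A by (auto intro!: AutoGroup_mult)
    then show "(\<sigma> \<otimes>\<^bsub>AutoGroup G\<lparr>carrier := A\<rparr>\<^esub> \<rho>) ` S = \<sigma> ` \<rho> ` S"
      using sub[OF S] by (auto simp: compose_def image_def subset_iff)
  qed
qed

text \<open>
  Conjugation by \<open>b\<close> on the image of \<open>\<psi>\<close>, carried back to \<open>H\<close>.  Taking \<open>b h b\<inverse>\<close> rather than by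
  \<open>b\<inverse> h b\<close> makes it a homomorphism in \<open>b\<close> for the product \<open>f \<circ> g\<close> of automorphisms.
\<close>

definition conj_aut :: "('b, 'm) monoid_scheme \<Rightarrow> 'b set \<Rightarrow> ('b \<Rightarrow> 'b) \<Rightarrow> 'b \<Rightarrow> 'b \<Rightarrow> 'b" where
  "conj_aut B H \<psi> b = (\<lambda>h \<in> H. inv_into H \<psi> (b \<otimes>\<^bsub>B\<^esub> \<psi> h \<otimes>\<^bsub>B\<^esub> inv\<^bsub>B\<^esub> b))"

text \<open>
  For an HNN-extension this occurs with \<open>\<psi>\<close> the inclusion of \<open>H\<close> (or of \<open>L\<close>), and with \<open>\<psi> = \<phi>\<close>, whose
  image is \<open>K\<close>.
\<close>

locale normal_embedding = group B for B :: "('b, 'm) monoid_scheme" +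
  fixes H :: "'b set" and \<psi> :: "'b \<Rightarrow> 'b"
  assumes H: "subgroup H B" and \<psi>: "\<psi> \<in> hom (B\<lparr>carrier := H\<rparr>) B" and inj: "inj_on \<psi> H"
    and img: "\<psi> ` H \<lhd> B"
begin

lemma \<psi>_mult: "h \<in> H \<Longrightarrow> h' \<in> H \<Longrightarrow> \<psi> (h \<otimes>\<^bsub>B\<^esub> h') = \<psi> h \<otimes>\<^bsub>B\<^esub> \<psi> h'"
  and \<psi>_closed: "h \<in> H \<Longrightarrow> \<psi> h \<in> carrier B"
  using \<psi> by (auto simp: hom_def)

lemma
  assumes "b \<in> carrier B" "h \<in> H"
  shows conj_aut_closed: "conj_aut B H \<psi> b h \<in> H"
    and conj_aut: "\<psi> (conj_aut B H \<psi> b h) = b \<otimes>\<^bsub>B\<^esub> \<psi> h \<otimes>\<^bsub>B\<^esub> inv\<^bsub>B\<^esub> b"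
proof -
  have "b \<otimes>\<^bsub>B\<^esub> \<psi> h \<otimes>\<^bsub>B\<^esub> inv\<^bsub>B\<^esub> b \<in> \<psi> ` H"
    using normal.inv_op_closed2[OF img] assms by blast
  then show "conj_aut B H \<psi> b h \<in> H"
    "\<psi> (conj_aut B H \<psi> b h) = b \<otimes>\<^bsub>B\<^esub> \<psi> h \<otimes>\<^bsub>B\<^esub> inv\<^bsub>B\<^esub> b"
    using assms by (auto simp: conj_aut_def inv_into_into f_inv_into_f simp del: image_iff)
qed

lemma conj_aut_eqI:
  assumes "b \<in> carrier B" "h \<in> H" "h' \<in> H" "\<psi> h' = b \<otimes>\<^bsub>B\<^esub> \<psi> h \<otimes>\<^bsub>B\<^esub> inv\<^bsub>B\<^esub> b"
  shows "conj_aut B H \<psi> b h = h'"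
  using assms conj_aut conj_aut_closed inj by (metis inj_onD)

lemma conj_aut_mult:
  assumes "b \<in> carrier B" "b' \<in> carrier B"
  shows "conj_aut B H \<psi> (b \<otimes>\<^bsub>B\<^esub> b') = compose H (conj_aut B H \<psi> b) (conj_aut B H \<psi> b')"
proof (rule ext)
  fix h
  show "conj_aut B H \<psi> (b \<otimes>\<^bsub>B\<^esub> b') h = compose H (conj_aut B H \<psi> b) (conj_aut B H \<psi> b') h"
  proof (cases "h \<in> H")
    case True
    then show ?thesis
      using assms conj_aut conj_aut_closed \<psi>_closed[OF True]
      by (auto simp: compose_def m_assoc inv_mult_group intro!: conj_aut_eqI)
  qed (simp add: conj_aut_def compose_def)
qed

lemma conj_aut_one: "conj_aut B H \<psi> \<one>\<^bsub>B\<^esub> = (\<lambda>h \<in> H. h)"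
proof (rule ext)
  fix h show "conj_aut B H \<psi> \<one>\<^bsub>B\<^esub> h = (\<lambda>h \<in> H. h) h"
  proof (cases "h \<in> H")
    case True
    then have "conj_aut B H \<psi> \<one>\<^bsub>B\<^esub> h = h" by (intro conj_aut_eqI) (auto simp: \<psi>_closed)
    with True show ?thesis by simp
  qed (simp add: conj_aut_def)
qed

lemma conj_aut_AutoGroup:
  assumes b: "b \<in> carrier B"
  shows "conj_aut B H \<psi> b \<in> carrier (AutoGroup (B\<lparr>carrier := H\<rparr>))"
proof -
  let ?c = "conj_aut B H \<psi>"
  have inv: "?c b' (?c b h) = h" if "b \<in> carrier B" "b' \<in> carrier B" "b' \<otimes>\<^bsub>B\<^esub> b = \<one>\<^bsub>B\<^esub>" "h \<in> H" for b b' h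
  proof -
    have "?c b' (?c b h) = ?c (b' \<otimes>\<^bsub>B\<^esub> b) h"
      unfolding conj_aut_mult[OF that(2,1)] using that(4) by (simp add: compose_def)
    then show ?thesis using that by (simp add: conj_aut_one)
  qed
  have "bij_betw (?c b) H H"
    by (rule bij_betwI[of _ _ _ "?c (inv\<^bsub>B\<^esub> b)"]) (use b conj_aut_closed inv in auto)
  moreover have "?c b \<in> hom (B\<lparr>carrier := H\<rparr>) (B\<lparr>carrier := H\<rparr>)"
  proof (rule homI)
    fix h h' assume "h \<in> carrier (B\<lparr>carrier := H\<rparr>)" "h' \<in> carrier (B\<lparr>carrier := H\<rparr>)"
    then have h: "h \<in> H" "h' \<in> H" by auto
    have "?c b (h \<otimes>\<^bsub>B\<^esub> h') = ?c b h \<otimes>\<^bsub>B\<^esub> ?c b h'"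
      using b h subgroup.m_closed[OF H] conj_aut_closed
      by (intro conj_aut_eqI) (auto simp: conj_aut \<psi>_mult \<psi>_closed m_assoc)
    then show "?c b (h \<otimes>\<^bsub>B\<lparr>carrier := H\<rparr>\<^esub> h') = ?c b h \<otimes>\<^bsub>B\<lparr>carrier := H\<rparr>\<^esub> ?c b h'" by simp
  qed (use b conj_aut_closed in auto)
  moreover have "?c b \<in> extensional H" by (simp add: conj_aut_def)
  ultimately show ?thesis by (simp add: AutoGroup_carrier)
qed

lemma conj_aut_hom:
  assumes "\<And>b. b \<in> carrier B \<Longrightarrow> conj_aut B H \<psi> b \<in> A"
  shows "conj_aut B H \<psi> \<in> hom B (AutoGroup (B\<lparr>carrier := H\<rparr>)\<lparr>carrier := A\<rparr>)"
  using assms conj_aut_AutoGroup conj_aut_mult by (auto simp: hom_def AutoGroup_mult)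

lemma subgroup_group: "group (B\<lparr>carrier := H\<rparr>)"
  using H subgroup.subgroup_is_group by blast

text \<open>
  In the quotient of \<open>B\<close> by \<open>M\<close> the image of \<open>\<psi> ` H\<close> is a normal subgroup isomorphic to \<open>H / L\<close>, with quotient
  \<open>B / N\<close>, and \<open>B\<close> acts on it through \<open>A\<close>.  The twisted Kaloujnine-Krasner embedding of this extension
  sends \<open>\<psi> h\<close> to the constant \<open>L h\<close>: the value involves neither \<open>\<psi>\<close> nor \<open>M\<close>, and the codomain involves them
  only through \<open>N\<close>.  Hence two instances fit together: the inclusion of \<open>H\<close> with
  \<open>M = K\<close>, and \<open>\<phi>\<close> with \<open>M = H\<close>.
\<close>

lemma wreath_hom_with_kernel:
  fixes M L N A
  assumes M: "M \<lhd> B" and L: "L \<lhd> B\<lparr>carrier := H\<rparr>" and L_eq: "L = {h \<in> H. \<psi> h \<in> M}"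
    and N: "N \<lhd> B" "N = M <#>\<^bsub>B\<^esub> \<psi> ` H"
    and A: "subgroup A (AutoGroup (B\<lparr>carrier := H\<rparr>))" "\<And>\<sigma>. \<sigma> \<in> A \<Longrightarrow> \<sigma> ` L = L"
    and cA: "\<And>b. b \<in> carrier B \<Longrightarrow> conj_aut B H \<psi> b \<in> A"
  defines "G \<equiv> semidirect (B\<lparr>carrier := H\<rparr> Mod L) (AutoGroup (B\<lparr>carrier := H\<rparr>)\<lparr>carrier := A\<rparr>) (`)"
  shows "\<exists>\<beta> \<in> hom B (wreath G (B Mod N)).
    (\<forall>h \<in> H. \<beta> (\<psi> h) = (\<lambda>x \<in> carrier (B Mod N). (L #>\<^bsub>B\<^esub> h, \<one>\<^bsub>AutoGroup (B\<lparr>carrier := H\<rparr>)\<^esub>), \<one>\<^bsub>B Mod N\<^esub>)) \<and>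
    (\<forall>b \<in> carrier B. \<beta> b = \<one>\<^bsub>wreath G (B Mod N)\<^esub> \<longleftrightarrow> b \<in> M)"
proof -
  let ?H = "B\<lparr>carrier := H\<rparr>" and ?A = "AutoGroup (B\<lparr>carrier := H\<rparr>)\<lparr>carrier := A\<rparr>"
  let ?c = "conj_aut B H \<psi>" and ?Q = "B Mod N"
  interpret HG: group ?H by (rule subgroup_group)
  interpret Hs: subgroup H B by (rule H)
  interpret M: normal M B by fact
  interpret N: normal N B by fact
  interpret L: normal L ?H by fact
  have gA: "group ?A"
    using subgroup.subgroup_is_group[OF A(1) HG.AutoGroup] .
  interpret A: group ?A by (rule gA)
  have Asub: "A \<subseteq> carrier (AutoGroup ?H)" using subgroup.subset[OF A(1)] .
  have act: "acts_on ?A (?H Mod L) (`)"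
    by (rule HG.AutoGroup_acts_on_quotient[OF Asub L A(2)])
  have actL: "\<sigma> ` (L #>\<^bsub>B\<^esub> x) = L #>\<^bsub>B\<^esub> \<sigma> x" if "\<sigma> \<in> A" "x \<in> H" for \<sigma> x
    using HG.AutoGroup_acts_on_quotient(2)[OF Asub L A(2), of \<sigma> x] that by (simp add: r_coset_def)
  have gG: "group G" unfolding G_def
    by (rule semidirect_group[OF L.factorgroup_is_group gA act])
  have gQ: "group ?Q" by (rule N.factorgroup_is_group)
  have LH: "L \<subseteq> H" using L.subset by simp
  have cos_c: "L #>\<^bsub>B\<^esub> h \<in> carrier (?H Mod L)" if "h \<in> H" for h
    using that by (auto simp: carrier_FactGroup r_coset_def)
  have cos_m: "(L #>\<^bsub>B\<^esub> h) <#>\<^bsub>B\<^esub> (L #>\<^bsub>B\<^esub> h') = L #>\<^bsub>B\<^esub> (h \<otimes>\<^bsub>B\<^esub> h')" if "h \<in> H" "h' \<in> H" for h h'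
    using L.rcos_sum[of h h'] that by (simp add: r_coset_def set_mult_def)
  have cos1: "L #>\<^bsub>B\<^esub> \<one>\<^bsub>B\<^esub> = L" using LH Hs.subset by (auto simp: r_coset_def subset_iff)
  have kern: "kernel B ?Q (\<lambda>b. N #>\<^bsub>B\<^esub> b) = N"
    using N.rcos_const[OF group_axioms] coset_join1[OF _ _ N.subgroup_axioms] N.subset by (auto simp: kernel_def)
  \<comment> \<open>The coset of \<open>L\<close> formed by the \<open>H\<close>-components of \<open>n\<close>.\<close>
  define S where "S n = {h \<in> H. \<psi> h \<otimes>\<^bsub>B\<^esub> inv\<^bsub>B\<^esub> n \<in> M}" for n
  have S: "S (m \<otimes>\<^bsub>B\<^esub> \<psi> h) = L #>\<^bsub>B\<^esub> h" if m: "m \<in> M" and h: "h \<in> H" for m h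
  proof -
    have mB: "m \<in> carrier B" using m M.subset by blast
    have inv\<psi>: "\<psi> (inv\<^bsub>B\<^esub> h) = inv\<^bsub>B\<^esub> \<psi> h"
    proof -
      have "\<psi> (inv\<^bsub>?H\<^esub> h) = inv\<^bsub>B\<^esub> \<psi> h"
        using group_hom.hom_inv[of ?H B \<psi> h] \<psi> h HG.group_axioms group_axioms
        by (simp add: group_hom_def group_hom_axioms_def)
      then show ?thesis using m_inv_consistent[OF H h] by simp
    qed
    have "h' \<in> S (m \<otimes>\<^bsub>B\<^esub> \<psi> h) \<longleftrightarrow> h' \<otimes>\<^bsub>B\<^esub> inv\<^bsub>B\<^esub> h \<in> L" if h': "h' \<in> H" for h'
    proof -
      have "\<psi> h' \<otimes>\<^bsub>B\<^esub> inv\<^bsub>B\<^esub> (m \<otimes>\<^bsub>B\<^esub> \<psi> h) = \<psi> (h' \<otimes>\<^bsub>B\<^esub> inv\<^bsub>B\<^esub> h) \<otimes>\<^bsub>B\<^esub> inv\<^bsub>B\<^esub> m"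
        using mB h h' by (simp add: \<psi>_mult \<psi>_closed inv\<psi> inv_mult_group m_assoc)
      moreover have "\<psi> (h' \<otimes>\<^bsub>B\<^esub> inv\<^bsub>B\<^esub> h) \<otimes>\<^bsub>B\<^esub> inv\<^bsub>B\<^esub> m \<in> M \<longleftrightarrow> \<psi> (h' \<otimes>\<^bsub>B\<^esub> inv\<^bsub>B\<^esub> h) \<in> M" (is "?x \<otimes>\<^bsub>B\<^esub> _ \<in> M \<longleftrightarrow> _")
      proof
        have x: "?x \<in> carrier B" using h h' by (simp add: \<psi>_closed)
        assume "?x \<otimes>\<^bsub>B\<^esub> inv\<^bsub>B\<^esub> m \<in> M"
        from M.m_closed[OF this m] show "?x \<in> M" using x mB by (simp add: m_assoc)
      qed (use m in simp)
      ultimately show ?thesis using h h' by (simp add: S_def L_eq)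
    qed
    moreover have "h' \<otimes>\<^bsub>B\<^esub> inv\<^bsub>B\<^esub> h \<in> L \<longleftrightarrow> h' \<in> L #>\<^bsub>B\<^esub> h" if h': "h' \<in> H" for h'
    proof
      assume "h' \<otimes>\<^bsub>B\<^esub> inv\<^bsub>B\<^esub> h \<in> L"
      then show "h' \<in> L #>\<^bsub>B\<^esub> h" using h h'
        by (auto simp: r_coset_def m_assoc intro!: bexI[of _ "h' \<otimes>\<^bsub>B\<^esub> inv\<^bsub>B\<^esub> h"])
    next
      assume "h' \<in> L #>\<^bsub>B\<^esub> h"
      then show "h' \<otimes>\<^bsub>B\<^esub> inv\<^bsub>B\<^esub> h \<in> L" using h LH by (auto simp: r_coset_def m_assoc subset_iff)
    qed
    moreover have "S (m \<otimes>\<^bsub>B\<^esub> \<psi> h) \<subseteq> H" "L #>\<^bsub>B\<^esub> h \<subseteq> H"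
      using h LH by (auto simp: S_def r_coset_def)
    ultimately show ?thesis by blast
  qed
  have Nex: "\<exists>m \<in> M. \<exists>h \<in> H. n = m \<otimes>\<^bsub>B\<^esub> \<psi> h" if "n \<in> N" for n
    using that N(2) by (auto simp: set_mult_def)
  have MB: "m \<in> carrier B" if "m \<in> M" for m using that M.subset by blast
  let ?\<iota> = "\<lambda>n. (S n, \<one>\<^bsub>AutoGroup ?H\<^esub>)"
  let ?\<alpha> = "\<lambda>b. (L, ?c b)"
  have \<theta>: "(\<lambda>b. N #>\<^bsub>B\<^esub> b) \<in> hom B ?Q" by (rule N.r_coset_hom_Mod)
  have oneA: "\<one>\<^bsub>AutoGroup ?H\<^esub> \<in> A" using subgroup.one_closed[OF A(1)] .
  have img1: "\<one>\<^bsub>AutoGroup ?H\<^esub> ` X = X" if "X \<subseteq> H" for X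
    using that by (auto simp: AutoGroup_one image_def subset_iff)
  have cosH: "L #>\<^bsub>B\<^esub> h \<subseteq> H" if "h \<in> H" for h
    using that LH by (auto simp: r_coset_def)
  have LL: "L <#>\<^bsub>B\<^esub> L = L" using cos_m[of "\<one>\<^bsub>B\<^esub>" "\<one>\<^bsub>B\<^esub>"] by (simp add: cos1)
  have LX: "L <#>\<^bsub>B\<^esub> (L #>\<^bsub>B\<^esub> h) = L #>\<^bsub>B\<^esub> h" "(L #>\<^bsub>B\<^esub> h) <#>\<^bsub>B\<^esub> L = L #>\<^bsub>B\<^esub> h" if "h \<in> H" for h
    using cos_m[of "\<one>\<^bsub>B\<^esub>" h] cos_m[of h "\<one>\<^bsub>B\<^esub>"] that Hs.mem_carrier by (simp_all add: cos1)
  have \<iota>: "?\<iota> \<in> hom (B\<lparr>carrier := kernel B ?Q (\<lambda>b. N #>\<^bsub>B\<^esub> b)\<rparr>) G"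
  proof (rule homI)
    fix n n' assume "n \<in> carrier (B\<lparr>carrier := kernel B ?Q (\<lambda>b. N #>\<^bsub>B\<^esub> b)\<rparr>)"
      "n' \<in> carrier (B\<lparr>carrier := kernel B ?Q (\<lambda>b. N #>\<^bsub>B\<^esub> b)\<rparr>)"
    then have "n \<in> N" "n' \<in> N" by (auto simp: kern)
    then obtain m h m' h' where n: "n = m \<otimes>\<^bsub>B\<^esub> \<psi> h" "n' = m' \<otimes>\<^bsub>B\<^esub> \<psi> h'"
      and mh: "m \<in> M" "h \<in> H" "m' \<in> M" "h' \<in> H" using Nex[of n] Nex[of n'] by auto
    have "\<psi> h \<otimes>\<^bsub>B\<^esub> m' \<otimes>\<^bsub>B\<^esub> inv\<^bsub>B\<^esub> \<psi> h \<in> M"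
      using mh by (intro M.inv_op_closed2) (auto simp: \<psi>_closed)
    moreover have "n \<otimes>\<^bsub>B\<^esub> n' = (m \<otimes>\<^bsub>B\<^esub> (\<psi> h \<otimes>\<^bsub>B\<^esub> m' \<otimes>\<^bsub>B\<^esub> inv\<^bsub>B\<^esub> \<psi> h)) \<otimes>\<^bsub>B\<^esub> \<psi> (h \<otimes>\<^bsub>B\<^esub> h')"
      using mh MB by (simp add: n \<psi>_mult \<psi>_closed m_assoc)
    ultimately have "S (n \<otimes>\<^bsub>B\<^esub> n') = L #>\<^bsub>B\<^esub> (h \<otimes>\<^bsub>B\<^esub> h')" using S mh by simp
    then show "?\<iota> (n \<otimes>\<^bsub>B\<lparr>carrier := kernel B ?Q (\<lambda>b. N #>\<^bsub>B\<^esub> b)\<rparr>\<^esub> n') = ?\<iota> n \<otimes>\<^bsub>G\<^esub> ?\<iota> n'"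
      using mh A.one_closed A.l_one[OF A.one_closed] cosH
      by (simp add: n S G_def img1 cos_m)
  next
    fix n assume "n \<in> carrier (B\<lparr>carrier := kernel B ?Q (\<lambda>b. N #>\<^bsub>B\<^esub> b)\<rparr>)"
    then obtain m h where "n = m \<otimes>\<^bsub>B\<^esub> \<psi> h" "m \<in> M" "h \<in> H"
      using Nex[of n] by (auto simp: kern)
    then show "?\<iota> n \<in> carrier G" using S cos_c oneA by (simp add: G_def)
  qed
  have \<alpha>: "?\<alpha> \<in> hom B G"
  proof (rule homI)
    show "?\<alpha> b \<in> carrier G" if "b \<in> carrier B" for b
      using cA[OF that] cos_c[of "\<one>\<^bsub>B\<^esub>"] by (simp add: G_def cos1)
    show "?\<alpha> (b \<otimes>\<^bsub>B\<^esub> b') = ?\<alpha> b \<otimes>\<^bsub>G\<^esub> ?\<alpha> b'" if "b \<in> carrier B" "b' \<in> carrier B" for b b'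
      using that hom_mult[OF conj_aut_hom[OF cA] that] cA[of b] by (simp add: G_def A(2) LL)
  qed
  have compat: "?\<alpha> b \<otimes>\<^bsub>G\<^esub> ?\<iota> n = ?\<iota> (b \<otimes>\<^bsub>B\<^esub> n \<otimes>\<^bsub>B\<^esub> inv\<^bsub>B\<^esub> b) \<otimes>\<^bsub>G\<^esub> ?\<alpha> b"
    if b: "b \<in> carrier B" and n: "n \<in> N" for b n
  proof -
    obtain m h where n: "n = m \<otimes>\<^bsub>B\<^esub> \<psi> h" and mh: "m \<in> M" "h \<in> H" using Nex[OF n] by auto
    have "b \<otimes>\<^bsub>B\<^esub> m \<otimes>\<^bsub>B\<^esub> inv\<^bsub>B\<^esub> b \<in> M" using b mh by (intro M.inv_op_closed2)
    moreover have "b \<otimes>\<^bsub>B\<^esub> n \<otimes>\<^bsub>B\<^esub> inv\<^bsub>B\<^esub> b = (b \<otimes>\<^bsub>B\<^esub> m \<otimes>\<^bsub>B\<^esub> inv\<^bsub>B\<^esub> b) \<otimes>\<^bsub>B\<^esub> \<psi> (?c b h)"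
      using b mh MB by (simp add: n conj_aut \<psi>_closed m_assoc)
    ultimately have "S (b \<otimes>\<^bsub>B\<^esub> n \<otimes>\<^bsub>B\<^esub> inv\<^bsub>B\<^esub> b) = L #>\<^bsub>B\<^esub> ?c b h"
      using S b mh conj_aut_closed by simp
    moreover have "S n = L #>\<^bsub>B\<^esub> h" using S n mh by simp
    ultimately show ?thesis
      using cA[OF b] mh b conj_aut_closed[OF b] A.l_one[of "?c b"] A.r_one[of "?c b"]
      by (simp add: G_def actL LX img1[OF LH])
  qed
  have "\<exists>\<beta> \<in> hom B (wreath G ?Q). (\<forall>b \<in> carrier B. snd (\<beta> b) = N #>\<^bsub>B\<^esub> b) \<and>
      (\<forall>n \<in> N. \<beta> n = (\<lambda>x \<in> carrier ?Q. ?\<iota> n, \<one>\<^bsub>?Q\<^esub>))"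
    by (rule induced_hom[OF group_axioms gG gQ \<theta> \<iota> \<alpha>, unfolded kern, OF compat])
  then obtain \<beta> where \<beta>: "\<beta> \<in> hom B (wreath G ?Q)"
    "\<forall>b \<in> carrier B. snd (\<beta> b) = N #>\<^bsub>B\<^esub> b"
    "\<forall>n \<in> N. \<beta> n = (\<lambda>x \<in> carrier ?Q. ?\<iota> n, \<one>\<^bsub>?Q\<^esub>)"
    by blast
  have \<psi>N: "\<psi> h \<in> N" if "h \<in> H" for h
  proof -
    have "\<psi> h = \<one>\<^bsub>B\<^esub> \<otimes>\<^bsub>B\<^esub> \<psi> h" using \<psi>_closed[OF that] by simp
    then show ?thesis using that N(2) M.one_closed unfolding set_mult_def by blast
  qed
  have MN: "m \<in> N" if "m \<in> M" for m
  proof -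
    have "m = m \<otimes>\<^bsub>B\<^esub> \<psi> \<one>\<^bsub>B\<^esub>"
      using MB[OF that] hom_one[OF \<psi> HG.group_axioms group_axioms] by simp
    then show ?thesis using that N(2) Hs.one_closed unfolding set_mult_def by blast
  qed
  have neQ: "\<one>\<^bsub>?Q\<^esub> \<in> carrier ?Q" by (rule monoid.one_closed[OF group.is_monoid[OF gQ]])
  show ?thesis
  proof (intro bexI[OF _ \<beta>(1)] conjI ballI)
    fix h assume h: "h \<in> H"
    have "S (\<psi> h) = L #>\<^bsub>B\<^esub> h" using S[OF M.one_closed h] \<psi>_closed[OF h] by simp
    then show "\<beta> (\<psi> h) = (\<lambda>x \<in> carrier (B Mod N). (L #>\<^bsub>B\<^esub> h, \<one>\<^bsub>AutoGroup (B\<lparr>carrier := H\<rparr>)\<^esub>), \<one>\<^bsub>B Mod N\<^esub>)"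
      using \<beta>(3) \<psi>N[OF h] by simp
  next
    fix b assume b: "b \<in> carrier B"
    have S1: "S b = L \<longleftrightarrow> b \<in> M" if bN: "b \<in> N"
    proof -
      obtain m h where n: "b = m \<otimes>\<^bsub>B\<^esub> \<psi> h" and mh: "m \<in> M" "h \<in> H" using Nex[OF bN] by auto
      have "S b = L \<longleftrightarrow> L #>\<^bsub>B\<^esub> h = L" using S n mh by simp
      also have "\<dots> \<longleftrightarrow> h \<in> L"
      proof
        assume "L #>\<^bsub>B\<^esub> h = L"
        moreover have "\<one>\<^bsub>B\<^esub> \<otimes>\<^bsub>B\<^esub> h \<in> L #>\<^bsub>B\<^esub> h" using L.one_closed by (auto simp: r_coset_def)
        ultimately show "h \<in> L" using mh by simp
      next
        assume "h \<in> L"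
        then show "L #>\<^bsub>B\<^esub> h = L" using L.rcos_const[OF HG.group_axioms, of h] by (simp add: r_coset_def)
      qed
      also have "\<dots> \<longleftrightarrow> \<psi> h \<in> M" using mh by (simp add: L_eq)
      also have "\<dots> \<longleftrightarrow> b \<in> M"
      proof
        assume "b \<in> M"
        then have "inv\<^bsub>B\<^esub> m \<otimes>\<^bsub>B\<^esub> b \<in> M" using mh by simp
        then show "\<psi> h \<in> M" using mh MB by (simp add: n \<psi>_closed)
      qed (use mh n in simp)
      finally show ?thesis .
    qed
    show "\<beta> b = \<one>\<^bsub>wreath G (B Mod N)\<^esub> \<longleftrightarrow> b \<in> M"
    proof
      assume one: "\<beta> b = \<one>\<^bsub>wreath G (B Mod N)\<^esub>"
      then have "N #>\<^bsub>B\<^esub> b = \<one>\<^bsub>?Q\<^esub>" using \<beta>(2) b by (metis snd_conv wreath_one)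
      then have "b \<in> N" using kern b by (auto simp: kernel_def)
      moreover have "S b = L"
        using one \<beta>(3) \<open>b \<in> N\<close> neQ by (auto simp: G_def dest!: fun_cong[of _ _ "\<one>\<^bsub>?Q\<^esub>"])
      ultimately show "b \<in> M" using S1 by simp
    next
      assume "b \<in> M"
      then show "\<beta> b = \<one>\<^bsub>wreath G (B Mod N)\<^esub>" using S1 MN \<beta>(3) by (simp add: G_def)
    qed
  qed
qed

end

section \<open>Representations injective on the base group\<close>

text \<open>
  The data of a homomorphism from the HNN-extension to \<open>Q\<close>.
\<close>

definition hnn_rep ::
    "('b, 'm) monoid_scheme \<Rightarrow> 'b set \<Rightarrow> ('b \<Rightarrow> 'b) \<Rightarrow> ('q, 'k) monoid_scheme \<Rightarrow> ('b \<Rightarrow> 'q) \<Rightarrow> 'q \<Rightarrow> bool" where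
  "hnn_rep B H \<phi> Q \<beta> \<tau> \<longleftrightarrow> \<beta> \<in> hom B Q \<and> \<tau> \<in> carrier Q \<and> (\<forall>h \<in> H. \<beta> h \<otimes>\<^bsub>Q\<^esub> \<tau> = \<tau> \<otimes>\<^bsub>Q\<^esub> \<beta> (\<phi> h))"

text \<open>
  If \<open>\<beta>\<^sub>0\<close> kills \<open>K\<close> and \<open>\<beta>\<^sub>1\<close> kills \<open>H\<close>, place \<open>\<beta>\<^sub>0\<close> in the coordinate \<open>1\<close> and \<open>\<beta>\<^sub>1\<close> in the coordinate \<open>y\<close>.  Then
  \<open>H\<close> lives in the first coordinate only and \<open>K\<close> in the second only, so that translation by \<open>y\<close> can
  serve as the stable letter.
\<close>

lemma hnn_rep_two_coordinates:
  assumes "group B" "group R" "group Y" and y: "y \<in> carrier Y" "y \<noteq> \<one>\<^bsub>Y\<^esub>"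
    and \<beta>: "\<beta>\<^sub>0 \<in> hom B R" "\<beta>\<^sub>1 \<in> hom B R"
    and H: "H \<subseteq> carrier B" "\<phi> ` H \<subseteq> carrier B"
    and kill: "\<And>h. h \<in> H \<Longrightarrow> \<beta>\<^sub>1 h = \<one>\<^bsub>R\<^esub>" "\<And>h. h \<in> H \<Longrightarrow> \<beta>\<^sub>0 (\<phi> h) = \<one>\<^bsub>R\<^esub>"
    and match: "\<And>h. h \<in> H \<Longrightarrow> \<beta>\<^sub>0 h = \<beta>\<^sub>1 (\<phi> h)"
  shows "\<exists>\<theta> \<tau>. hnn_rep B H \<phi> (wreath R Y) \<theta> \<tau> \<and>
    (\<forall>b \<in> carrier B. \<theta> b = \<one>\<^bsub>wreath R Y\<^esub> \<longleftrightarrow> \<beta>\<^sub>0 b = \<one>\<^bsub>R\<^esub> \<and> \<beta>\<^sub>1 b = \<one>\<^bsub>R\<^esub>)"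
proof -
  interpret B: group B by fact
  interpret R: group R by fact
  interpret Y: group Y by fact
  define f where "f b x = (if x = \<one>\<^bsub>Y\<^esub> then \<beta>\<^sub>0 b else if x = y then \<beta>\<^sub>1 b else \<one>\<^bsub>R\<^esub>)" for b x
  define \<theta> where "\<theta> b = (\<lambda>x \<in> carrier Y. f b x, \<one>\<^bsub>Y\<^esub>)" for b
  define \<tau> where "\<tau> = (\<lambda>x \<in> carrier Y. \<one>\<^bsub>R\<^esub>, y)"
  have f: "f b x \<in> carrier R" if "b \<in> carrier B" for b x
    using that \<beta> by (auto simp: f_def hom_def)
  have "\<theta> \<in> hom B (wreath R Y)"
    unfolding \<theta>_def
    by (rule wreath_homI[OF assms(3), where \<theta> = "\<lambda>_. \<one>\<^bsub>Y\<^esub>"]) (use \<beta> f in \<open>auto simp: hom_def f_def\<close>)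
  moreover have "\<tau> \<in> carrier (wreath R Y)" using y by (auto simp: \<tau>_def)
  moreover have "\<theta> h \<otimes>\<^bsub>wreath R Y\<^esub> \<tau> = \<tau> \<otimes>\<^bsub>wreath R Y\<^esub> \<theta> (\<phi> h)" if h: "h \<in> H" for h
  proof -
    have "f h x = f (\<phi> h) (x \<otimes>\<^bsub>Y\<^esub> y)" if x: "x \<in> carrier Y" for x
    proof -
      have "x \<otimes>\<^bsub>Y\<^esub> y = y \<longleftrightarrow> x = \<one>\<^bsub>Y\<^esub>" using x y Y.r_cancel_one by blast
      then show ?thesis using kill[OF h] match[OF h] y by (simp add: f_def)
    qed
    moreover have "f h x \<in> carrier R" "f (\<phi> h) x \<in> carrier R" for x
      using f h H by auto
    ultimately show ?thesis
      using y by (auto simp: \<theta>_def \<tau>_def wreath_mult[OF assms(3)] intro!: restrict_ext)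
  qed
  moreover have "\<theta> b = \<one>\<^bsub>wreath R Y\<^esub> \<longleftrightarrow> \<beta>\<^sub>0 b = \<one>\<^bsub>R\<^esub> \<and> \<beta>\<^sub>1 b = \<one>\<^bsub>R\<^esub>" for b
  proof
    assume "\<theta> b = \<one>\<^bsub>wreath R Y\<^esub>"
    then have "(\<lambda>x \<in> carrier Y. f b x) = (\<lambda>x \<in> carrier Y. \<one>\<^bsub>R\<^esub>)" by (simp add: \<theta>_def)
    from fun_cong[OF this, of "\<one>\<^bsub>Y\<^esub>"] fun_cong[OF this, of y] show "\<beta>\<^sub>0 b = \<one>\<^bsub>R\<^esub> \<and> \<beta>\<^sub>1 b = \<one>\<^bsub>R\<^esub>"
      using y by (simp add: f_def)
  qed (auto simp: \<theta>_def f_def intro!: restrict_ext)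
  ultimately show ?thesis unfolding hnn_rep_def by blast
qed

text \<open>
  A representation with kernel \<open>L\<close> on the base group is lifted to an injective one.  The twisted
  Kaloujnine-Krasner embedding of \<open>B\<close> over \<open>\<theta>\<close> makes \<open>L\<close> constant.  Its restriction to \<open>H\<close>, and the
  homomorphism obtained from \<open>\<phi>\<close> and a first guess \<open>\<tau>\<^sub>0\<close> for the stable letter, which acts on the constants
  as \<open>\<phi>\<close> requires, lie over the same homomorphism and agree on \<open>L\<close>.  Therefore they are conjugate,
  and the conjugating function corrects \<open>\<tau>\<^sub>0\<close>.
\<close>

lemma hnn_rep_extend_over_kernel:
  fixes \<tau>\<^sub>1
  assumes "normal_embedding B L (\<lambda>x. x)" and Q: "group Q"
    and H: "subgroup H B" "L \<subseteq> H" and \<phi>: "\<phi> \<in> hom (B\<lparr>carrier := H\<rparr>) B" "inj_on \<phi> L" "\<phi> ` L = L"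
    and rep: "hnn_rep B H \<phi> Q \<theta> \<tau>\<^sub>1" and ker: "kernel B Q \<theta> = L"
    and A: "subgroup A (AutoGroup (B\<lparr>carrier := L\<rparr>))"
      "\<And>b. b \<in> carrier B \<Longrightarrow> conj_aut B L (\<lambda>x. x) b \<in> A" "restrict \<phi> L \<in> A"
  defines "G \<equiv> semidirect (B\<lparr>carrier := L\<rparr>) (AutoGroup (B\<lparr>carrier := L\<rparr>)\<lparr>carrier := A\<rparr>) (\<lambda>\<sigma>. \<sigma>)"
  shows "\<exists>\<beta> \<tau>. hnn_rep B H \<phi> (wreath G Q) \<beta> \<tau> \<and> inj_on \<beta> (carrier B)"
proof -
  interpret L: normal_embedding B L "\<lambda>x. x" by fact
  interpret Q: group Q by fact
  let ?L = "B\<lparr>carrier := L\<rparr>"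
  let ?A = "AutoGroup ?L\<lparr>carrier := A\<rparr>" and ?c = "conj_aut B L (\<lambda>x. x)"
  interpret LG: group ?L by (rule L.subgroup_group)
  interpret Ls: subgroup L B by (rule L.H)
  interpret Hs: subgroup H B by (rule H)
  interpret Aut: group "AutoGroup ?L" by (rule LG.AutoGroup)
  have gA: "group ?A" using subgroup.subgroup_is_group[OF A(1) LG.AutoGroup] .
  interpret A: group ?A by (rule gA)
  have Asub: "A \<subseteq> carrier (AutoGroup ?L)" using subgroup.subset[OF A(1)] .
  have gG: "group G" unfolding G_def
    by (rule semidirect_group[OF LG.group_axioms gA LG.AutoGroup_acts_on[OF Asub]])
  interpret G: group G by (rule gG)
  let ?W = "wreath G Q"
  interpret W: group ?W by (rule wreath_group[OF gG Q])
  interpret \<theta>: group_hom B Q \<theta>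
    using rep L.group_axioms Q by (simp add: hnn_rep_def group_hom_def group_hom_axioms_def)
  have \<tau>\<^sub>1: "\<tau>\<^sub>1 \<in> carrier Q" and \<theta>\<tau>: "\<And>h. h \<in> H \<Longrightarrow> \<theta> h \<otimes>\<^bsub>Q\<^esub> \<tau>\<^sub>1 = \<tau>\<^sub>1 \<otimes>\<^bsub>Q\<^esub> \<theta> (\<phi> h)"
    using rep by (auto simp: hnn_rep_def)
  have aut: "\<sigma> l \<in> L" "\<sigma> \<one>\<^bsub>B\<^esub> = \<one>\<^bsub>B\<^esub>" if "\<sigma> \<in> A" "l \<in> L" for \<sigma> l
  proof -
    have "\<sigma> \<in> hom ?L ?L" using that Asub by (auto simp: AutoGroup_carrier)
    then show "\<sigma> l \<in> L" "\<sigma> \<one>\<^bsub>B\<^esub> = \<one>\<^bsub>B\<^esub>"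
      using that hom_in_carrier[of \<sigma> ?L ?L l] hom_one[of \<sigma> ?L ?L] LG.group_axioms by auto
  qed
  have oneA: "\<one>\<^bsub>AutoGroup ?L\<^esub> \<in> A" using A.one_closed by simp
  have idL: "\<one>\<^bsub>AutoGroup ?L\<^esub> l = l" if "l \<in> L" for l
    using that by (simp add: AutoGroup_one)
  let ?\<iota> = "\<lambda>l. (l, \<one>\<^bsub>AutoGroup ?L\<^esub>)"
  let ?\<alpha> = "\<lambda>b. (\<one>\<^bsub>B\<^esub>, ?c b)"
  have \<iota>: "?\<iota> \<in> hom ?L G"
    using A.l_one[OF A.one_closed] oneA by (auto simp: hom_def G_def idL)
  have \<alpha>: "?\<alpha> \<in> hom B G"
    using L.conj_aut_hom[OF A(2)] A(2) aut(2)[OF A(2) Ls.one_closed] by (auto simp: hom_def G_def Pi_iff)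
  have compat: "?\<alpha> b \<otimes>\<^bsub>G\<^esub> ?\<iota> l = ?\<iota> (b \<otimes>\<^bsub>B\<^esub> l \<otimes>\<^bsub>B\<^esub> inv\<^bsub>B\<^esub> b) \<otimes>\<^bsub>G\<^esub> ?\<alpha> b"
    if b: "b \<in> carrier B" and l: "l \<in> L" for b l
    using L.conj_aut[OF b l] L.conj_aut_closed[OF b l] A.l_one[of "?c b"] A.r_one[of "?c b"] A(2)[OF b]
    by (simp add: G_def idL)
  have "\<exists>\<beta> \<in> hom B ?W. (\<forall>b \<in> carrier B. snd (\<beta> b) = \<theta> b) \<and>
      (\<forall>l \<in> L. \<beta> l = (\<lambda>x \<in> carrier Q. ?\<iota> l, \<one>\<^bsub>Q\<^esub>))"
    by (rule induced_hom[OF L.group_axioms gG Q \<theta>.homh _ \<alpha>, unfolded ker, OF \<iota> compat])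
  then obtain \<beta> where \<beta>: "\<beta> \<in> hom B ?W" and snd\<beta>: "\<And>b. b \<in> carrier B \<Longrightarrow> snd (\<beta> b) = \<theta> b"
    and \<beta>L: "\<And>l. l \<in> L \<Longrightarrow> \<beta> l = (\<lambda>x \<in> carrier Q. ?\<iota> l, \<one>\<^bsub>Q\<^esub>)" by blast
  interpret \<beta>: group_hom B ?W \<beta>
    using \<beta> L.group_axioms W.group_axioms by (simp add: group_hom_def group_hom_axioms_def)
  have inj: "inj_on \<beta> (carrier B)"
  proof (rule \<beta>.trivial_ker_imp_inj)
    have "b = \<one>\<^bsub>B\<^esub>" if b: "b \<in> carrier B" "\<beta> b = \<one>\<^bsub>?W\<^esub>" for b
    proof -
    from b have "\<theta> b = \<one>\<^bsub>Q\<^esub>" using snd\<beta>[of b] by simp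
    then have "b \<in> L" using b ker by (auto simp: kernel_def)
    then show "b = \<one>\<^bsub>B\<^esub>"
      using b(2) \<beta>L[of b] by (auto simp: G_def dest!: fun_cong[of _ _ "\<one>\<^bsub>Q\<^esub>"])
    qed
    then show "kernel B ?W \<beta> = {\<one>\<^bsub>B\<^esub>}"
      using L.one_closed \<beta>.hom_one by (auto simp: kernel_def simp del: wreath_one)
  qed
  \<comment> \<open>The inverse of \<open>\<phi>\<close> on \<open>L\<close> is conjugation by the stable letter.\<close>
  define \<rho> where "\<rho> = inv\<^bsub>?A\<^esub> restrict \<phi> L"
  have \<rho>: "\<rho> \<in> A" using A.inv_closed A(3) by (simp add: \<rho>_def)
  have \<rho>\<phi>: "\<rho> (\<phi> l) = l" if "l \<in> L" for l
  proof -
    have "\<rho> \<otimes>\<^bsub>AutoGroup ?L\<^esub> restrict \<phi> L = \<one>\<^bsub>AutoGroup ?L\<^esub>"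
      using A.l_inv[of "restrict \<phi> L"] A(3) by (simp add: \<rho>_def)
    moreover have "\<rho> \<otimes>\<^bsub>AutoGroup ?L\<^esub> restrict \<phi> L = compose L \<rho> (restrict \<phi> L)"
      using AutoGroup_mult[of \<rho> ?L "restrict \<phi> L"] \<rho> A(3) Asub by auto
    ultimately have "compose L \<rho> (restrict \<phi> L) l = l" using idL[OF that] by simp
    then show ?thesis using that by (simp add: compose_def)
  qed
  define \<tau>\<^sub>0 where "\<tau>\<^sub>0 = (\<lambda>x \<in> carrier Q. (\<one>\<^bsub>B\<^esub>, \<rho>), \<tau>\<^sub>1)"
  have \<tau>\<^sub>0: "\<tau>\<^sub>0 \<in> carrier ?W" using \<rho> \<tau>\<^sub>1 by (auto simp: \<tau>\<^sub>0_def G_def)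
  let ?H = "B\<lparr>carrier := H\<rparr>"
  have \<phi>B: "\<phi> h \<in> carrier B" if "h \<in> H" for h using \<phi>(1) that by (auto simp: hom_def)
  have \<phi>L: "\<phi> l \<in> L" if "l \<in> L" for l using \<phi>(3) that by blast
  let ?\<beta>\<^sub>2 = "\<lambda>h. \<tau>\<^sub>0 \<otimes>\<^bsub>?W\<^esub> \<beta> (\<phi> h) \<otimes>\<^bsub>?W\<^esub> inv\<^bsub>?W\<^esub> \<tau>\<^sub>0"
  have sndW: "snd \<in> hom ?W Q" by (rule wreath_snd_hom[OF Q])
  interpret snd: group_hom ?W Q snd
    using sndW W.group_axioms Q by (simp add: group_hom_def group_hom_axioms_def)
  have "\<exists>c \<in> carrier ?W. snd c = \<one>\<^bsub>Q\<^esub> \<and> (\<forall>h \<in> carrier ?H. \<beta> h \<otimes>\<^bsub>?W\<^esub> c = c \<otimes>\<^bsub>?W\<^esub> ?\<beta>\<^sub>2 h)"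
  proof (rule wreath_homs_conjugate[OF _ gG Q])
    show "group ?H" by (rule subgroup.subgroup_is_group[OF H(1) L.group_axioms])
    show "\<beta> \<in> hom ?H ?W" using \<beta> by (auto simp: hom_def Pi_iff)
    show "?\<beta>\<^sub>2 \<in> hom ?H ?W"
    proof (rule homI)
      fix h h' assume "h \<in> carrier ?H" "h' \<in> carrier ?H"
      then have "\<phi> (h \<otimes>\<^bsub>B\<^esub> h') = \<phi> h \<otimes>\<^bsub>B\<^esub> \<phi> h'" and "h \<in> H" "h' \<in> H" using \<phi>(1) by (auto simp: hom_def)
      then show "?\<beta>\<^sub>2 (h \<otimes>\<^bsub>?H\<^esub> h') = ?\<beta>\<^sub>2 h \<otimes>\<^bsub>?W\<^esub> ?\<beta>\<^sub>2 h'"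
        using \<tau>\<^sub>0 \<phi>B by (simp add: W.m_assoc del: wreath_carrier wreath_one)
    qed (use \<tau>\<^sub>0 \<phi>B in \<open>simp del: wreath_carrier wreath_one\<close>)
    fix h assume "h \<in> carrier ?H"
    then have h: "h \<in> H" by simp
    have "snd (?\<beta>\<^sub>2 h) = \<tau>\<^sub>1 \<otimes>\<^bsub>Q\<^esub> \<theta> (\<phi> h) \<otimes>\<^bsub>Q\<^esub> inv\<^bsub>Q\<^esub> \<tau>\<^sub>1"
      using \<tau>\<^sub>0 \<phi>B[OF h] by (simp add: snd\<beta> \<tau>\<^sub>0_def del: wreath_carrier wreath_one)
    also have "\<dots> = \<theta> h"
      using \<tau>\<^sub>1 h by (simp add: Q.m_assoc flip: \<theta>\<tau>)
    finally show eq: "snd (\<beta> h) = snd (?\<beta>\<^sub>2 h)" using h by (simp add: snd\<beta>)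
    assume "snd (\<beta> h) = \<one>\<^bsub>Q\<^esub>"
    then have l: "h \<in> L" using h snd\<beta>[OF Hs.mem_carrier[OF h]] unfolding ker[symmetric] kernel_def by simp
    have "\<beta> h \<otimes>\<^bsub>?W\<^esub> \<tau>\<^sub>0 = \<tau>\<^sub>0 \<otimes>\<^bsub>?W\<^esub> \<beta> (\<phi> h)"
      using \<tau>\<^sub>1 l \<phi>L[OF l] A.l_one[of \<rho>] A.r_one[of \<rho>] \<rho>
      by (auto simp: \<beta>L \<tau>\<^sub>0_def wreath_mult[OF Q] G_def \<rho>\<phi> idL intro!: restrict_ext)
    then show "\<beta> h = ?\<beta>\<^sub>2 h"
      using \<tau>\<^sub>0 \<phi>B[OF h] h by (metis Hs.mem_carrier W.inv_solve_right' W.m_closed \<beta>.hom_closed)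
  qed
  then obtain c where c: "c \<in> carrier ?W" "\<And>h. h \<in> H \<Longrightarrow> \<beta> h \<otimes>\<^bsub>?W\<^esub> c = c \<otimes>\<^bsub>?W\<^esub> ?\<beta>\<^sub>2 h" by auto
  have "hnn_rep B H \<phi> ?W \<beta> (c \<otimes>\<^bsub>?W\<^esub> \<tau>\<^sub>0)"
    unfolding hnn_rep_def
  proof (intro conjI ballI)
    fix h assume h: "h \<in> H"
    have "\<beta> h \<otimes>\<^bsub>?W\<^esub> (c \<otimes>\<^bsub>?W\<^esub> \<tau>\<^sub>0) = c \<otimes>\<^bsub>?W\<^esub> ?\<beta>\<^sub>2 h \<otimes>\<^bsub>?W\<^esub> \<tau>\<^sub>0"
      using c(1) \<tau>\<^sub>0 h by (simp add: c(2) del: wreath_carrier wreath_one flip: W.m_assoc)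
    also have "\<dots> = (c \<otimes>\<^bsub>?W\<^esub> \<tau>\<^sub>0) \<otimes>\<^bsub>?W\<^esub> \<beta> (\<phi> h)"
      using c(1) \<tau>\<^sub>0 \<phi>B[OF h] by (simp add: W.m_assoc del: wreath_carrier wreath_one)
    finally show "\<beta> h \<otimes>\<^bsub>?W\<^esub> (c \<otimes>\<^bsub>?W\<^esub> \<tau>\<^sub>0) = (c \<otimes>\<^bsub>?W\<^esub> \<tau>\<^sub>0) \<otimes>\<^bsub>?W\<^esub> \<beta> (\<phi> h)" .
  qed (use \<beta> c(1) \<tau>\<^sub>0 in \<open>simp_all del: wreath_carrier wreath_one\<close>)
  with inj show ?thesis by blast
qed

locale normal_hnn = group B for B :: "'b monoid" +
  fixes H K L :: "'b set" and \<phi> :: "'b \<Rightarrow> 'b"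
  assumes H: "H \<lhd> B" and K: "K \<lhd> B"
    and \<phi>: "\<phi> \<in> iso (B\<lparr>carrier := H\<rparr>) (B\<lparr>carrier := K\<rparr>)"
    and L_def: "L = H \<inter> K" and \<phi>L: "\<phi> ` L = L"
begin

abbreviation "BH \<equiv> B\<lparr>carrier := H\<rparr>"
abbreviation "BL \<equiv> B\<lparr>carrier := L\<rparr>"

lemma subgroups: "subgroup H B" "subgroup K B"
  using H K normal_imp_subgroup by auto

lemma L_normal: "L \<lhd> B"
  unfolding L_def by (rule normal_subgroup_intersect[OF H K])

lemma \<phi>_hom: "\<phi> \<in> hom BH B" and \<phi>_inj: "inj_on \<phi> H" and \<phi>_img: "\<phi> ` H = K"
  using \<phi> subgroup.subset[OF subgroups(2)] by (auto simp: iso_def hom_def bij_betw_def)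

lemma L_sub: "L \<subseteq> H" "L \<subseteq> K" by (auto simp: L_def)

sublocale H: normal_embedding B H "\<lambda>x. x"
  by (intro normal_embedding.intro normal_embedding_axioms.intro group_axioms)
    (use subgroups(1) H subgroup.subset[OF subgroups(1)] in \<open>auto simp: hom_def\<close>)

sublocale K: normal_embedding B H \<phi>
  by (intro normal_embedding.intro normal_embedding_axioms.intro group_axioms)
    (use subgroups(1) \<phi>_hom \<phi>_inj K in \<open>auto simp: \<phi>_img\<close>)

sublocale L: normal_embedding B L "\<lambda>x. x"
  by (intro normal_embedding.intro normal_embedding_axioms.intro group_axioms)
    (use L_normal normal_imp_subgroup[OF L_normal] subgroup.subset[OF normal_imp_subgroup[OF L_normal]] in \<open>auto simp: hom_def\<close>)

lemma \<phi>_mem_L: "h \<in> H \<Longrightarrow> \<phi> h \<in> L \<longleftrightarrow> h \<in> L"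
  using \<phi>L inj_on_image_mem_iff[OF \<phi>_inj _ L_sub(1)] by metis

lemma L_normal_H: "L \<lhd> BH"
  by (rule normal_restrict_supergroup[OF subgroups(1) L_normal L_sub(1)])

lemma image_inv: "(\<lambda>b. inv\<^bsub>B\<^esub> b) ` carrier B = carrier B"
proof -
  have "b \<in> (\<lambda>b. inv\<^bsub>B\<^esub> b) ` carrier B" if "b \<in> carrier B" for b
    using that by (intro image_eqI[of _ _ "inv\<^bsub>B\<^esub> b"]) auto
  then show ?thesis by auto
qed

lemma Aut_restr_eq: "Aut_restr B H = conj_aut B H (\<lambda>x. x) ` carrier B"
  "Aut_restr B L = conj_aut B L (\<lambda>x. x) ` carrier B"
proof -
  have "Aut_restr B M = conj_aut B M (\<lambda>x. x) ` carrier B" if "M \<lhd> B" for M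
  proof -
    have "(\<lambda>y\<in>M. inv\<^bsub>B\<^esub> x \<otimes>\<^bsub>B\<^esub> y \<otimes>\<^bsub>B\<^esub> x) = conj_aut B M (\<lambda>x. x) (inv\<^bsub>B\<^esub> x)" if "x \<in> carrier B" for x
      using that normal.inv_op_closed1[OF \<open>M \<lhd> B\<close> that] inv_into_f_f[of "\<lambda>x. x" M]
      by (auto simp: conj_aut_def intro!: restrict_ext)
    then have "Aut_restr B M = conj_aut B M (\<lambda>x. x) ` (\<lambda>x. inv\<^bsub>B\<^esub> x) ` carrier B"
      by (auto simp: Aut_restr_def image_image)
    then show ?thesis using image_inv by simp
  qed
  from this[OF H] this[OF L_normal] show "Aut_restr B H = conj_aut B H (\<lambda>x. x) ` carrier B"
    "Aut_restr B L = conj_aut B L (\<lambda>x. x) ` carrier B" by auto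
qed

lemma Aut_restr_conj_eq: "Aut_restr_conj B H K \<phi> = conj_aut B H \<phi> ` carrier B"
proof -
  have "(\<lambda>h \<in> H. inv_into H \<phi> ((\<lambda>y\<in>K. inv\<^bsub>B\<^esub> x \<otimes>\<^bsub>B\<^esub> y \<otimes>\<^bsub>B\<^esub> x) (\<phi> h))) = conj_aut B H \<phi> (inv\<^bsub>B\<^esub> x)"
    if "x \<in> carrier B" for x
    using that \<phi>_img by (auto simp: conj_aut_def intro!: restrict_ext)
  then have "Aut_restr_conj B H K \<phi> = conj_aut B H \<phi> ` (\<lambda>x. inv\<^bsub>B\<^esub> x) ` carrier B"
    by (auto simp: Aut_restr_conj_def Aut_restr_def image_image)
  then show ?thesis using image_inv by simp
qed

definition "U_set = generate (AutoGroup BH) (conj_aut B H (\<lambda>x. x) ` carrier B \<union> conj_aut B H \<phi> ` carrier B)"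
definition "V_set = generate (AutoGroup BL)
  (conj_aut B L (\<lambda>x. x) ` carrier B \<union> generate (AutoGroup BL) {restrict \<phi> L})"

lemma restrict_\<phi>_L: "restrict \<phi> L \<in> carrier (AutoGroup BL)"
  using \<phi>_hom \<phi>_inj \<phi>L L_sub
  by (auto simp: AutoGroup_carrier hom_def bij_betw_def Pi_iff subset_iff L.H subgroup.m_closed intro: inj_on_subset)

lemma hnn_U_eq: "hnn_U B H K \<phi> = AutoGroup BH\<lparr>carrier := U_set\<rparr>"
proof -
  have "carrier (AutoGroup BH) \<inter> (conj_aut B H (\<lambda>x. x) ` carrier B \<union> conj_aut B H \<phi> ` carrier B)
      = conj_aut B H (\<lambda>x. x) ` carrier B \<union> conj_aut B H \<phi> ` carrier B"
    using H.conj_aut_AutoGroup K.conj_aut_AutoGroup by blast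
  then show ?thesis
    by (simp add: hnn_U_def subgroup_generated_def U_set_def Aut_restr_eq Aut_restr_conj_eq)
qed

lemma generate_\<phi>_sub: "generate (AutoGroup BL) {restrict \<phi> L} \<subseteq> carrier (AutoGroup BL)"
  using group.generate_incl[OF group.AutoGroup[OF L.subgroup_group]] restrict_\<phi>_L by simp

lemma hnn_V_eq: "hnn_V B L \<phi> = AutoGroup BL\<lparr>carrier := V_set\<rparr>"
proof -
  have "carrier (AutoGroup BL) \<inter> (conj_aut B L (\<lambda>x. x) ` carrier B \<union> generate (AutoGroup BL) {restrict \<phi> L})
      = conj_aut B L (\<lambda>x. x) ` carrier B \<union> generate (AutoGroup BL) {restrict \<phi> L}"
    using L.conj_aut_AutoGroup generate_\<phi>_sub by blast
  then show ?thesis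
    by (simp add: hnn_V_def subgroup_generated_def V_set_def Aut_restr_eq)
qed

lemma U_subgroup: "subgroup U_set (AutoGroup BH)"
  unfolding U_set_def
  using H.conj_aut_AutoGroup K.conj_aut_AutoGroup
  by (intro group.generate_is_subgroup group.AutoGroup H.subgroup_group) auto

lemma V_subgroup: "subgroup V_set (AutoGroup BL)"
  unfolding V_set_def
  using L.conj_aut_AutoGroup generate_\<phi>_sub
  by (intro group.generate_is_subgroup group.AutoGroup L.subgroup_group) auto

text \<open>
  The generators, conjugations on \<open>H\<close> and conjugations on \<open>K\<close> carried back by \<open>\<phi>\<close>, preserve \<open>L\<close>, because \<open>L\<close> is normal in \<open>B\<close> and
  \<open>\<phi> ` L = L\<close>.  So the group they generate acts on \<open>H / L\<close>.
\<close>

lemma U_preserves_L: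
  assumes "\<sigma> \<in> U_set"
  shows "\<sigma> ` L = L"
proof -
  let ?S = "{\<sigma> \<in> carrier (AutoGroup BH). \<sigma> ` L = L}"
  have S: "subgroup ?S (AutoGroup BH)"
    using group.AutoGroup_stabilizer_subgroup[OF H.subgroup_group] L_sub by simp
  \<comment> \<open>An inclusion that holds for \<open>b\<close> and for its inverse is an equality.\<close>
  have eq: "conj_aut B H \<psi> b ` L = L"
    if \<psi>: "normal_embedding B H \<psi>" "\<And>h. h \<in> H \<Longrightarrow> \<psi> h \<in> L \<longleftrightarrow> h \<in> L" and b: "b \<in> carrier B" for \<psi> b
  proof -
    interpret \<psi>: normal_embedding B H \<psi> by fact
    have sub: "conj_aut B H \<psi> b l \<in> L" if "b \<in> carrier B" "l \<in> L" for b l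
      using normal.inv_op_closed2[OF L_normal, of b "\<psi> l"] \<psi>(2)[of l] \<psi>(2)[of "conj_aut B H \<psi> b l"] that L_sub
        \<psi>.conj_aut[of b l] \<psi>.conj_aut_closed[of b l] by auto
    have "l = conj_aut B H \<psi> b (conj_aut B H \<psi> (inv\<^bsub>B\<^esub> b) l)" if "l \<in> L" for l
      using \<psi>.conj_aut_mult[of b "inv\<^bsub>B\<^esub> b"] \<psi>.conj_aut_one b that L_sub
      by (auto simp: compose_def restrict_def fun_eq_iff split: if_splits)
    then show ?thesis using sub b by (metis (no_types, lifting) image_subsetI inv_closed rev_image_eqI subsetI subset_antisym)
  qed
  have "conj_aut B H (\<lambda>x. x) ` carrier B \<subseteq> ?S"
    using eq[OF H.normal_embedding_axioms HOL.refl] H.conj_aut_AutoGroup by (intro image_subsetI CollectI conjI)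
  moreover have "conj_aut B H \<phi> ` carrier B \<subseteq> ?S"
    using eq[OF K.normal_embedding_axioms \<phi>_mem_L] K.conj_aut_AutoGroup by (intro image_subsetI CollectI conjI)
  ultimately have "conj_aut B H (\<lambda>x. x) ` carrier B \<union> conj_aut B H \<phi> ` carrier B \<subseteq> ?S"
    by (rule Un_least)
  then have "U_set \<subseteq> ?S"
    unfolding U_set_def
    by (rule group.generate_subgroup_incl[OF group.AutoGroup[OF H.subgroup_group] _ S])
  then show ?thesis using assms by auto
qed

text \<open>
  The inner wreath product receives the two homomorphisms that kill \<open>K\<close> and \<open>H\<close>; the coordinates from
  \<open>Y\<close> turn them into a representation with kernel \<open>L\<close>; the outermost layer resolves this kernel.
\<close>

definition "target Y =
  wreath (semidirect BL (hnn_V B L \<phi>) (\<lambda>\<sigma>. \<sigma>))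
    (wreath (wreath (semidirect (BH Mod L) (hnn_U B H K \<phi>) (`)) (B Mod (K <#>\<^bsub>B\<^esub> H))) Y)"

lemma KH_normal: "K <#>\<^bsub>B\<^esub> H \<lhd> B"
  by (rule normal_subgroup_set_mult_closed[OF K H])

text \<open>
  Every representation factors through the HNN-extension, so that the latter contains \<open>B\<close>.
\<close>

lemma injective_hnn_rep:
  assumes Y: "group Y" "y \<in> carrier Y" "y \<noteq> \<one>\<^bsub>Y\<^esub>"
  shows "\<exists>\<beta> \<tau>. hnn_rep B H \<phi> (target Y) \<beta> \<tau> \<and> inj_on \<beta> (carrier B)"
proof -
  let ?U = "AutoGroup BH\<lparr>carrier := U_set\<rparr>"
  let ?G = "semidirect (BH Mod L) ?U (`)"
  let ?R = "wreath ?G (B Mod (K <#>\<^bsub>B\<^esub> H))"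
  have gU: "group ?U"
    using subgroup.subgroup_is_group[OF U_subgroup group.AutoGroup[OF H.subgroup_group]] .
  have gR: "group ?R"
    using semidirect_group[OF normal.factorgroup_is_group[OF L_normal_H] gU]
      group.AutoGroup_acts_on_quotient(1)[OF H.subgroup_group subgroup.subset[OF U_subgroup] L_normal_H]
      U_preserves_L normal.factorgroup_is_group[OF KH_normal] by (auto intro!: wreath_group)
  have conjU: "conj_aut B H (\<lambda>x. x) b \<in> U_set" "conj_aut B H \<phi> b \<in> U_set" if "b \<in> carrier B" for b
    using that by (auto simp: U_set_def intro: generate.incl)
  have KH: "K <#>\<^bsub>B\<^esub> H = K <#>\<^bsub>B\<^esub> (\<lambda>x. x) ` H" "K <#>\<^bsub>B\<^esub> H = H <#>\<^bsub>B\<^esub> \<phi> ` H"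
    using commut_normal[OF subgroups(1) K] by (simp_all add: \<phi>_img)
  obtain \<beta>\<^sub>0 where \<beta>\<^sub>0: "\<beta>\<^sub>0 \<in> hom B ?R"
    "\<And>h. h \<in> H \<Longrightarrow> \<beta>\<^sub>0 h = (\<lambda>x \<in> carrier (B Mod (K <#>\<^bsub>B\<^esub> H)). (L #>\<^bsub>B\<^esub> h, \<one>\<^bsub>AutoGroup BH\<^esub>), \<one>\<^bsub>B Mod (K <#>\<^bsub>B\<^esub> H)\<^esub>)"
    "\<And>b. b \<in> carrier B \<Longrightarrow> \<beta>\<^sub>0 b = \<one>\<^bsub>?R\<^esub> \<longleftrightarrow> b \<in> K"
  proof -
    have "L = {h \<in> H. h \<in> K}" by (auto simp: L_def)
    from H.wreath_hom_with_kernel[OF K L_normal_H this KH_normal KH(1) U_subgroup U_preserves_L conjU(1)] that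
    show ?thesis by blast
  qed
  obtain \<beta>\<^sub>1 where \<beta>\<^sub>1: "\<beta>\<^sub>1 \<in> hom B ?R"
    "\<And>h. h \<in> H \<Longrightarrow> \<beta>\<^sub>1 (\<phi> h) = (\<lambda>x \<in> carrier (B Mod (K <#>\<^bsub>B\<^esub> H)). (L #>\<^bsub>B\<^esub> h, \<one>\<^bsub>AutoGroup BH\<^esub>), \<one>\<^bsub>B Mod (K <#>\<^bsub>B\<^esub> H)\<^esub>)"
    "\<And>b. b \<in> carrier B \<Longrightarrow> \<beta>\<^sub>1 b = \<one>\<^bsub>?R\<^esub> \<longleftrightarrow> b \<in> H"
  proof -
    have "L = {h \<in> H. \<phi> h \<in> H}" using \<phi>_mem_L \<phi>_img L_sub by (auto simp: L_def)
    from K.wreath_hom_with_kernel[OF H L_normal_H this KH_normal KH(2) U_subgroup U_preserves_L conjU(2)] that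
    show ?thesis by blast
  qed
  have "\<exists>\<theta> \<tau>. hnn_rep B H \<phi> (wreath ?R Y) \<theta> \<tau> \<and>
    (\<forall>b \<in> carrier B. \<theta> b = \<one>\<^bsub>wreath ?R Y\<^esub> \<longleftrightarrow> \<beta>\<^sub>0 b = \<one>\<^bsub>?R\<^esub> \<and> \<beta>\<^sub>1 b = \<one>\<^bsub>?R\<^esub>)"
  proof (rule hnn_rep_two_coordinates[OF group_axioms gR Y \<beta>\<^sub>0(1) \<beta>\<^sub>1(1)])
    show HB: "H \<subseteq> carrier B" "\<phi> ` H \<subseteq> carrier B"
      using subgroup.subset subgroups \<phi>_img by auto
    fix h assume h: "h \<in> H"
    show "\<beta>\<^sub>1 h = \<one>\<^bsub>?R\<^esub>" using \<beta>\<^sub>1(3)[of h] h HB by blast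
    show "\<beta>\<^sub>0 (\<phi> h) = \<one>\<^bsub>?R\<^esub>" using \<beta>\<^sub>0(3)[of "\<phi> h"] h HB \<phi>_img by blast
    show "\<beta>\<^sub>0 h = \<beta>\<^sub>1 (\<phi> h)" using \<beta>\<^sub>0(2)[OF h] \<beta>\<^sub>1(2)[OF h] by simp
  qed
  then obtain \<theta> \<tau> where rep: "hnn_rep B H \<phi> (wreath ?R Y) \<theta> \<tau>"
    and \<theta>: "\<And>b. b \<in> carrier B \<Longrightarrow> \<theta> b = \<one>\<^bsub>wreath ?R Y\<^esub> \<longleftrightarrow> \<beta>\<^sub>0 b = \<one>\<^bsub>?R\<^esub> \<and> \<beta>\<^sub>1 b = \<one>\<^bsub>?R\<^esub>"
    by blast
  have ker: "kernel B (wreath ?R Y) \<theta> = L"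
    using \<theta> \<beta>\<^sub>0(3) \<beta>\<^sub>1(3) subgroup.subset[OF subgroups(1)] unfolding kernel_def L_def by blast
  show ?thesis
    unfolding target_def hnn_U_eq hnn_V_eq
  proof (rule hnn_rep_extend_over_kernel[OF L.normal_embedding_axioms wreath_group[OF gR Y(1)]
        subgroups(1) L_sub(1) \<phi>_hom _ \<phi>L rep ker V_subgroup])
    show "inj_on \<phi> L" using \<phi>_inj L_sub inj_on_subset by blast
    show "conj_aut B L (\<lambda>x. x) b \<in> V_set" if "b \<in> carrier B" for b
      using that by (auto simp: V_set_def intro: generate.incl)
    show "restrict \<phi> L \<in> V_set"
      by (auto simp: V_set_def intro: generate.incl)
  qed
qed

lemma group_target: assumes "group Y" shows "group (target Y)"
  unfolding target_def hnn_U_eq hnn_V_eq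
  using assms subgroup.subgroup_is_group[OF U_subgroup group.AutoGroup[OF H.subgroup_group]]
    subgroup.subgroup_is_group[OF V_subgroup group.AutoGroup[OF L.subgroup_group]]
    group.AutoGroup_acts_on_quotient(1)[OF H.subgroup_group subgroup.subset[OF U_subgroup] L_normal_H U_preserves_L]
    group.AutoGroup_acts_on[OF L.subgroup_group subgroup.subset[OF V_subgroup]]
    normal.factorgroup_is_group[OF L_normal_H] normal.factorgroup_is_group[OF KH_normal] L.subgroup_group
  by (intro wreath_group semidirect_group) auto

lemma target_in_class:
  assumes C: "root_class C" "quotient_closed C" and "B in_class C" "Y in_class C"
    and "hnn_U B H K \<phi> in_class C" "hnn_V B L \<phi> in_class C"
  shows "target Y in_class C"
proof -
  have quot: "(X Mod N) in_class C" if "X in_class C" "N \<lhd> X" for X :: "'b monoid" and N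
    by (rule in_class_hom_image[OF C that(1) normal.factorgroup_is_group[OF that(2)]
          normal.r_coset_hom_Mod[OF that(2)]]) (simp add: carrier_FactGroup)
  have sub: "BH in_class C" "BL in_class C"
    using in_class_subgroup[OF C(1) assms(3)] subgroups L.H by auto
  show ?thesis
    unfolding target_def
    using group.AutoGroup_acts_on_quotient(1)[OF H.subgroup_group subgroup.subset[OF U_subgroup] L_normal_H U_preserves_L]
      group.AutoGroup_acts_on[OF L.subgroup_group subgroup.subset[OF V_subgroup]]
      quot[OF sub(1) L_normal_H] quot[OF assms(3) KH_normal] sub assms
    by (intro wreath_in_class semidirect_in_class) (auto simp: hnn_U_eq hnn_V_eq)
qed

end

section \<open>The universal property of the HNN-extension\<close>

locale hnn_data = group B for B :: "('b, 'm) monoid_scheme" +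
  fixes H :: "'b set" and \<phi> :: "'b \<Rightarrow> 'b"
  assumes H_sub: "H \<subseteq> carrier B" and \<phi>_closed: "h \<in> H \<Longrightarrow> \<phi> h \<in> carrier B"
begin

abbreviation "E \<equiv> hnn_extension B H \<phi>"
abbreviation "words \<equiv> hnn_words B"
abbreviation "cls \<equiv> hnn_class B H \<phi>"
abbreviation "weq \<equiv> hnn_eq B H \<phi>"

lemma words_simps [simp]:
  "[] \<in> words" "u @ v \<in> words \<longleftrightarrow> u \<in> words \<and> v \<in> words"
  "Base b # w \<in> words \<longleftrightarrow> b \<in> carrier B \<and> w \<in> words"
  "Stable # w \<in> words \<longleftrightarrow> w \<in> words" "StableInv # w \<in> words \<longleftrightarrow> w \<in> words"
  by (auto simp: hnn_words_def)

lemma eq_words: "weq u v \<Longrightarrow> u \<in> words \<and> v \<in> words"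
  by (induction rule: hnn_eq.induct) (use H_sub \<phi>_closed in auto)

lemma cls_eq: "u \<in> words \<Longrightarrow> cls u = cls v \<longleftrightarrow> weq u v"
  unfolding hnn_class_def using hnn_eq.refl hnn_eq.sym hnn_eq.trans by (metis (mono_tags) Collect_cong mem_Collect_eq)

lemma E_carrier: "carrier E = cls ` words" and E_one: "\<one>\<^bsub>E\<^esub> = cls []"
  by (simp_all add: hnn_extension_def)

lemma E_mult: "u \<in> words \<Longrightarrow> v \<in> words \<Longrightarrow> cls u \<otimes>\<^bsub>E\<^esub> cls v = cls (u @ v)"
proof -
  assume uv: "u \<in> words" "v \<in> words"
  have app: "cls (u' @ v') = cls (u @ v)" if "u' \<in> cls u" "v' \<in> cls v" for u' v'
  proof -
    have "weq (u @ v) (u' @ v')" using that by (intro hnn_eq.append) (simp_all add: hnn_class_def)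
    then show ?thesis using uv cls_eq[of "u @ v" "u' @ v'"] by simp
  qed
  have ne: "cls u \<noteq> {}" "cls v \<noteq> {}" using uv hnn_eq.refl unfolding hnn_class_def by blast+
  have "cls u \<otimes>\<^bsub>E\<^esub> cls v = (\<Union>u' \<in> cls u. \<Union>v' \<in> cls v. cls (u' @ v'))"
    by (simp add: hnn_extension_def)
  also have "\<dots> = (\<Union>u' \<in> cls u. \<Union>v' \<in> cls v. cls (u @ v))"
    by (intro SUP_cong HOL.refl app)
  also have "\<dots> = cls (u @ v)" using ne by simp
  finally show ?thesis .
qed

definition "base_elt b = cls [Base b]"
definition "stable_elt = cls [Stable]"

lemma word_inverse: "w \<in> words \<Longrightarrow> \<exists>v \<in> words. weq (v @ w) []"
proof (induction w)
  case Nil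
  then show ?case using hnn_eq.refl[of "[]" B] by (intro bexI[of _ "[]"]) simp_all
next
  case (Cons a w)
  then obtain v where v: "v \<in> words" "weq (v @ w) []" by (cases a) auto
  have "\<exists>a'. [a'] \<in> words \<and> weq [a', a] []"
  proof (cases a)
    case (Base b)
    then have b: "b \<in> carrier B" using Cons by simp
    have "weq [Base (inv\<^bsub>B\<^esub> b), Base b] [Base \<one>\<^bsub>B\<^esub>]"
      using hnn_eq.base_mult[of "inv\<^bsub>B\<^esub> b" B b] b by simp
    then have "weq [Base (inv\<^bsub>B\<^esub> b), Base b] []" using hnn_eq.base_one hnn_eq.trans by metis
    then show ?thesis using b Base by (intro exI[of _ "Base (inv\<^bsub>B\<^esub> b)"]) simp
  qed (use hnn_eq.stable_left_inv hnn_eq.stable_right_inv in \<open>force+\<close>)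
  then obtain a' where a': "[a'] \<in> words" "weq [a', a] []" by blast
  have w: "w \<in> words" using Cons(2) by (cases a) auto
  have "weq (v @ [a', a] @ w) (v @ [] @ w)"
    using v(1) w a'(2) by (intro hnn_eq.append hnn_eq.refl)
  then have "weq ((v @ [a']) @ a # w) []" using v(2) hnn_eq.trans by fastforce
  then show ?case using v(1) a'(1) by (intro bexI[of _ "v @ [a']"]) auto
qed

lemma E_group: "group E"
proof (rule groupI)
  fix x assume "x \<in> carrier E"
  then obtain w where w: "w \<in> words" "x = cls w" by (auto simp: E_carrier)
  obtain v where v: "v \<in> words" "weq (v @ w) []" using word_inverse[OF w(1)] by blast
  then have "cls v \<otimes>\<^bsub>E\<^esub> x = \<one>\<^bsub>E\<^esub>" using w cls_eq[of "v @ w" "[]"] by (simp add: E_mult E_one)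
  then show "\<exists>y\<in>carrier E. y \<otimes>\<^bsub>E\<^esub> x = \<one>\<^bsub>E\<^esub>" using v by (auto simp: E_carrier)
qed (auto simp: E_carrier E_mult E_one)

lemma hnn_rep_E: "hnn_rep B H \<phi> E base_elt stable_elt"
  unfolding hnn_rep_def
proof (intro conjI ballI)
  show "base_elt \<in> hom B E"
    using hnn_eq.base_mult[of _ B] by (intro homI) (auto simp: E_carrier base_elt_def E_mult cls_eq hnn_eq.sym)
  show "stable_elt \<in> carrier E" by (auto simp: E_carrier stable_elt_def)
  fix h assume h: "h \<in> H"
  have hB: "h \<in> carrier B" "\<phi> h \<in> carrier B" using h H_sub \<phi>_closed by auto
  have "weq ([Stable, StableInv] @ [Base h, Stable]) ([] @ [Base h, Stable])"
    using hB by (intro hnn_eq.append hnn_eq.stable_right_inv hnn_eq.refl) auto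
  moreover have "weq ([Stable] @ [StableInv, Base h, Stable]) ([Stable] @ [Base (\<phi> h)])"
    using h by (intro hnn_eq.append hnn_eq.conj hnn_eq.refl) auto
  ultimately have "weq [Base h, Stable] [Stable, Base (\<phi> h)]"
    using hnn_eq.sym hnn_eq.trans by fastforce
  then show "base_elt h \<otimes>\<^bsub>E\<^esub> stable_elt = stable_elt \<otimes>\<^bsub>E\<^esub> base_elt (\<phi> h)"
    using hB by (simp add: base_elt_def stable_elt_def E_mult cls_eq)
qed

end

fun letter_val :: "('q, 'k) monoid_scheme \<Rightarrow> ('b \<Rightarrow> 'q) \<Rightarrow> 'q \<Rightarrow> 'b hnn_letter \<Rightarrow> 'q" where
  "letter_val Q \<beta> \<tau> (Base b) = \<beta> b"
| "letter_val Q \<beta> \<tau> Stable = \<tau>"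
| "letter_val Q \<beta> \<tau> StableInv = inv\<^bsub>Q\<^esub> \<tau>"

fun word_val :: "('q, 'k) monoid_scheme \<Rightarrow> ('b \<Rightarrow> 'q) \<Rightarrow> 'q \<Rightarrow> 'b hnn_letter list \<Rightarrow> 'q" where
  "word_val Q \<beta> \<tau> [] = \<one>\<^bsub>Q\<^esub>"
| "word_val Q \<beta> \<tau> (a # w) = letter_val Q \<beta> \<tau> a \<otimes>\<^bsub>Q\<^esub> word_val Q \<beta> \<tau> w"

locale hnn_representation = hnn_data B H \<phi> + Q: group Q
  for B :: "('b, 'm) monoid_scheme" and H \<phi> and Q :: "('q, 'k) monoid_scheme" +
  fixes \<beta> :: "'b \<Rightarrow> 'q" and \<tau> :: 'q
  assumes rep: "hnn_rep B H \<phi> Q \<beta> \<tau>"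
begin

sublocale \<beta>: group_hom B Q \<beta>
  using rep group_axioms Q.group_axioms by (simp add: hnn_rep_def group_hom_def group_hom_axioms_def)

lemma \<tau>_closed [simp]: "\<tau> \<in> carrier Q" and \<tau>_conj: "h \<in> H \<Longrightarrow> \<beta> h \<otimes>\<^bsub>Q\<^esub> \<tau> = \<tau> \<otimes>\<^bsub>Q\<^esub> \<beta> (\<phi> h)"
  using rep by (auto simp: hnn_rep_def)

lemma \<tau>_inv_conj:
  assumes "h \<in> H"
  shows "\<beta> (\<phi> h) \<otimes>\<^bsub>Q\<^esub> inv\<^bsub>Q\<^esub> \<tau> = inv\<^bsub>Q\<^esub> \<tau> \<otimes>\<^bsub>Q\<^esub> \<beta> h"
proof -
  have h: "\<beta> h \<in> carrier Q" "\<beta> (\<phi> h) \<in> carrier Q" using assms H_sub \<phi>_closed by auto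
  have "inv\<^bsub>Q\<^esub> \<tau> \<otimes>\<^bsub>Q\<^esub> (\<beta> h \<otimes>\<^bsub>Q\<^esub> \<tau>) \<otimes>\<^bsub>Q\<^esub> inv\<^bsub>Q\<^esub> \<tau> = \<beta> (\<phi> h) \<otimes>\<^bsub>Q\<^esub> inv\<^bsub>Q\<^esub> \<tau>"
    using h by (simp add: \<tau>_conj[OF assms])
  then show ?thesis using h by (simp add: Q.m_assoc)
qed

lemma letter_val_closed: "[a] \<in> words \<Longrightarrow> letter_val Q \<beta> \<tau> a \<in> carrier Q"
  by (cases a) auto

lemma word_val_closed: "w \<in> words \<Longrightarrow> word_val Q \<beta> \<tau> w \<in> carrier Q"
proof (induction w)
  case (Cons a w)
  then show ?case by (cases a) auto
qed simp

lemma word_val_append: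
  "u \<in> words \<Longrightarrow> v \<in> words \<Longrightarrow>
    word_val Q \<beta> \<tau> (u @ v) = word_val Q \<beta> \<tau> u \<otimes>\<^bsub>Q\<^esub> word_val Q \<beta> \<tau> v"
proof (induction u)
  case (Cons a u)
  then show ?case by (cases a) (auto simp: Q.m_assoc word_val_closed)
qed (simp add: word_val_closed)

lemma word_val_eq: "weq u v \<Longrightarrow> word_val Q \<beta> \<tau> u = word_val Q \<beta> \<tau> v"
proof (induction rule: hnn_eq.induct)
  case (append u u' v v')
  then show ?case using eq_words by (simp add: word_val_append)
next
  case (conj h)
  then have "h \<in> carrier B" "\<phi> h \<in> carrier B" using H_sub \<phi>_closed by auto
  then show ?case using conj by (simp add: \<tau>_conj)
qed auto

lemma ex_hom_E: "\<exists>f \<in> hom E Q. \<forall>w \<in> words. f (cls w) = word_val Q \<beta> \<tau> w"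
proof -
  define f where "f P = word_val Q \<beta> \<tau> (SOME w. w \<in> P)" for P
  have f: "f (cls w) = word_val Q \<beta> \<tau> w" if "w \<in> words" for w
  proof -
    have "w \<in> cls w" using that hnn_eq.refl by (simp add: hnn_class_def)
    then have "(SOME v. v \<in> cls w) \<in> cls w" by (rule someI)
    then have "weq w (SOME v. v \<in> cls w)" by (simp add: hnn_class_def)
    then show ?thesis using word_val_eq by (simp add: f_def)
  qed
  have "f \<in> hom E Q"
    by (rule homI) (auto simp: E_carrier E_mult f word_val_closed word_val_append)
  with f show ?thesis by blast
qed

end

context hnn_data begin

lemma representation_E: "hnn_representation B H \<phi> E base_elt stable_elt"
  by (intro hnn_representation.intro hnn_representation_axioms.intro hnn_data_axioms E_group hnn_rep_E)

lemma word_val_E: "w \<in> words \<Longrightarrow> word_val E base_elt stable_elt w = cls w"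
proof (induction w)
  case Nil
  then show ?case by (simp add: E_one)
next
  case (Cons a w)
  interpret hnn_representation B H \<phi> E base_elt stable_elt by (rule representation_E)
  have "inv\<^bsub>E\<^esub> stable_elt = cls [StableInv]"
  proof (rule Q.inv_equality)
    show "cls [StableInv] \<otimes>\<^bsub>E\<^esub> stable_elt = \<one>\<^bsub>E\<^esub>"
      using hnn_eq.stable_left_inv by (auto simp: stable_elt_def E_mult E_one cls_eq)
  qed (auto simp: E_carrier stable_elt_def)
  then have "letter_val E base_elt stable_elt a = cls [a]"
    by (cases a) (auto simp: base_elt_def stable_elt_def)
  then show ?case using Cons by (cases a) (auto simp: E_mult)
qed

end

section \<open>Automorphisms realized by conjugation\<close>

definition realizes :: "('n, 'm) monoid_scheme \<Rightarrow> ('q, 'k) monoid_scheme \<Rightarrow> ('n \<Rightarrow> 'q) \<Rightarrow> ('n \<Rightarrow> 'n) \<Rightarrow> 'q \<Rightarrow> bool" where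
  "realizes N Q \<beta> \<sigma> q \<longleftrightarrow> \<sigma> \<in> carrier (AutoGroup N) \<and> q \<in> carrier Q \<and>
     (\<forall>n \<in> carrier N. \<beta> (\<sigma> n) \<otimes>\<^bsub>Q\<^esub> q = q \<otimes>\<^bsub>Q\<^esub> \<beta> n)"

locale realization = N: group N + Q: group Q
  for N :: "('n, 'm) monoid_scheme" and Q :: "('q, 'k) monoid_scheme" +
  fixes \<beta> :: "'n \<Rightarrow> 'q"
  assumes \<beta>: "\<beta> \<in> hom N Q" "inj_on \<beta> (carrier N)"
begin

sublocale A: group "AutoGroup N" by (rule N.AutoGroup)

lemma \<beta>_closed [simp]: "n \<in> carrier N \<Longrightarrow> \<beta> n \<in> carrier Q"
  using \<beta> by (auto simp: hom_def)

lemma aut_closed: "\<sigma> \<in> carrier (AutoGroup N) \<Longrightarrow> n \<in> carrier N \<Longrightarrow> \<sigma> n \<in> carrier N"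
  by (auto simp: AutoGroup_carrier hom_def)

lemma realizes_one: "realizes N Q \<beta> \<one>\<^bsub>AutoGroup N\<^esub> \<one>\<^bsub>Q\<^esub>"
  using A.one_closed by (simp add: realizes_def) (simp add: AutoGroup_one)

lemma realizes_mult:
  assumes "realizes N Q \<beta> \<sigma> q" "realizes N Q \<beta> \<rho> r"
  shows "realizes N Q \<beta> (\<sigma> \<otimes>\<^bsub>AutoGroup N\<^esub> \<rho>) (q \<otimes>\<^bsub>Q\<^esub> r)"
proof -
  have "\<beta> (\<sigma> (\<rho> n)) \<otimes>\<^bsub>Q\<^esub> (q \<otimes>\<^bsub>Q\<^esub> r) = q \<otimes>\<^bsub>Q\<^esub> r \<otimes>\<^bsub>Q\<^esub> \<beta> n" if n: "n \<in> carrier N" for n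
  proof -
    have \<rho>n: "\<rho> n \<in> carrier N" and "\<sigma> (\<rho> n) \<in> carrier N"
      using assms n aut_closed by (auto simp: realizes_def)
    then have "\<beta> (\<sigma> (\<rho> n)) \<otimes>\<^bsub>Q\<^esub> (q \<otimes>\<^bsub>Q\<^esub> r) = q \<otimes>\<^bsub>Q\<^esub> (\<beta> (\<rho> n) \<otimes>\<^bsub>Q\<^esub> r)"
      using assms by (simp add: realizes_def flip: Q.m_assoc)
    also have "\<dots> = q \<otimes>\<^bsub>Q\<^esub> r \<otimes>\<^bsub>Q\<^esub> \<beta> n" using assms n by (simp add: realizes_def Q.m_assoc)
    finally show ?thesis .
  qed
  then show ?thesis
    using assms A.m_closed[of \<sigma> \<rho>] by (auto simp: realizes_def AutoGroup_mult compose_def)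
qed

lemma realizes_inv:
  assumes "realizes N Q \<beta> \<sigma> q"
  shows "realizes N Q \<beta> (inv\<^bsub>AutoGroup N\<^esub> \<sigma>) (inv\<^bsub>Q\<^esub> q)"
proof -
  let ?\<rho> = "inv\<^bsub>AutoGroup N\<^esub> \<sigma>"
  have \<sigma>: "\<sigma> \<in> carrier (AutoGroup N)" and q: "q \<in> carrier Q" using assms by (auto simp: realizes_def)
  have "\<beta> (?\<rho> n) \<otimes>\<^bsub>Q\<^esub> inv\<^bsub>Q\<^esub> q = inv\<^bsub>Q\<^esub> q \<otimes>\<^bsub>Q\<^esub> \<beta> n" if n: "n \<in> carrier N" for n
  proof -
    have \<rho>n: "?\<rho> n \<in> carrier N" using A.inv_closed[OF \<sigma>] aut_closed n by blast
    have "compose (carrier N) \<sigma> ?\<rho> = \<one>\<^bsub>AutoGroup N\<^esub>"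
      using A.r_inv[OF \<sigma>] AutoGroup_mult[OF \<sigma> A.inv_closed[OF \<sigma>]] by simp
    from fun_cong[OF this, of n] have "\<sigma> (?\<rho> n) = n"
      using n by (simp add: compose_def AutoGroup_one)
    then have "\<beta> n \<otimes>\<^bsub>Q\<^esub> q = q \<otimes>\<^bsub>Q\<^esub> \<beta> (?\<rho> n)" using assms \<rho>n by (metis realizes_def)
    then have "inv\<^bsub>Q\<^esub> q \<otimes>\<^bsub>Q\<^esub> (\<beta> n \<otimes>\<^bsub>Q\<^esub> q) \<otimes>\<^bsub>Q\<^esub> inv\<^bsub>Q\<^esub> q = \<beta> (?\<rho> n) \<otimes>\<^bsub>Q\<^esub> inv\<^bsub>Q\<^esub> q"
      using q \<rho>n by simp
    then show ?thesis using q n \<rho>n by (simp add: Q.m_assoc)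
  qed
  then show ?thesis using \<sigma> q by (simp add: realizes_def)
qed

lemma realizes_unique:
  assumes "realizes N Q \<beta> \<sigma> q" "realizes N Q \<beta> \<rho> q"
  shows "\<sigma> = \<rho>"
proof (rule extensionalityI[of _ "carrier N"])
  show "\<sigma> \<in> extensional (carrier N)" "\<rho> \<in> extensional (carrier N)"
    using assms by (auto simp: realizes_def AutoGroup_carrier)
  fix n assume n: "n \<in> carrier N"
  then have c: "\<sigma> n \<in> carrier N" "\<rho> n \<in> carrier N"
    using assms aut_closed by (auto simp: realizes_def)
  have "\<beta> (\<sigma> n) \<otimes>\<^bsub>Q\<^esub> q = \<beta> (\<rho> n) \<otimes>\<^bsub>Q\<^esub> q" using assms n by (simp add: realizes_def)
  then have "\<beta> (\<sigma> n) = \<beta> (\<rho> n)" using assms c by (simp add: realizes_def)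
  then show "\<sigma> n = \<rho> n" using \<beta>(2) c by (auto simp: inj_on_def)
qed

lemma realizable_subgroup: "subgroup {\<sigma>. \<exists>q. realizes N Q \<beta> \<sigma> q} (AutoGroup N)"
proof (rule A.subgroupI)
  show "{\<sigma>. \<exists>q. realizes N Q \<beta> \<sigma> q} \<subseteq> carrier (AutoGroup N)" by (auto simp: realizes_def)
qed (use realizes_one realizes_mult realizes_inv in blast)+

text \<open>
  The elements of \<open>Q\<close> that realize some automorphism from \<open>A\<close> form a subgroup, and it maps onto \<open>A\<close>
  because an automorphism is determined by an element realizing it.
\<close>

lemma realizable_in_class:
  assumes C: "root_class C" "quotient_closed C" and Q: "Q in_class C"
    and A: "subgroup A (AutoGroup N)" and real: "\<And>\<sigma>. \<sigma> \<in> A \<Longrightarrow> \<exists>q. realizes N Q \<beta> \<sigma> q"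
  shows "AutoGroup N\<lparr>carrier := A\<rparr> in_class C"
proof -
  define T where "T = {q. \<exists>\<sigma> \<in> A. realizes N Q \<beta> \<sigma> q}"
  have "subgroup T Q"
  proof (rule Q.subgroupI)
    show "T \<noteq> {}" using realizes_one subgroup.one_closed[OF A] by (auto simp: T_def)
    show "inv\<^bsub>Q\<^esub> q \<in> T" if "q \<in> T" for q
      using that realizes_inv subgroup.m_inv_closed[OF A] unfolding T_def by blast
    show "q \<otimes>\<^bsub>Q\<^esub> r \<in> T" if "q \<in> T" "r \<in> T" for q r
      using that realizes_mult subgroup.m_closed[OF A] unfolding T_def by blast
  qed (auto simp: T_def realizes_def)
  then have T: "Q\<lparr>carrier := T\<rparr> in_class C" by (rule in_class_subgroup[OF C(1) Q])
  define k where "k q = (THE \<sigma>. realizes N Q \<beta> \<sigma> q)" for q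
  have k: "k q = \<sigma>" if "realizes N Q \<beta> \<sigma> q" for \<sigma> q
    unfolding k_def using that realizes_unique by blast
  show ?thesis
  proof (rule in_class_hom_image[OF C T])
    show "group (AutoGroup N\<lparr>carrier := A\<rparr>)" by (rule subgroup.subgroup_is_group[OF A N.AutoGroup])
    show "k \<in> hom (Q\<lparr>carrier := T\<rparr>) (AutoGroup N\<lparr>carrier := A\<rparr>)"
    proof (rule homI)
      fix q r assume "q \<in> carrier (Q\<lparr>carrier := T\<rparr>)" "r \<in> carrier (Q\<lparr>carrier := T\<rparr>)"
      then obtain \<sigma> \<rho> where "realizes N Q \<beta> \<sigma> q" "realizes N Q \<beta> \<rho> r" by (auto simp: T_def)
      then show "k (q \<otimes>\<^bsub>Q\<lparr>carrier := T\<rparr>\<^esub> r) = k q \<otimes>\<^bsub>AutoGroup N\<lparr>carrier := A\<rparr>\<^esub> k r"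
        using k realizes_mult by simp
    qed (use k in \<open>auto simp: T_def\<close>)
    have "A \<subseteq> k ` T"
    proof
      fix \<sigma> assume \<sigma>: "\<sigma> \<in> A"
      obtain q where "realizes N Q \<beta> \<sigma> q" using real[OF \<sigma>] by blast
      then show "\<sigma> \<in> k ` T" using k[of \<sigma> q] \<sigma> by (intro image_eqI[of _ _ q]) (auto simp: T_def)
    qed
    moreover have "k ` T \<subseteq> A" using k by (auto simp: T_def)
    ultimately show "k ` carrier (Q\<lparr>carrier := T\<rparr>) = carrier (AutoGroup N\<lparr>carrier := A\<rparr>)" by auto
  qed
qed

end

context normal_hnn begin

lemma H_carrier: "H \<subseteq> carrier B" and \<phi>_carrier: "h \<in> H \<Longrightarrow> \<phi> h \<in> carrier B"
  using subgroup.subset subgroups \<phi>_img by auto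

sublocale hnn_data B H \<phi>
  using H_carrier \<phi>_carrier by (intro hnn_data.intro hnn_data_axioms.intro group_axioms)

text \<open>
  Conjugation by \<open>\<beta> b\<close> realizes the conjugations on \<open>H\<close> and on \<open>L\<close>.  Conjugation by \<open>\<tau> (\<beta> b) \<tau>\<inverse>\<close> realizes
  those on \<open>K\<close> carried back by \<open>\<phi>\<close>, and \<open>\<tau>\<inverse>\<close> realizes \<open>\<phi>\<close> on \<open>L\<close>.
\<close>

lemma U_V_in_class:
  assumes C: "root_class C" "quotient_closed C" and Q: "Q in_class C"
    and rep: "hnn_rep B H \<phi> Q \<beta> \<tau>" and inj: "inj_on \<beta> (carrier B)"
  shows "hnn_U B H K \<phi> in_class C" "hnn_V B L \<phi> in_class C"
proof -
  interpret hnn_representation B H \<phi> Q \<beta> \<tau>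
    using rep in_class_group[OF Q]
    by (intro hnn_representation.intro hnn_representation_axioms.intro hnn_data_axioms)
  have LH: "l \<in> H" "l \<in> carrier B" if "l \<in> L" for l using that L_sub H_carrier by auto
  interpret RH: realization BH Q \<beta>
    using H.subgroup_group Q.group_axioms \<beta>.homh H_carrier inj
    by (intro realization.intro realization_axioms.intro) (auto simp: hom_def Pi_iff subset_iff intro: inj_on_subset)
  interpret RL: realization BL Q \<beta>
    using L.subgroup_group Q.group_axioms \<beta>.homh LH inj
    by (intro realization.intro realization_axioms.intro) (auto simp: hom_def Pi_iff subset_iff intro: inj_on_subset)
  have conj: "\<beta> (b \<otimes>\<^bsub>B\<^esub> x \<otimes>\<^bsub>B\<^esub> inv\<^bsub>B\<^esub> b) \<otimes>\<^bsub>Q\<^esub> \<beta> b = \<beta> b \<otimes>\<^bsub>Q\<^esub> \<beta> x"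
    if "b \<in> carrier B" "x \<in> carrier B" for b x
    using that by (simp add: Q.m_assoc)
  have R1: "realizes BH Q \<beta> (conj_aut B H (\<lambda>x. x) b) (\<beta> b)" if "b \<in> carrier B" for b
    unfolding realizes_def
    using that H.conj_aut_AutoGroup[OF that] H.conj_aut[OF that] H_carrier conj by auto
  have R2: "realizes BH Q \<beta> (conj_aut B H \<phi> b) (\<tau> \<otimes>\<^bsub>Q\<^esub> \<beta> b \<otimes>\<^bsub>Q\<^esub> inv\<^bsub>Q\<^esub> \<tau>)" if b: "b \<in> carrier B" for b
    unfolding realizes_def
  proof (intro conjI ballI)
    fix h assume "h \<in> carrier BH"
    then have h: "h \<in> H" by simp
    let ?h = "conj_aut B H \<phi> b h"
    have h': "?h \<in> H" using K.conj_aut_closed[OF b h] .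
    have [simp]: "h \<in> carrier B" "?h \<in> carrier B" using h h' H_carrier by auto
    have "\<beta> ?h \<otimes>\<^bsub>Q\<^esub> (\<tau> \<otimes>\<^bsub>Q\<^esub> \<beta> b \<otimes>\<^bsub>Q\<^esub> inv\<^bsub>Q\<^esub> \<tau>) = (\<beta> ?h \<otimes>\<^bsub>Q\<^esub> \<tau>) \<otimes>\<^bsub>Q\<^esub> \<beta> b \<otimes>\<^bsub>Q\<^esub> inv\<^bsub>Q\<^esub> \<tau>"
      using b by (simp add: Q.m_assoc)
    also have "\<dots> = \<tau> \<otimes>\<^bsub>Q\<^esub> (\<beta> (b \<otimes>\<^bsub>B\<^esub> \<phi> h \<otimes>\<^bsub>B\<^esub> inv\<^bsub>B\<^esub> b) \<otimes>\<^bsub>Q\<^esub> \<beta> b) \<otimes>\<^bsub>Q\<^esub> inv\<^bsub>Q\<^esub> \<tau>"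
      unfolding \<tau>_conj[OF h'] K.conj_aut[OF b h] using b \<phi>_carrier[OF h] by (simp add: Q.m_assoc)
    also have "\<dots> = \<tau> \<otimes>\<^bsub>Q\<^esub> \<beta> b \<otimes>\<^bsub>Q\<^esub> (\<beta> (\<phi> h) \<otimes>\<^bsub>Q\<^esub> inv\<^bsub>Q\<^esub> \<tau>)"
      unfolding conj[OF b \<phi>_carrier[OF h]] using b \<phi>_carrier[OF h] by (simp add: Q.m_assoc)
    also have "\<dots> = \<tau> \<otimes>\<^bsub>Q\<^esub> \<beta> b \<otimes>\<^bsub>Q\<^esub> inv\<^bsub>Q\<^esub> \<tau> \<otimes>\<^bsub>Q\<^esub> \<beta> h"
      unfolding \<tau>_inv_conj[OF h] using b by (simp add: Q.m_assoc)
    finally show "\<beta> ?h \<otimes>\<^bsub>Q\<^esub> (\<tau> \<otimes>\<^bsub>Q\<^esub> \<beta> b \<otimes>\<^bsub>Q\<^esub> inv\<^bsub>Q\<^esub> \<tau>) = \<tau> \<otimes>\<^bsub>Q\<^esub> \<beta> b \<otimes>\<^bsub>Q\<^esub> inv\<^bsub>Q\<^esub> \<tau> \<otimes>\<^bsub>Q\<^esub> \<beta> h" .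
  qed (use b K.conj_aut_AutoGroup in auto)
  have "U_set \<subseteq> {\<sigma>. \<exists>q. realizes BH Q \<beta> \<sigma> q}"
    unfolding U_set_def
    by (rule RH.A.generate_subgroup_incl[OF _ RH.realizable_subgroup]) (use R1 R2 in blast)
  then show "hnn_U B H K \<phi> in_class C"
    unfolding hnn_U_eq by (intro RH.realizable_in_class[OF C Q U_subgroup]) auto
  have R3: "realizes BL Q \<beta> (conj_aut B L (\<lambda>x. x) b) (\<beta> b)" if "b \<in> carrier B" for b
    unfolding realizes_def
    using that L.conj_aut_AutoGroup[OF that] L.conj_aut[OF that] LH conj by auto
  have R4: "realizes BL Q \<beta> (restrict \<phi> L) (inv\<^bsub>Q\<^esub> \<tau>)"
    unfolding realizes_def using restrict_\<phi>_L LH \<tau>_inv_conj by auto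
  have "generate (AutoGroup BL) {restrict \<phi> L} \<subseteq> {\<sigma>. \<exists>q. realizes BL Q \<beta> \<sigma> q}"
    by (rule RL.A.generate_subgroup_incl[OF _ RL.realizable_subgroup]) (use R4 in blast)
  then have "V_set \<subseteq> {\<sigma>. \<exists>q. realizes BL Q \<beta> \<sigma> q}"
    unfolding V_set_def
    by (intro RL.A.generate_subgroup_incl[OF _ RL.realizable_subgroup]) (use R3 in blast)
  then show "hnn_V B L \<phi> in_class C"
    unfolding hnn_V_eq by (intro RL.realizable_in_class[OF C Q V_subgroup]) auto
qed

end

section \<open>Reduced forms and residuality\<close>

text \<open>
  A syllable \<open>(b, e)\<close> stands for \<open>b t\<close> or \<open>b t\<inverse>\<close>, according to \<open>e\<close>.  The head of a list is the last
  syllable of the product, so that the suffixes of the list are the initial segments of the product.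
\<close>

fun syl_val :: "('q, 'k) monoid_scheme \<Rightarrow> ('b \<Rightarrow> 'q) \<Rightarrow> 'q \<Rightarrow> ('b \<times> bool) list \<Rightarrow> 'q" where
  "syl_val Q \<beta> \<tau> [] = \<one>\<^bsub>Q\<^esub>"
| "syl_val Q \<beta> \<tau> ((b, e) # ws) = syl_val Q \<beta> \<tau> ws \<otimes>\<^bsub>Q\<^esub> \<beta> b \<otimes>\<^bsub>Q\<^esub> (if e then \<tau> else inv\<^bsub>Q\<^esub> \<tau>)"

fun reduced :: "'b set \<Rightarrow> 'b set \<Rightarrow> ('b \<times> bool) list \<Rightarrow> bool" where
  "reduced H K ((b, e) # (b', e') # ws) \<longleftrightarrow>
     (e \<and> \<not> e' \<longrightarrow> b \<notin> H) \<and> (\<not> e \<and> e' \<longrightarrow> b \<notin> K) \<and> reduced H K ((b', e') # ws)"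
| "reduced H K _ \<longleftrightarrow> True"

lemma reduced_tl: "reduced H K (s # ws) \<Longrightarrow> reduced H K ws"
  by (cases "(H, K, s # ws)" rule: reduced.cases) auto

context hnn_representation begin

abbreviation "val \<equiv> syl_val Q \<beta> \<tau>"
abbreviation "syls \<equiv> lists (carrier B \<times> (UNIV :: bool set))"

lemma val_closed: "ws \<in> syls \<Longrightarrow> val ws \<in> carrier Q"
  by (induction ws) auto

text \<open>
  Appending a letter to a reduced form either lengthens it or completes a subword \<open>t\<inverse> h t\<close> with
  \<open>h \<in> H\<close>, or \<open>t k t\<inverse>\<close> with \<open>k \<in> K\<close>, which is absorbed into the preceding base element.
\<close>

lemma reduced_form:
  assumes "w \<in> words"
  shows "\<exists>ws b. ws \<in> syls \<and> reduced H (\<phi> ` H) ws \<and> b \<in> carrier B \<and>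
    word_val Q \<beta> \<tau> w = val ws \<otimes>\<^bsub>Q\<^esub> \<beta> b"
  using assms
proof (induction w rule: rev_induct)
  case Nil
  show ?case by (intro exI[of _ "[]"] exI[of _ "\<one>\<^bsub>B\<^esub>"]) simp
next
  case (snoc a w)
  then obtain ws b where ws: "ws \<in> syls" "reduced H (\<phi> ` H) ws" and b: "b \<in> carrier B"
    and w: "word_val Q \<beta> \<tau> w = val ws \<otimes>\<^bsub>Q\<^esub> \<beta> b" by auto
  have vc: "val ws \<in> carrier Q" using val_closed ws by blast
  have wa: "w \<in> words" "[a] \<in> words" using snoc(2) by simp_all
  have eq: "word_val Q \<beta> \<tau> (w @ [a]) = val ws \<otimes>\<^bsub>Q\<^esub> \<beta> b \<otimes>\<^bsub>Q\<^esub> letter_val Q \<beta> \<tau> a"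
    using wa letter_val_closed[OF wa(2)] by (simp add: word_val_append w)
  show ?case
  proof (cases a)
    case (Base c)
    then have "c \<in> carrier B" using wa by simp
    then show ?thesis using ws b vc unfolding eq unfolding Base
      by (intro exI[of _ ws] exI[of _ "b \<otimes>\<^bsub>B\<^esub> c"]) (simp add: Q.m_assoc)
  next
    case Stable
    show ?thesis
    proof (cases "reduced H (\<phi> ` H) ((b, True) # ws)")
      case True
      then show ?thesis using ws b vc unfolding eq unfolding Stable
        by (intro exI[of _ "(b, True) # ws"] exI[of _ "\<one>\<^bsub>B\<^esub>"]) simp
    next
      case False
      then obtain c vs where vs: "ws = (c, False) # vs" and h: "b \<in> H"
        using ws by (cases ws) (auto split: if_splits)
      have c: "c \<in> carrier B" "vs \<in> syls" using ws vs by auto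
      have "val ws \<otimes>\<^bsub>Q\<^esub> \<beta> b \<otimes>\<^bsub>Q\<^esub> \<tau> = val vs \<otimes>\<^bsub>Q\<^esub> \<beta> c \<otimes>\<^bsub>Q\<^esub> inv\<^bsub>Q\<^esub> \<tau> \<otimes>\<^bsub>Q\<^esub> (\<beta> b \<otimes>\<^bsub>Q\<^esub> \<tau>)"
        using b c val_closed[of vs] by (simp add: vs Q.m_assoc)
      also have "\<dots> = val vs \<otimes>\<^bsub>Q\<^esub> \<beta> (c \<otimes>\<^bsub>B\<^esub> \<phi> b)"
        unfolding \<tau>_conj[OF h] using \<phi>_closed[OF h] c val_closed[of vs] by (simp add: Q.m_assoc)
      finally show ?thesis using reduced_tl[of H "\<phi> ` H" _ vs] ws c \<phi>_closed[OF h] unfolding eq unfolding Stable vs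
        by (intro exI[of _ vs] exI[of _ "c \<otimes>\<^bsub>B\<^esub> \<phi> b"]) auto
    qed
  next
    case StableInv
    show ?thesis
    proof (cases "reduced H (\<phi> ` H) ((b, False) # ws)")
      case True
      then show ?thesis using ws b vc unfolding eq unfolding StableInv
        by (intro exI[of _ "(b, False) # ws"] exI[of _ "\<one>\<^bsub>B\<^esub>"]) simp
    next
      case False
      then obtain c vs h where vs: "ws = (c, True) # vs" and h: "h \<in> H" "b = \<phi> h"
        using ws by (cases ws) (auto split: if_splits)
      have hB: "h \<in> carrier B" using h H_sub by auto
      have c: "c \<in> carrier B" "vs \<in> syls" using ws vs by auto
      have "val ws \<otimes>\<^bsub>Q\<^esub> \<beta> b \<otimes>\<^bsub>Q\<^esub> inv\<^bsub>Q\<^esub> \<tau> = val vs \<otimes>\<^bsub>Q\<^esub> \<beta> c \<otimes>\<^bsub>Q\<^esub> \<tau> \<otimes>\<^bsub>Q\<^esub> (\<beta> (\<phi> h) \<otimes>\<^bsub>Q\<^esub> inv\<^bsub>Q\<^esub> \<tau>)"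
        using b c val_closed[of vs] h by (simp add: vs Q.m_assoc)
      also have "\<dots> = val vs \<otimes>\<^bsub>Q\<^esub> \<beta> (c \<otimes>\<^bsub>B\<^esub> h)"
        unfolding \<tau>_inv_conj[OF h(1)] using hB c val_closed[of vs] by (simp add: Q.m_assoc)
      finally show ?thesis using reduced_tl[of H "\<phi> ` H" _ vs] ws c hB unfolding eq unfolding StableInv vs
        by (intro exI[of _ vs] exI[of _ "c \<otimes>\<^bsub>B\<^esub> h"]) auto
    qed
  qed
qed

end

lemma hom_syl_val:
  assumes "hnn_representation B H \<phi> W \<beta> \<tau>" "group Q" "f \<in> hom W Q"
    and "ws \<in> lists (carrier B \<times> (UNIV :: bool set))"
    and "\<And>b. b \<in> carrier B \<Longrightarrow> f (\<beta> b) = \<beta>' b" "f \<tau> = \<tau>'"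
  shows "f (syl_val W \<beta> \<tau> ws) = syl_val Q \<beta>' \<tau>' ws"
proof -
  interpret hnn_representation B H \<phi> W \<beta> \<tau> by fact
  interpret f: group_hom W Q f
    using assms Q.group_axioms by (simp add: group_hom_def group_hom_axioms_def)
  show ?thesis
    using assms(4)
  proof (induction ws rule: list.induct)
    case (Cons s ws)
    obtain b e where s: "s = (b, e)" by force
    have "b \<in> carrier B" "ws \<in> syls" using Cons(2) by (auto simp: s)
    then show ?case using Cons(1) val_closed[of ws] by (simp add: s assms(5,6))
  qed simp
qed

text \<open>
  Read along the word, the cosets \<open>v \<beta>(B)\<close> of the initial segments \<open>v\<close> are the vertices of a path in the
  graph obtained from the Bass-Serre tree by factoring out the kernel of the representation; its
  edges are the cosets of \<open>\<beta>(H)\<close>.  The condition says that the path does not visit a vertex twice.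
\<close>

fun separated :: "('b, 'm) monoid_scheme \<Rightarrow> ('q, 'k) monoid_scheme \<Rightarrow> ('b \<Rightarrow> 'q) \<Rightarrow> 'q \<Rightarrow> ('b \<times> bool) list \<Rightarrow> bool" where
  "separated B Q \<beta> \<tau> [] \<longleftrightarrow> True"
| "separated B Q \<beta> \<tau> (s # ws) \<longleftrightarrow> separated B Q \<beta> \<tau> ws \<and>
     (\<forall>vs. suffix vs ws \<longrightarrow> (\<forall>c \<in> carrier B. syl_val Q \<beta> \<tau> (s # ws) \<noteq> syl_val Q \<beta> \<tau> vs \<otimes>\<^bsub>Q\<^esub> \<beta> c))"

lemma separatedD:
  assumes "separated B Q \<beta> \<tau> ws" "suffix vs ws" "vs \<noteq> ws" "c \<in> carrier B"
  shows "syl_val Q \<beta> \<tau> ws \<noteq> syl_val Q \<beta> \<tau> vs \<otimes>\<^bsub>Q\<^esub> \<beta> c"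
  using assms by (cases ws) (auto simp: suffix_Cons)

lemma suffix_lists: "suffix vs ws \<Longrightarrow> ws \<in> lists A \<Longrightarrow> vs \<in> lists A"
  using set_mono_suffix by fastforce

lemma separated_pullback:
  assumes W: "hnn_representation B H \<phi> W \<beta> \<tau>" and Q: "group Q" and f: "f \<in> hom W Q"
    and ws: "ws \<in> lists (carrier B \<times> (UNIV :: bool set))"
    and f\<beta>: "\<And>b. b \<in> carrier B \<Longrightarrow> f (\<beta> b) = \<beta>' b" "f \<tau> = \<tau>'"
    and sep: "separated B Q \<beta>' \<tau>' ws"
  shows "separated B W \<beta> \<tau> ws"
  using ws sep
proof (induction ws rule: list.induct)
  case (Cons s ws)
  interpret hnn_representation B H \<phi> W \<beta> \<tau> by fact
  have "syl_val W \<beta> \<tau> (s # ws) \<noteq> syl_val W \<beta> \<tau> vs \<otimes>\<^bsub>W\<^esub> \<beta> c"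
    if vs: "suffix vs ws" and c: "c \<in> carrier B" for vs c
  proof
    have vsl: "vs \<in> syls" using suffix_lists[OF vs] Cons(2) by simp
    assume "syl_val W \<beta> \<tau> (s # ws) = syl_val W \<beta> \<tau> vs \<otimes>\<^bsub>W\<^esub> \<beta> c"
    then have "f (syl_val W \<beta> \<tau> (s # ws)) = f (syl_val W \<beta> \<tau> vs \<otimes>\<^bsub>W\<^esub> \<beta> c)" by (rule arg_cong)
    also have "\<dots> = f (syl_val W \<beta> \<tau> vs) \<otimes>\<^bsub>Q\<^esub> \<beta>' c"
      using hom_mult[OF f val_closed[OF vsl] \<beta>.hom_closed[OF c]] f\<beta>(1)[OF c] by simp
    finally have "syl_val Q \<beta>' \<tau>' (s # ws) = syl_val Q \<beta>' \<tau>' vs \<otimes>\<^bsub>Q\<^esub> \<beta>' c"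
      using hom_syl_val[OF W Q f vsl f\<beta>] hom_syl_val[OF W Q f Cons(2) f\<beta>] by metis
    then show False using Cons(3) vs c unfolding separated.simps by blast
  qed
  then show ?case using Cons by simp
qed simp

context hnn_representation begin

text \<open>
  Let the path of \<open>ws\<close> visit no vertex twice.  The edge traversed by one more syllable has the last
  vertex of the path as an end point, so that it occurs on the path only if it is the last edge of
  the path, traversed backwards.  This contradicts reducedness, because \<open>\<beta>\<close> is injective.  In the
  wreath product with \<open>Y\<close>, the stable letter can therefore be given the value \<open>y\<close> on this edge and the
  value \<open>1\<close> on all others.  Then the coordinate at \<open>1\<close> of every initial segment is trivial up to \<open>ws\<close> and
  nontrivial for the longer word, whose last vertex is thereby new.
\<close>

lemma separate_further:
  assumes HB: "subgroup H B" "subgroup (\<phi> ` H) B"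
    and Y: "group Y" "y \<in> carrier Y" "y \<noteq> \<one>\<^bsub>Y\<^esub>" and inj: "inj_on \<beta> (carrier B)"
    and sep: "separated B Q \<beta> \<tau> ws" and ws: "(b, e) # ws \<in> syls" and red: "reduced H (\<phi> ` H) ((b, e) # ws)"
  shows "\<exists>\<beta>' \<tau>'. hnn_representation B H \<phi> (wreath Y Q) \<beta>' \<tau>' \<and> inj_on \<beta>' (carrier B) \<and>
    separated B (wreath Y Q) \<beta>' \<tau>' ((b, e) # ws)"
proof -
  interpret Y: group Y by fact
  let ?W = "wreath Y Q"
  interpret W: group ?W by (rule wreath_group[OF Y(1) Q.group_axioms])
  have wsl: "ws \<in> syls" and b: "b \<in> carrier B" using ws by auto
  have vw: "val ws \<in> carrier Q" using val_closed[OF wsl] .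
  \<comment> \<open>\<open>g \<beta>(H)\<close> is the edge traversed by the new syllable: for \<open>t\<inverse>\<close> it starts at the new vertex.\<close>
  define g where "g = (if e then val ws \<otimes>\<^bsub>Q\<^esub> \<beta> b else val ws \<otimes>\<^bsub>Q\<^esub> \<beta> b \<otimes>\<^bsub>Q\<^esub> inv\<^bsub>Q\<^esub> \<tau>)"
  have g: "g \<in> carrier Q" using vw b by (simp add: g_def)
  define f where "f x = (if \<exists>h \<in> H. x = g \<otimes>\<^bsub>Q\<^esub> \<beta> h then y else \<one>\<^bsub>Y\<^esub>)" for x
  have f_closed [simp]: "f x \<in> carrier Y" for x using Y by (simp add: f_def)
  define \<beta>' where "\<beta>' c = (\<lambda>x \<in> carrier Q. \<one>\<^bsub>Y\<^esub>, \<beta> c)" for c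
  define \<tau>' where "\<tau>' = (\<lambda>x \<in> carrier Q. f x, \<tau>)"
  interpret Hs: subgroup H B by fact
  have hB: "h \<in> carrier B" "\<phi> h \<in> carrier B" if "h \<in> H" for h
    using that H_sub \<phi>_closed by auto
  have f_H: "f (x \<otimes>\<^bsub>Q\<^esub> \<beta> h) = f x" if x: "x \<in> carrier Q" and h: "h \<in> H" for x h
  proof -
    have "(\<exists>k \<in> H. x \<otimes>\<^bsub>Q\<^esub> \<beta> h = g \<otimes>\<^bsub>Q\<^esub> \<beta> k) \<longleftrightarrow> (\<exists>k \<in> H. x = g \<otimes>\<^bsub>Q\<^esub> \<beta> k)"
    proof
      assume "\<exists>k \<in> H. x \<otimes>\<^bsub>Q\<^esub> \<beta> h = g \<otimes>\<^bsub>Q\<^esub> \<beta> k"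
      then obtain k where k: "k \<in> H" "x \<otimes>\<^bsub>Q\<^esub> \<beta> h = g \<otimes>\<^bsub>Q\<^esub> \<beta> k" by blast
      have "x = (x \<otimes>\<^bsub>Q\<^esub> \<beta> h) \<otimes>\<^bsub>Q\<^esub> \<beta> (inv\<^bsub>B\<^esub> h)" using x hB[OF h] by (simp add: Q.m_assoc)
      also have "\<dots> = g \<otimes>\<^bsub>Q\<^esub> \<beta> (k \<otimes>\<^bsub>B\<^esub> inv\<^bsub>B\<^esub> h)" unfolding k(2) using g hB[OF h] hB[OF k(1)] by (simp add: Q.m_assoc)
      finally show "\<exists>k \<in> H. x = g \<otimes>\<^bsub>Q\<^esub> \<beta> k" using h k(1) by (intro bexI[of _ "k \<otimes>\<^bsub>B\<^esub> inv\<^bsub>B\<^esub> h"]) auto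
    next
      assume "\<exists>k \<in> H. x = g \<otimes>\<^bsub>Q\<^esub> \<beta> k"
      then obtain k where k: "k \<in> H" "x = g \<otimes>\<^bsub>Q\<^esub> \<beta> k" by blast
      have "x \<otimes>\<^bsub>Q\<^esub> \<beta> h = g \<otimes>\<^bsub>Q\<^esub> \<beta> (k \<otimes>\<^bsub>B\<^esub> h)" unfolding k(2) using g hB[OF h] hB[OF k(1)] by (simp add: Q.m_assoc)
      then show "\<exists>k \<in> H. x \<otimes>\<^bsub>Q\<^esub> \<beta> h = g \<otimes>\<^bsub>Q\<^esub> \<beta> k" using h k(1) by (intro bexI[of _ "k \<otimes>\<^bsub>B\<^esub> h"]) auto
    qed
    then show ?thesis by (simp add: f_def)
  qed
  have \<tau>': "\<tau>' \<in> carrier ?W" by (auto simp: \<tau>'_def)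
  have \<beta>': "\<beta>' \<in> hom B ?W" unfolding \<beta>'_def
    by (rule wreath_homI[OF Q.group_axioms \<beta>.homh]) simp_all
  have "hnn_rep B H \<phi> ?W \<beta>' \<tau>'"
    unfolding hnn_rep_def
  proof (intro conjI ballI \<beta>' \<tau>')
    fix h assume h: "h \<in> H"
    show "\<beta>' h \<otimes>\<^bsub>?W\<^esub> \<tau>' = \<tau>' \<otimes>\<^bsub>?W\<^esub> \<beta>' (\<phi> h)"
      using hB[OF h] f_H[OF _ h] \<tau>_conj[OF h]
      by (auto simp: \<beta>'_def \<tau>'_def wreath_mult[OF Q.group_axioms] intro!: restrict_ext)
  qed
  then have rep': "hnn_representation B H \<phi> ?W \<beta>' \<tau>'"
    by (intro hnn_representation.intro hnn_representation_axioms.intro hnn_data_axioms W.group_axioms)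
  interpret R: hnn_representation B H \<phi> ?W \<beta>' \<tau>' by (rule rep')
  have snd: "snd \<in> hom ?W Q" by (rule wreath_snd_hom[OF Q.group_axioms])
  have snd_val: "snd (R.val vs) = val vs" if "vs \<in> syls" for vs
    by (rule hom_syl_val[OF rep' Q.group_axioms snd that]) (simp_all add: \<beta>'_def \<tau>'_def)
  have inv_\<tau>': "inv\<^bsub>?W\<^esub> \<tau>' = (\<lambda>x \<in> carrier Q. inv\<^bsub>Y\<^esub> f (x \<otimes>\<^bsub>Q\<^esub> inv\<^bsub>Q\<^esub> \<tau>), inv\<^bsub>Q\<^esub> \<tau>)"
    by (rule W.inv_equality)
      (auto simp: \<tau>'_def wreath_mult[OF Q.group_axioms] intro!: restrict_ext)
  have step: "fst (R.val ((c, d) # vs)) \<one>\<^bsub>Q\<^esub> = fst (R.val vs) \<one>\<^bsub>Q\<^esub> \<otimes>\<^bsub>Y\<^esub>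
      (if d then f (val vs \<otimes>\<^bsub>Q\<^esub> \<beta> c) else inv\<^bsub>Y\<^esub> f (val vs \<otimes>\<^bsub>Q\<^esub> \<beta> c \<otimes>\<^bsub>Q\<^esub> inv\<^bsub>Q\<^esub> \<tau>))"
    if vs: "vs \<in> syls" and c: "c \<in> carrier B" for c d vs
  proof -
    obtain F where F: "R.val vs = (F, val vs)" using snd_val[OF vs] by (metis prod.collapse)
    have Fc: "F \<in> carrier Q \<rightarrow>\<^sub>E carrier Y" "val vs \<in> carrier Q"
      using R.val_closed[OF vs] by (auto simp: F)
    then have "F \<one>\<^bsub>Q\<^esub> \<in> carrier Y" by auto
    then show ?thesis
      using Fc(2) c by (simp add: F inv_\<tau>') (simp add: \<beta>'_def \<tau>'_def wreath_mult[OF Q.group_axioms])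
  qed
  \<comment> \<open>Vertices on the path are distinct, and their representatives are rigid as \<open>\<beta>\<close> is injective.\<close>
  have return: "vs = ws \<and> c = d"
    if vs: "suffix vs ws" and cd: "c \<in> carrier B" "d \<in> carrier B"
      and eq: "val vs \<otimes>\<^bsub>Q\<^esub> \<beta> c = val ws \<otimes>\<^bsub>Q\<^esub> \<beta> d" for vs c d
  proof -
    have vv: "val vs \<in> carrier Q" using val_closed suffix_lists[OF vs wsl] by blast
    have "val ws = (val ws \<otimes>\<^bsub>Q\<^esub> \<beta> d) \<otimes>\<^bsub>Q\<^esub> \<beta> (inv\<^bsub>B\<^esub> d)" using vw cd by (simp add: Q.m_assoc)
    also have "\<dots> = val vs \<otimes>\<^bsub>Q\<^esub> \<beta> (c \<otimes>\<^bsub>B\<^esub> inv\<^bsub>B\<^esub> d)"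
      unfolding eq[symmetric] using vv cd by (simp add: Q.m_assoc)
    finally have vs_eq: "vs = ws"
      using separatedD[OF sep vs, of "c \<otimes>\<^bsub>B\<^esub> inv\<^bsub>B\<^esub> d"] cd by auto
    then have "\<beta> c = \<beta> d" using eq vw cd by simp
    then show ?thesis using vs_eq inj cd by (auto simp: inj_on_def)
  qed
  have fresh: "f (if d then val vs \<otimes>\<^bsub>Q\<^esub> \<beta> c else val vs \<otimes>\<^bsub>Q\<^esub> \<beta> c \<otimes>\<^bsub>Q\<^esub> inv\<^bsub>Q\<^esub> \<tau>) = \<one>\<^bsub>Y\<^esub>"
    if suf: "suffix ((c, d) # vs) ws" for c d vs
  proof (rule ccontr)
    let ?g = "if d then val vs \<otimes>\<^bsub>Q\<^esub> \<beta> c else val vs \<otimes>\<^bsub>Q\<^esub> \<beta> c \<otimes>\<^bsub>Q\<^esub> inv\<^bsub>Q\<^esub> \<tau>"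
    assume "f ?g \<noteq> \<one>\<^bsub>Y\<^esub>"
    then obtain h where h: "h \<in> H" and gh: "?g = g \<otimes>\<^bsub>Q\<^esub> \<beta> h" by (auto simp: f_def split: if_splits)
    have cvs: "c \<in> carrier B" "vs \<in> syls" using suffix_lists[OF suf wsl] by auto
    have vv: "val vs \<in> carrier Q" using val_closed cvs by blast
    have suf': "suffix vs ws" "vs \<noteq> ws"
      using suf by (auto simp: suffix_def)
    have end_eq: "?g \<otimes>\<^bsub>Q\<^esub> \<tau> = g \<otimes>\<^bsub>Q\<^esub> \<tau> \<otimes>\<^bsub>Q\<^esub> \<beta> (\<phi> h)"
      unfolding gh using g hB[OF h] by (simp add: Q.m_assoc \<tau>_conj[OF h])
    show False
    proof (cases e; cases d)
      assume "e" "d"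
      then have "val vs \<otimes>\<^bsub>Q\<^esub> \<beta> c = val ws \<otimes>\<^bsub>Q\<^esub> \<beta> (b \<otimes>\<^bsub>B\<^esub> h)"
        using gh vw b hB[OF h] by (simp add: g_def Q.m_assoc)
      then show False using return[OF suf'(1) cvs(1)] suf'(2) b hB[OF h] by blast
    next
      assume ed: "e" "\<not> d"
      then have "val ((c, d) # vs) \<otimes>\<^bsub>Q\<^esub> \<beta> \<one>\<^bsub>B\<^esub> = val ws \<otimes>\<^bsub>Q\<^esub> \<beta> (b \<otimes>\<^bsub>B\<^esub> h)"
        using gh vw vv cvs b hB[OF h] by (simp add: g_def Q.m_assoc)
      then have "(c, d) # vs = ws" "\<one>\<^bsub>B\<^esub> = b \<otimes>\<^bsub>B\<^esub> h"
        using return[OF suf one_closed] b hB[OF h] by blast+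
      then have "b = inv\<^bsub>B\<^esub> h" using inv_equality[of b h] b hB[OF h] by simp
      then show False using red ed h \<open>(c, d) # vs = ws\<close> by auto
    next
      assume ed: "\<not> e" "d"
      then have "val ((c, d) # vs) \<otimes>\<^bsub>Q\<^esub> \<beta> \<one>\<^bsub>B\<^esub> = val ws \<otimes>\<^bsub>Q\<^esub> \<beta> (b \<otimes>\<^bsub>B\<^esub> \<phi> h)"
        using end_eq vw vv cvs b hB[OF h] by (simp add: g_def Q.m_assoc)
      then have "(c, d) # vs = ws" "\<one>\<^bsub>B\<^esub> = b \<otimes>\<^bsub>B\<^esub> \<phi> h"
        using return[OF suf one_closed] b hB[OF h] by blast+
      then have "b = inv\<^bsub>B\<^esub> \<phi> h" using inv_equality[of b "\<phi> h"] b hB[OF h] by simp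
      then have "b \<in> \<phi> ` H" using subgroup.m_inv_closed[OF HB(2)] h by blast
      then show False using red ed \<open>(c, d) # vs = ws\<close> by auto
    next
      assume ed: "\<not> e" "\<not> d"
      then have "val vs \<otimes>\<^bsub>Q\<^esub> \<beta> c = val ws \<otimes>\<^bsub>Q\<^esub> \<beta> (b \<otimes>\<^bsub>B\<^esub> \<phi> h)"
        using end_eq vw vv cvs b hB[OF h] by (simp add: g_def Q.m_assoc)
      then show False using return[OF suf'(1) cvs(1)] suf'(2) b hB[OF h] by blast
    qed
  qed
  have untouched: "fst (R.val vs) \<one>\<^bsub>Q\<^esub> = \<one>\<^bsub>Y\<^esub>" if "suffix vs ws" for vs
    using that
  proof (induction vs)
    case (Cons s vs)
    obtain c d where s: "s = (c, d)" by force
    have "suffix vs ws" using Cons(2) by (auto simp: suffix_def)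
    moreover have "s # vs \<in> syls" by (rule suffix_lists[OF Cons(2) wsl])
    ultimately show ?case using Cons step[of vs c d] fresh[of c d vs] by (auto simp: s)
  qed simp
  have "separated B ?W \<beta>' \<tau>' ((b, e) # ws)"
    unfolding separated.simps
  proof (intro conjI allI impI ballI notI)
    show "separated B ?W \<beta>' \<tau>' ws"
      by (rule separated_pullback[OF rep' Q.group_axioms snd wsl _ _ sep]) (simp_all add: \<beta>'_def \<tau>'_def)
    fix vs c assume vs: "suffix vs ws" and c: "c \<in> carrier B"
      and eq: "R.val ((b, e) # ws) = R.val vs \<otimes>\<^bsub>?W\<^esub> \<beta>' c"
    have vsl: "vs \<in> syls" by (rule suffix_lists[OF vs wsl])
    have "g = g \<otimes>\<^bsub>Q\<^esub> \<beta> \<one>\<^bsub>B\<^esub>" using g by simp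
    then have "f g = y" using Hs.one_closed unfolding f_def by metis
    then have "fst (R.val ((b, e) # ws)) \<one>\<^bsub>Q\<^esub> = (if e then y else inv\<^bsub>Y\<^esub> y)"
      using step[OF wsl b, of e] untouched[of ws] Y by (auto simp: g_def)
    then have "fst (R.val ((b, e) # ws)) \<one>\<^bsub>Q\<^esub> \<noteq> \<one>\<^bsub>Y\<^esub>"
      using Y by (auto simp: Y.inv_eq_1_iff)
    moreover have "fst (R.val vs \<otimes>\<^bsub>?W\<^esub> \<beta>' c) \<one>\<^bsub>Q\<^esub> = \<one>\<^bsub>Y\<^esub>"
    proof -
      obtain F where F: "R.val vs = (F, val vs)" using snd_val[OF vsl] by (metis prod.collapse)
      then show ?thesis
        using untouched[OF vs] val_closed[OF vsl] by (simp add: \<beta>'_def wreath_mult[OF Q.group_axioms])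
    qed
    ultimately show False using eq by simp
  qed
  moreover have "inj_on \<beta>' (carrier B)" using inj by (auto simp: inj_on_def \<beta>'_def)
  ultimately show ?thesis using rep' by blast
qed

end

lemma hnn_representation_transport:
  assumes R: "hnn_representation B H \<phi> W \<beta> \<tau>" and X: "group X" and k: "k \<in> iso W X"
  shows "hnn_representation B H \<phi> X (k \<circ> \<beta>) (k \<tau>)"
proof -
  interpret hnn_representation B H \<phi> W \<beta> \<tau> by fact
  interpret k: group_hom W X k
    using k X Q.group_axioms by (simp add: iso_def group_hom_def group_hom_axioms_def)
  have "k (\<beta> h) \<otimes>\<^bsub>X\<^esub> k \<tau> = k \<tau> \<otimes>\<^bsub>X\<^esub> k (\<beta> (\<phi> h))" if h: "h \<in> H" for h
    using arg_cong[OF \<tau>_conj[OF h], of k] h H_sub \<phi>_closed[OF h] by (simp add: subset_iff)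
  then have "hnn_rep B H \<phi> X (k \<circ> \<beta>) (k \<tau>)"
    unfolding hnn_rep_def using Group.hom_compose[OF \<beta>.homh k.homh] by simp
  then show ?thesis
    by (intro hnn_representation.intro hnn_representation_axioms.intro hnn_data_axioms X)
qed

text \<open>
  The construction is repeated syllable by syllable; all the groups that arise stay in \<open>C\<close>.
\<close>

lemma ex_separated:
  fixes C :: "'u monoid set"
  assumes C: "root_class C" and HB: "subgroup H B" "subgroup (\<phi> ` H) B"
    and ex: "Q \<in> C" "hnn_representation B H \<phi> Q \<beta> \<tau>" "inj_on \<beta> (carrier B)"
    and ws: "ws \<in> lists (carrier B \<times> (UNIV :: bool set))" "reduced H (\<phi> ` H) ws"
  shows "\<exists>Q \<in> C. \<exists>\<beta> \<tau>. hnn_representation B H \<phi> Q \<beta> \<tau> \<and> inj_on \<beta> (carrier B) \<and> separated B Q \<beta> \<tau> ws"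
  using ws
proof (induction ws rule: list.induct)
  case Nil
  then show ?case using ex by auto
next
  case (Cons s ws)
  obtain b e where s: "s = (b, e)" by force
  obtain Q \<beta> \<tau> where Q: "Q \<in> C" "hnn_representation B H \<phi> Q \<beta> \<tau>" "inj_on \<beta> (carrier B)"
    "separated B Q \<beta> \<tau> ws" using Cons reduced_tl[OF Cons(3)] by auto
  obtain Y y where "Y \<in> C" and Y: "group Y" "Y in_class C" "y \<in> carrier Y" "y \<noteq> \<one>\<^bsub>Y\<^esub>"
    using root_class_nontrivial[OF C] .
  obtain \<beta>' \<tau>' where R: "hnn_representation B H \<phi> (wreath Y Q) \<beta>' \<tau>'" "inj_on \<beta>' (carrier B)"
    "separated B (wreath Y Q) \<beta>' \<tau>' (s # ws)"
    using hnn_representation.separate_further[OF Q(2) HB Y(1,3,4) Q(3,4)] Cons(2,3) unfolding s by blast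
  have "Q in_class C" by (rule root_class_member_in_class[OF C Q(1)])
  then have Wc: "wreath Y Q in_class C" using wreath_in_class[OF C Y(2)] by blast
  obtain X k where X: "X \<in> C" "k \<in> iso (wreath Y Q) X" using in_classE[OF Wc] .
  have gX: "group X" by (rule root_class_member_group[OF C X(1)])
  interpret W: group "wreath Y Q" using in_class_group[OF Wc] .
  interpret R: hnn_representation B H \<phi> "wreath Y Q" \<beta>' \<tau>' by fact
  have kinj: "inj_on k (carrier (wreath Y Q))" using X(2) by (simp add: iso_def bij_betw_def)
  have kc: "\<beta>' ` carrier B \<subseteq> carrier (wreath Y Q)" using R.\<beta>.hom_closed by blast
  have R': "hnn_representation B H \<phi> X (k \<circ> \<beta>') (k \<tau>')"
    by (rule hnn_representation_transport[OF R(1) gX X(2)])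
  have "inj_on (k \<circ> \<beta>') (carrier B)" by (rule comp_inj_on[OF R(2) inj_on_subset[OF kinj kc]])
  moreover have "separated B X (k \<circ> \<beta>') (k \<tau>') (s # ws)"
  proof (rule separated_pullback[OF R' W.group_axioms _ Cons(2) _ _ R(3)])
    let ?i = "inv_into (carrier (wreath Y Q)) k"
    show "?i \<in> hom X (wreath Y Q)" using W.iso_set_sym[OF X(2)] by (simp add: iso_def)
    show "?i ((k \<circ> \<beta>') b) = \<beta>' b" if "b \<in> carrier B" for b
      using kinj R.\<beta>.hom_closed[OF that] by (simp del: wreath_carrier)
    show "?i (k \<tau>') = \<tau>'" using kinj R.\<tau>_closed by (simp del: wreath_carrier)
  qed
  ultimately show ?case using X(1) R' by blast
qed

lemma epi_onto_class_member:
  assumes C: "root_class C" and E: "group E" and Q: "Q in_class C" and f: "f \<in> hom E Q"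
  shows "\<exists>X \<in> C. \<exists>g \<in> epi E X. \<forall>x \<in> carrier E. \<forall>y \<in> carrier E. g x = g y \<longleftrightarrow> f x = f y"
proof -
  have gQ: "group Q" by (rule in_class_group[OF Q])
  let ?I = "Q\<lparr>carrier := f ` carrier E\<rparr>"
  have I: "?I in_class C" by (rule in_class_subgroup[OF C Q hom_image_subgroup[OF E gQ f]])
  obtain X k where X: "X \<in> C" "k \<in> iso ?I X" using in_classE[OF I] .
  have k: "k \<in> hom ?I X" "inj_on k (f ` carrier E)" "k ` f ` carrier E = carrier X"
    using X(2) by (auto simp: iso_def bij_betw_def)
  have "f \<in> hom E ?I" using f by (auto simp: hom_def)
  then have "k \<circ> f \<in> epi E X" using hom_compose[OF _ k(1)] k(3) by (auto simp: epi_def image_comp)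
  moreover have "(k \<circ> f) x = (k \<circ> f) y \<longleftrightarrow> f x = f y" if "x \<in> carrier E" "y \<in> carrier E" for x y
    using that inj_on_eq_iff[OF k(2)] by simp
  ultimately show ?thesis using X(1) by blast
qed

text \<open>
  An element of the base group survives in the given representation.  Any other element has a nonempty
  reduced form, and a representation that separates the vertices of its path does not map it into
  the base.
\<close>

lemma residually_of_injective_rep:
  fixes C :: "'u monoid set"
  assumes C: "root_class C" and HB: "subgroup H B" "subgroup (\<phi> ` H) B"
    and ex: "Q \<in> C" "hnn_representation B H \<phi> Q \<beta> \<tau>" "inj_on \<beta> (carrier B)"
  shows "residually (hnn_extension B H \<phi>) C"
  unfolding residually_def
proof (intro ballI impI)
  interpret D: hnn_data B H \<phi> using ex(2) by (simp add: hnn_representation_def)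
  interpret E: hnn_representation B H \<phi> D.E D.base_elt D.stable_elt by (rule D.representation_E)
  fix x assume x: "x \<in> carrier D.E" "x \<noteq> \<one>\<^bsub>D.E\<^esub>"
  then obtain w where w: "w \<in> D.words" "x = D.cls w" by (auto simp: D.E_carrier)
  then obtain ws b where ws: "ws \<in> lists (carrier B \<times> (UNIV :: bool set))" "reduced H (\<phi> ` H) ws"
    and b: "b \<in> carrier B" and x_eq: "x = E.val ws \<otimes>\<^bsub>D.E\<^esub> D.base_elt b"
    using E.reduced_form[OF w(1)] D.word_val_E[OF w(1)] by auto
  obtain Q' \<beta>' \<tau>' where Q': "Q' \<in> C" "hnn_representation B H \<phi> Q' \<beta>' \<tau>'" "inj_on \<beta>' (carrier B)"
    "separated B Q' \<beta>' \<tau>' ws"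
    using ex_separated[OF C HB ex ws] by blast
  interpret R: hnn_representation B H \<phi> Q' \<beta>' \<tau>' by fact
  obtain f where f: "f \<in> hom D.E Q'" "\<And>w. w \<in> D.words \<Longrightarrow> f (D.cls w) = word_val Q' \<beta>' \<tau>' w"
    using R.ex_hom_E by blast
  have f_base: "f (D.base_elt b) = \<beta>' b" if "b \<in> carrier B" for b
    using f(2)[of "[Base b]"] that by (simp add: D.base_elt_def)
  have f_stable: "f D.stable_elt = \<tau>'" using f(2)[of "[Stable]"] by (simp add: D.stable_elt_def)
  have "f (E.val ws) = R.val ws"
    by (rule hom_syl_val[OF D.representation_E R.Q.group_axioms f(1) ws(1) f_base f_stable])
  then have fx: "f x = R.val ws \<otimes>\<^bsub>Q'\<^esub> \<beta>' b"
    using hom_mult[OF f(1) E.val_closed[OF ws(1)] E.\<beta>.hom_closed[OF b]] f_base[OF b] x_eq by simp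
  have "f x \<noteq> \<one>\<^bsub>Q'\<^esub>"
  proof
    assume one: "f x = \<one>\<^bsub>Q'\<^esub>"
    have "R.val ws = R.val ws \<otimes>\<^bsub>Q'\<^esub> \<beta>' b \<otimes>\<^bsub>Q'\<^esub> \<beta>' (inv\<^bsub>B\<^esub> b)"
      using R.val_closed[OF ws(1)] b by (simp add: R.Q.m_assoc)
    then have v: "R.val ws = R.val [] \<otimes>\<^bsub>Q'\<^esub> \<beta>' (inv\<^bsub>B\<^esub> b)" using one fx by simp
    have "ws = []"
      using separatedD[OF Q'(4), of "[]" "inv\<^bsub>B\<^esub> b"] v b by auto
    then have "\<beta>' b = \<beta>' \<one>\<^bsub>B\<^esub>" using one fx b by simp
    then have "b = \<one>\<^bsub>B\<^esub>" using Q'(3) b by (auto simp: inj_on_def)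
    then show False using x(2) x_eq \<open>ws = []\<close> by simp
  qed
  moreover have "Q' in_class C" by (rule root_class_member_in_class[OF C Q'(1)])
  from epi_onto_class_member[OF C D.E_group this f(1)]
  obtain X g where X: "X \<in> C" "g \<in> epi D.E X"
    "\<forall>x \<in> carrier D.E. \<forall>y \<in> carrier D.E. g x = g y \<longleftrightarrow> f x = f y" by blast
  moreover have "g \<one>\<^bsub>D.E\<^esub> = \<one>\<^bsub>X\<^esub>" "f \<one>\<^bsub>D.E\<^esub> = \<one>\<^bsub>Q'\<^esub>"
    using hom_one[of g D.E X] hom_one[OF f(1) D.E_group R.Q.group_axioms] X(2) D.E_group
      root_class_member_group[OF C X(1)] by (auto simp: epi_def)
  ultimately have "g x \<noteq> \<one>\<^bsub>X\<^esub>" using x(1) E.Q.one_closed by metis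
  then show "\<exists>X \<in> C. \<exists>f \<in> epi D.E X. f x \<noteq> \<one>\<^bsub>X\<^esub>" using X(1,2) by blast
qed

theorem theorem1:
  fixes B :: "'b monoid" and H K L :: "'b set" and \<phi> :: "'b \<Rightarrow> 'b"
    and C :: "'u monoid set"
  assumes "H \<lhd> B" and "K \<lhd> B"
    and "\<phi> \<in> iso (B\<lparr>carrier := H\<rparr>) (B\<lparr>carrier := K\<rparr>)"
    and "L = H \<inter> K" and "\<phi> ` L = L"
    and "root_class C" and "quotient_closed C"
    and "B in_class C"
  shows "((\<exists>Q \<in> C. \<exists>f \<in> epi (hnn_extension B H \<phi>) Q. inj_on f (hnn_base B H \<phi>))
            \<longleftrightarrow> hnn_U B H K \<phi> in_class C \<and> hnn_V B L \<phi> in_class C)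
       \<and> ((\<exists>Q \<in> C. \<exists>f \<in> epi (hnn_extension B H \<phi>) Q. inj_on f (hnn_base B H \<phi>))
            \<longrightarrow> residually (hnn_extension B H \<phi>) C)
       \<and> (hnn_U B H K \<phi> in_class C \<and> hnn_V B L \<phi> in_class C
            \<longrightarrow> residually (hnn_extension B H \<phi>) C)"
proof -
  interpret normal_hnn B H K L \<phi>
    using assms in_class_group[OF assms(8)]
    by (intro normal_hnn.intro normal_hnn_axioms.intro)
  interpret E: hnn_representation B H \<phi> E base_elt stable_elt by (rule representation_E)
  note C = assms(6,7)
  obtain Y y where "Y \<in> C" and Y: "group Y" "Y in_class C" "y \<in> carrier Y" "y \<noteq> \<one>\<^bsub>Y\<^esub>"
    using root_class_nontrivial[OF C(1)] .
  obtain \<beta>\<^sub>0 \<tau>\<^sub>0 where rep\<^sub>0: "hnn_rep B H \<phi> (target Y) \<beta>\<^sub>0 \<tau>\<^sub>0" and inj\<^sub>0: "inj_on \<beta>\<^sub>0 (carrier B)"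
    using injective_hnn_rep[OF Y(1,3,4)] by blast
  interpret T: hnn_representation B H \<phi> "target Y" \<beta>\<^sub>0 \<tau>\<^sub>0
    using rep\<^sub>0 group_target[OF Y(1)]
    by (intro hnn_representation.intro hnn_representation_axioms.intro hnn_data_axioms)
  obtain F where F: "F \<in> hom E (target Y)" "\<And>w. w \<in> words \<Longrightarrow> F (cls w) = word_val (target Y) \<beta>\<^sub>0 \<tau>\<^sub>0 w"
    using T.ex_hom_E by blast
  have F_base: "F (base_elt b) = \<beta>\<^sub>0 b" if "b \<in> carrier B" for b
    using F(2)[of "[Base b]"] that by (simp add: base_elt_def)
  have base_inj: "inj_on base_elt (carrier B)"
    using inj\<^sub>0 F_base by (metis inj_on_def)
  have hnn_base: "hnn_base B H \<phi> = base_elt ` carrier B" by (simp add: hnn_base_def base_elt_def)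
  have F_inj: "inj_on F (hnn_base B H \<phi>)"
    using inj\<^sub>0 F_base unfolding hnn_base by (auto simp: inj_on_def)
  have base_sub: "hnn_base B H \<phi> \<subseteq> carrier E" using E.\<beta>.hom_closed unfolding hnn_base by blast
  let ?one = "\<exists>Q \<in> C. \<exists>f \<in> epi E Q. inj_on f (hnn_base B H \<phi>)"
  let ?two = "hnn_U B H K \<phi> in_class C \<and> hnn_V B L \<phi> in_class C"
  have from_one: "\<exists>Q \<in> C. \<exists>\<beta> \<tau>. hnn_representation B H \<phi> Q \<beta> \<tau> \<and> inj_on \<beta> (carrier B)" if one: ?one
  proof -
    obtain Q f where Q: "Q \<in> C" and f: "f \<in> epi E Q" "inj_on f (hnn_base B H \<phi>)" using one by blast
    have gQ: "group Q" by (rule root_class_member_group[OF C(1) Q])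
    have fh: "f \<in> hom E Q" using f(1) by (simp add: epi_def)
    interpret f: group_hom E Q f
      using fh gQ E_group by (simp add: group_hom_def group_hom_axioms_def)
    have "f (base_elt h) \<otimes>\<^bsub>Q\<^esub> f stable_elt = f stable_elt \<otimes>\<^bsub>Q\<^esub> f (base_elt (\<phi> h))" if h: "h \<in> H" for h
      using arg_cong[OF E.\<tau>_conj[OF h], of f] h H_carrier \<phi>_carrier[OF h] by (simp add: subset_iff)
    then have "hnn_rep B H \<phi> Q (f \<circ> base_elt) (f stable_elt)"
      unfolding hnn_rep_def using Group.hom_compose[OF E.\<beta>.homh fh] by simp
    then have "hnn_representation B H \<phi> Q (f \<circ> base_elt) (f stable_elt)"
      using gQ by (intro hnn_representation.intro hnn_representation_axioms.intro hnn_data_axioms)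
    moreover have "inj_on (f \<circ> base_elt) (carrier B)"
      using comp_inj_on[OF base_inj] f(2) by (simp add: hnn_base)
    ultimately show ?thesis using Q by blast
  qed
  have "?two" if one: ?one
  proof -
    obtain Q \<beta> \<tau> where Q: "Q \<in> C" "hnn_representation B H \<phi> Q \<beta> \<tau>" "inj_on \<beta> (carrier B)"
      using from_one[OF one] by blast
    have "Q in_class C" by (rule root_class_member_in_class[OF C(1) Q(1)])
    then show ?thesis
      using U_V_in_class[OF C _ hnn_representation.rep[OF Q(2)] Q(3)] by blast
  qed
  moreover have ?one if two: ?two
  proof -
    have "target Y in_class C" using target_in_class[OF C assms(8) Y(2)] two by blast
    from epi_onto_class_member[OF C(1) E_group this F(1)]
    obtain X g where X: "X \<in> C" "g \<in> epi E X"
      "\<forall>x \<in> carrier E. \<forall>y \<in> carrier E. g x = g y \<longleftrightarrow> F x = F y" by blast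
    have "inj_on g (hnn_base B H \<phi>)"
      using F_inj X(3) base_sub unfolding inj_on_def by blast
    then show ?thesis using X(1,2) by blast
  qed
  moreover have "residually E C" if one: ?one
    using from_one[OF one] residually_of_injective_rep[OF C(1) subgroups(1)] subgroups(2) \<phi>_img by metis
  ultimately show ?thesis by blast
qed

end
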